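(* Let $\Gamma$ be an equilateral metric graph with $n$ vertices, $N$ edges, common edge length $l_e$ and transition matrix $\mathcal{Z}$. Then the spectrum of the anti-standard Laplace operator $L^{a/st}(\Gamma)$ is given by $$\sigma(L^{a/st}(\Gamma))=\{0\}\cup\{\lambda>0:-\cos(\sqrt{\lambda}\,l_e)\in\sigma(\mathcal{Z})\}\cup\{\lambda>0:\cos(\sqrt{\lambda}\,l_e)=1\}.$$ The multiplicities of the eigenvalues are given by $$m(\lambda)=\begin{cases}N-n+1, & \text{if } \lambda=0 \text{ and } \Gamma \text{ is bipartite},\\ N-n, & \text{if } \lambda=0 \text{ and } \Gamma \text{ is non-bipartite},\\ \dim\ker(\mathcal{Z}+\cos(\sqrt{\lambda}\,l_e)I), & \text{if } \sin(\sqrt{\lambda}\,l_e)\neq 0,\\ N-n+2, & \text{if } \cos(\sqrt{\lambda}\,l_e)=-1,\\ N-n+2, & \text{if } \lambda>0,\ \cos(\sqrt{\lambda}\,l_e)=1 \text{ and } \Gamma \text{ is bipartite},\\ N-n, & \text{if } \lambda>0,\ \cos(\sqrt{\lambda}\,l_e)=1 \text{ and } \Gamma \text{ is non-bipartite},\end{cases}$$ where $I$ is an identity matrix.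
   Context: A metric graph $\Gamma$ consists of a finite vertex set $\mathcal{V}=\{v_1,\dots,v_n\}$ and a finite edge set $\mathcal{E}=\{e_1,\dots,e_N\}$; it is connected and simple (no loops, at most one edge between two vertices), and each edge $e_i$ has a length $l_{e_i}\in(0,\infty)$ and is identified with the interval $[0,l_{e_i}]$ (the endpoints $0$ and $l_{e_i}$ corresponding to the two vertices of $e_i$). $\Gamma$ is equilateral if all edges have the same length, denoted $l_e$. $\Gamma$ is bipartite if $\mathcal{V}$ is the disjoint union of two sets such that every edge has one endpoint in each. The adjacency matrix $\mathcal{A}=(a_{ij})_{n\times n}$ has $a_{ij}=1$ if $v_i,v_j$ are joined by an edge and $a_{ij}=0$ otherwise. The transition matrix is $\mathcal{Z}=\mathrm{Diag}(\mathcal{A}e)^{-1}\mathcal{A}$, where $e=(1,\dots,1)^{\top}\in\mathbb{R}^n$; $\sigma(\mathcal{Z})$ is its set of eigenvalues. $L^2(\Gamma)=\bigoplus_i L^2[0,l_{e_i}]$, and $f_i$ denotes the restriction of $f$ to $e_i$. The maximal domain consists of all $f\in L^2(\Gamma)$ with $f_i,f_i'$ (real-valued) absolutely continuous on $[0,l_{e_i}]$ for every $i$ and $-f''\in L^2(\Gamma)$. The anti-standard (anti-Kirchhoff) Laplace operator $L^{a/st}(\Gamma)$ acts by $f\mapsto -f''$ on each edge, with domain the functions $f$ in the maximal domain such that at every vertex $v$: the derivatives of $f$ at $v$ along all edges incident to $v$, each taken in the direction outgoing from $v$, coincide, and the sum over the edges incident to $v$ of the values of $f$ at $v$ is $0$.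 Its spectrum consists of isolated nonnegative eigenvalues of finite multiplicity; $m(\lambda)$ denotes the multiplicity of $\lambda$.
   Formalization: The spectrum formula fails for trees and for non-bipartite graphs with N = n (there m(0) = 0, e.g. a single edge); it is proved literally if N > n or N = n with Γ bipartite, and in general as those listed λ with m(λ) ≠ 0. At least one edge is assumed. *)

theory Defs
  imports "HOL-Analysis.Analysis" "HOL-Library.Function_Algebras"
begin

section \<open>Metric graphs and their matrices\<close>

text \<open>
  The vertex set is the whole finite type \<open>'v\<close>. A pair \<open>(u, v) \<in> E\<close> is an edge between \<open>u\<close> and \<open>v\<close>
  together with its parametrisation by \<open>[0, len (u, v)]\<close>: the endpoint \<open>0\<close> corresponds to \<open>u\<close>
  and the endpoint \<open>len (u, v)\<close> to \<open>v\<close>. Antisymmetry and irreflexivity make the graph simple and make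
  \<open>card E\<close> the number of edges. The edge set is nonempty: for the one-vertex graph without edges
  there is no edge length and the transition matrix does not exist.
\<close>

definition metric_graph :: "('v::finite \<times> 'v) set \<Rightarrow> ('v \<times> 'v \<Rightarrow> real) \<Rightarrow> bool" where
  "metric_graph E len \<longleftrightarrow>
     E \<noteq> {} \<and>
     (\<forall>u v. (u, v) \<in> E \<longrightarrow> u \<noteq> v \<and> (v, u) \<notin> E) \<and>
     (\<forall>u v. (u, v) \<in> (E \<union> E\<inverse>)\<^sup>*) \<and>
     (\<forall>e\<in>E. 0 < len e)"

definition equilateral :: "('v \<times> 'v) set \<Rightarrow> ('v \<times> 'v \<Rightarrow> real) \<Rightarrow> real \<Rightarrow> bool" where
  "equilateral E len l \<longleftrightarrow> (\<forall>e\<in>E. len e = l)"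

definition bipartite :: "('v \<times> 'v) set \<Rightarrow> bool" where
  "bipartite E \<longleftrightarrow>
     (\<exists>A B. A \<union> B = UNIV \<and> A \<inter> B = {} \<and>
        (\<forall>(u, v)\<in>E. (u \<in> A \<and> v \<in> B) \<or> (u \<in> B \<and> v \<in> A)))"

definition adjacency_matrix :: "('v::finite \<times> 'v) set \<Rightarrow> real^'v^'v" where
  "adjacency_matrix E = (\<chi> i j. if (i, j) \<in> E \<or> (j, i) \<in> E then 1 else 0)"

definition diag_matrix :: "real^'v \<Rightarrow> real^'v^'v" where
  "diag_matrix d = (\<chi> i j. if i = j then d $ i else 0)"

definition transition_matrix :: "('v::finite \<times> 'v) set \<Rightarrow> real^'v^'v" where
  "transition_matrix E =
     matrix_inv (diag_matrix (adjacency_matrix E *v vec 1)) ** adjacency_matrix E"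

definition eigenvalues :: "real^'v^'v \<Rightarrow> real set" where
  "eigenvalues A = {\<mu>. \<exists>x. x \<noteq> 0 \<and> A *v x = \<mu> *\<^sub>R x}"


section \<open>Functions on a metric graph\<close>

text \<open>
  A function \<open>f\<close> on the graph has the component \<open>f e\<close> on the edge \<open>e\<close>. Elements of \<open>L\<^sup>2(\<Gamma>)\<close> are
  represented by functions that vanish off the graph, and two representatives are identified by
  \<open>ae_eq\<close>. An element of the operator domain is represented by its unique continuous representative.
\<close>

type_synonym 'v gfun = "'v \<times> 'v \<Rightarrow> real \<Rightarrow> real"

global_interpretation gfun: vector_space "\<lambda>(c::real) (f::'v gfun) e x. c * f e x"
  by standard (simp_all add: fun_eq_iff algebra_simps)

definition L2 :: "('v \<times> 'v) set \<Rightarrow> ('v \<times> 'v \<Rightarrow> real) \<Rightarrow> 'v gfun set" where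
  "L2 E len =
     {f. (\<forall>e x. \<not> (e \<in> E \<and> x \<in> {0..len e}) \<longrightarrow> f e x = 0) \<and>
         (\<forall>e\<in>E. f e \<in> borel_measurable (lebesgue_on {0..len e}) \<and>
                 integrable (lebesgue_on {0..len e}) (\<lambda>x. (f e x)\<^sup>2))}"

definition L2_norm :: "('v \<times> 'v) set \<Rightarrow> ('v \<times> 'v \<Rightarrow> real) \<Rightarrow> 'v gfun \<Rightarrow> real" where
  "L2_norm E len f = sqrt (\<Sum>e\<in>E. integral\<^sup>L (lebesgue_on {0..len e}) (\<lambda>x. (f e x)\<^sup>2))"

definition ae_eq :: "('v \<times> 'v) set \<Rightarrow> ('v \<times> 'v \<Rightarrow> real) \<Rightarrow> 'v gfun \<Rightarrow> 'v gfun \<Rightarrow> bool" where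
  "ae_eq E len f g \<longleftrightarrow> (\<forall>e\<in>E. AE x in lebesgue_on {0..len e}. f e x = g e x)"

definition abs_cont_on :: "real \<Rightarrow> real \<Rightarrow> (real \<Rightarrow> real) \<Rightarrow> bool" where
  "abs_cont_on a b f \<longleftrightarrow>
     (\<forall>\<epsilon>>0. \<exists>\<delta>>0. \<forall>I.
        finite I \<and> (\<forall>(s, t)\<in>I. a \<le> s \<and> s \<le> t \<and> t \<le> b) \<and>
        pairwise (\<lambda>(s, t) (s', t'). {s<..<t} \<inter> {s'<..<t'} = {}) I \<and>
        (\<Sum>(s, t)\<in>I. t - s) < \<delta>
        \<longrightarrow> (\<Sum>(s, t)\<in>I. \<bar>f t - f s\<bar>) < \<epsilon>)"

text \<open>
  Edgewise derivative, one-sided at the endpoints. For \<open>f\<close> in the maximal domain the second derivative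
  \<open>gderiv E len (gderiv E len f)\<close> exists almost everywhere; its value elsewhere is arbitrary.
\<close>

definition gderiv :: "('v \<times> 'v) set \<Rightarrow> ('v \<times> 'v \<Rightarrow> real) \<Rightarrow> 'v gfun \<Rightarrow> 'v gfun" where
  "gderiv E len f = (\<lambda>e x. if e \<in> E \<and> x \<in> {0..len e}
     then vector_derivative (f e) (at x within {0..len e}) else 0)"

definition laplacian :: "('v \<times> 'v) set \<Rightarrow> ('v \<times> 'v \<Rightarrow> real) \<Rightarrow> 'v gfun \<Rightarrow> 'v gfun" where
  "laplacian E len f = - gderiv E len (gderiv E len f)"

definition maximal_domain :: "('v \<times> 'v) set \<Rightarrow> ('v \<times> 'v \<Rightarrow> real) \<Rightarrow> 'v gfun set" where
  "maximal_domain E len =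
     {f \<in> L2 E len.
        (\<forall>e\<in>E. abs_cont_on 0 (len e) (f e) \<and>
               f e differentiable_on {0..len e} \<and>
               abs_cont_on 0 (len e) (gderiv E len f e)) \<and>
        laplacian E len f \<in> L2 E len}"

definition incident :: "('v \<times> 'v) set \<Rightarrow> 'v \<Rightarrow> ('v \<times> 'v) set" where
  "incident E v = {e \<in> E. fst e = v \<or> snd e = v}"

definition vertex_value :: "('v \<times> 'v \<Rightarrow> real) \<Rightarrow> 'v gfun \<Rightarrow> 'v \<Rightarrow> 'v \<times> 'v \<Rightarrow> real" where
  "vertex_value len f v e = (if fst e = v then f e 0 else f e (len e))"

definition outgoing_deriv ::
    "('v \<times> 'v) set \<Rightarrow> ('v \<times> 'v \<Rightarrow> real) \<Rightarrow> 'v gfun \<Rightarrow> 'v \<Rightarrow> 'v \<times> 'v \<Rightarrow> real" where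
  "outgoing_deriv E len f v e =
     (if fst e = v then gderiv E len f e 0 else - gderiv E len f e (len e))"

definition anti_standard_domain ::
    "('v \<times> 'v) set \<Rightarrow> ('v \<times> 'v \<Rightarrow> real) \<Rightarrow> 'v gfun set" where
  "anti_standard_domain E len =
     {f \<in> maximal_domain E len. \<forall>v.
        (\<forall>e\<in>incident E v. \<forall>e'\<in>incident E v.
           outgoing_deriv E len f v e = outgoing_deriv E len f v e') \<and>
        (\<Sum>e\<in>incident E v. vertex_value len f v e) = 0}"


section \<open>Spectrum and multiplicity of the anti-standard Laplace operator\<close>

text \<open>
  \<open>\<mu>\<close> is in the resolvent set if \<open>L - \<mu>\<close> maps the domain bijectively onto \<open>L\<^sup>2(\<Gamma>)\<close> with bounded inverse.
\<close>

definition anti_standard_resolvent_set ::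
    "('v \<times> 'v) set \<Rightarrow> ('v \<times> 'v \<Rightarrow> real) \<Rightarrow> real set" where
  "anti_standard_resolvent_set E len =
     {\<mu>. (\<forall>g\<in>L2 E len. \<exists>!f. f \<in> anti_standard_domain E len \<and>
             ae_eq E len (\<lambda>e x. laplacian E len f e x - \<mu> * f e x) g) \<and>
          (\<exists>C. \<forall>f\<in>anti_standard_domain E len.
             L2_norm E len f \<le> C * L2_norm E len (\<lambda>e x. laplacian E len f e x - \<mu> * f e x))}"

definition anti_standard_spectrum ::
    "('v \<times> 'v) set \<Rightarrow> ('v \<times> 'v \<Rightarrow> real) \<Rightarrow> real set" where
  "anti_standard_spectrum E len = - anti_standard_resolvent_set E len"

definition anti_standard_eigenspace ::
    "('v \<times> 'v) set \<Rightarrow> ('v \<times> 'v \<Rightarrow> real) \<Rightarrow> real \<Rightarrow> 'v gfun set" where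
  "anti_standard_eigenspace E len \<mu> =
     {f \<in> anti_standard_domain E len.
        ae_eq E len (laplacian E len f) (\<lambda>e x. \<mu> * f e x)}"

definition anti_standard_mult ::
    "('v \<times> 'v) set \<Rightarrow> ('v \<times> 'v \<Rightarrow> real) \<Rightarrow> real \<Rightarrow> nat" where
  "anti_standard_mult E len \<mu> = gfun.dim (anti_standard_eigenspace E len \<mu>)"

end

(*
  On an edge, a function in the operator domain is determined by its value and derivative at the endpoint 0,
  through the solution formula for - f'' = mu f + g.  An eigenfunction is therefore encoded by its values a at
  the endpoints 0 of the edges and by the common outgoing derivatives y at the vertices.  If sin (sqrt mu l) is
  nonzero, a is a function of y and the vertex conditions say that y is an eigenvector of the transition matrix.
  If sin (sqrt mu l) = 0, the conditions on a and y decouple into the kernels of the (signless) incidence matrix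
  and of its transpose, whose dimensions are related by rank-nullity.  For mu <= 0, pairing the vertex conditions
  with y gives y = 0.

  Solving (L - mu) f = g is a square linear system for the initial data of f on the edges, so mu is in the
  resolvent set as soon as the eigenspace is trivial.

  For g in L2 the solution formula rests on Lebesgue's theorem that an absolutely continuous function is
  differentiable almost everywhere and is the integral of its derivative.  Differentiability follows from a
  double Vitali covering: where the slopes oscillate between r < s, disjoint intervals of slope >= s nearly
  exhaust disjoint intervals of slope <= r, and the leftover contributes little by absolute continuity.
*)

theory Submission
  imports Defs
begin

section \<open>Coverings by intervals\<close>

text \<open>The union in the theorem lists candidates whose multiplicity may vanish. On a tree N - n
  + 1 = 0, so 0 is not an eigenvalue; on a non-bipartite graph with N = n, neither 0 nor any \<mu> >
  0 with cosine 1 is an eigenvalue. Connectedness gives N \<ge> n - 1, so there are no other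
  exceptions: outside them the union is the spectrum, and in general it has to be intersected with
  the points of nonzero multiplicity. The second derivative of a solution then exists only almost
  everywhere, which is what brings in the measure theory. The functions \<open>cosf\<close> and
  \<open>sinf\<close> hide the sign of \<mu>, so that the single relation
  \<open>cosf_sinf_identity\<close> serves positive, zero and negative \<mu> alike.\<close>

definition small_cover :: "real set \<Rightarrow> (real \<times> real) set \<Rightarrow> bool" where
  "small_cover S K \<longleftrightarrow> (\<forall>x\<in>S. \<forall>d>0. \<exists>(y, z)\<in>K. x \<in> {y..z} \<and> z - y < d)"

definition separated_intervals :: "(real \<times> real) set \<Rightarrow> bool" where
  "separated_intervals F \<longleftrightarrow>
     (\<forall>i\<in>F. \<forall>j\<in>F. i \<noteq> j \<longrightarrow> {fst i..snd i} \<inter> {fst j..snd j} = {})"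

text \<open>This is the disjointness used in \<open>abs_cont_on\<close>. Pieces of a tagged division
  may share endpoints, so they are nonoverlapping without being separated.\<close>

definition nonoverlapping :: "(real \<times> real) set \<Rightarrow> bool" where
  "nonoverlapping F \<longleftrightarrow>
     (\<forall>i\<in>F. \<forall>j\<in>F. i \<noteq> j \<longrightarrow> {fst i<..<snd i} \<inter> {fst j<..<snd j} = {})"

lemma separated_intervals_subset: "separated_intervals F \<Longrightarrow> G \<subseteq> F \<Longrightarrow> separated_intervals G"
  unfolding separated_intervals_def by blast

lemma nonoverlapping_subset: "nonoverlapping F \<Longrightarrow> G \<subseteq> F \<Longrightarrow> nonoverlapping G"
  unfolding nonoverlapping_def by blast

lemma separated_intervals_imp_nonoverlapping: "separated_intervals F \<Longrightarrow> nonoverlapping F"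
  unfolding separated_intervals_def nonoverlapping_def
  by (meson disjoint_iff greaterThanLessThan_subseteq_atLeastAtMost_iff order_refl subset_iff)

lemma nonoverlapping_iff_pairwise:
  "nonoverlapping F \<longleftrightarrow> pairwise (\<lambda>(s, t) (s', t'). {s<..<t} \<inter> {s'<..<t'} = {}) F"
  unfolding nonoverlapping_def pairwise_def by (simp add: case_prod_unfold)

text \<open>A closed interval is the closed ball around its midpoint, so the ball version of
  Vitali's covering theorem applies.\<close>

lemma Vitali_covering_intervals:
  fixes K :: "(real \<times> real) set"
  assumes K: "\<And>y z. (y, z) \<in> K \<Longrightarrow> y < z" and S: "small_cover S K"
  obtains C where "countable C" "C \<subseteq> K"
    "separated_intervals C"
    "negligible (S - (\<Union>(y, z)\<in>C. {y..z}))"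
proof -
  define a where "a = (\<lambda>(y::real, z). (y + z) / 2)"
  define r where "r = (\<lambda>(y::real, z). (z - y) / 2)"
  have cb: "cball (a i) (r i) = (case i of (y, z) \<Rightarrow> {y..z})" for i
    by (cases i) (auto simp: a_def r_def dist_real_def abs_if field_simps split: if_splits)
  obtain C where C: "countable C" "C \<subseteq> K"
     "pairwise (\<lambda>i j. disjnt (cball (a i) (r i)) (cball (a j) (r j))) C"
     "negligible(S - (\<Union>i \<in> C. cball (a i) (r i)))"
  proof (rule Vitali_covering_theorem_cballs [of K r S a])
    show "0 < r i" if "i \<in> K" for i
      using K that by (cases i) (auto simp: r_def)
    show "\<exists>i. i \<in> K \<and> x \<in> cball (a i) (r i) \<and> r i < d" if x: "x \<in> S" "0 < d" for x d
    proof -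
      obtain y z where "(y, z) \<in> K" "x \<in> {y..z}" "z - y < d"
        using S x unfolding small_cover_def by blast
      then show ?thesis
        unfolding cb using K[of y z] by (intro exI[of _ "(y, z)"]) (auto simp: r_def)
    qed
  qed
  show thesis
  proof (rule that[OF C(1,2)])
    show "separated_intervals C"
      using C(3) unfolding cb disjnt_def pairwise_def separated_intervals_def by (simp add: case_prod_unfold)
    show "negligible (S - (\<Union>(y, z)\<in>C. {y..z}))"
      using C(4) unfolding cb by (simp add: case_prod_unfold)
  qed
qed

text \<open>The countable Vitali family lies in \<open>{a..b}\<close>, so it has a tail of small
  measure, which is moved into \<open>T\<close>. The finitely many endpoints and the uncovered null
  set go there too. What remains of \<open>S\<close> then lies in open intervals, which leaves room
  for a second covering inside them.\<close>

lemma finite_Vitali_intervals: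
  fixes K :: "(real \<times> real) set"
  assumes K: "\<And>y z. (y, z) \<in> K \<Longrightarrow> y < z \<and> {y..z} \<subseteq> {a..b}" and S: "small_cover S K" and e: "0 < e"
  obtains F T where "finite F" "F \<subseteq> K"
    "separated_intervals F"
    "S \<subseteq> T \<union> (\<Union>(y, z)\<in>F. {y<..<z})" "T \<in> lmeasurable" "measure lebesgue T < e"
proof -
  obtain C where C: "countable C" "C \<subseteq> K"
    "separated_intervals C"
    "negligible (S - (\<Union>(y, z)\<in>C. {y..z}))"
    by (rule Vitali_covering_intervals[OF _ S]) (use K in auto)
  define I where "I = (\<lambda>(y::real, z). {y..z})"
  have Im: "I i \<in> lmeasurable" for i by (cases i) (simp add: I_def)
  show thesis
  proof (cases "C = {}")
    case True
    show ?thesis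
    proof (rule that[of "{}" S])
      have N: "negligible S" using C(4) True by simp
      show "S \<in> lmeasurable" "measure lebesgue S < e"
        using N e by (auto simp: negligible_imp_measurable negligible_imp_measure0)
    qed (auto simp: separated_intervals_def)
  next
    case False
    define D where "D n = \<Union> (I ` C) - \<Union> (I ` from_nat_into C ` {..<n})" for n :: nat
    have inn: "from_nat_into C n \<in> C" for n by (rule from_nat_into[OF False])
    have UCm: "\<Union> (I ` C) \<in> sets lebesgue"
      using C(1) Im by (intro sets.countable_UN'') (auto simp: fmeasurableD)
    have UC: "\<Union> (I ` C) \<in> lmeasurable"
    proof (rule fmeasurableI2[of "{a..b}"])
      show "\<Union> (I ` C) \<subseteq> {a..b}" using C(2) K unfolding I_def by fastforce
    qed (use UCm in auto)
    have UF: "\<Union> (I ` from_nat_into C ` {..<n}) \<in> lmeasurable" for n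
      using Im by (intro fmeasurable.finite_Union) auto
    have Dm: "D n \<in> lmeasurable" for n
      unfolding D_def by (intro fmeasurable.Diff UC UF)
    have "(\<lambda>n. measure lebesgue (D n)) \<longlonglongrightarrow> measure lebesgue (\<Inter>n. D n)"
    proof (rule Lim_measure_decseq)
      show "range D \<subseteq> sets lebesgue" using Dm by auto
      show "decseq D" by (auto simp: decseq_def D_def)
      show "emeasure lebesgue (D i) \<noteq> \<infinity>" for i using Dm[of i] by (auto simp: fmeasurable_def)
    qed
    moreover have "(\<Inter>n. D n) = {}"
    proof -
      have "\<exists>n. x \<notin> D n" for x
      proof (cases "x \<in> \<Union> (I ` C)")
        case True
        then obtain i where i: "i \<in> C" "x \<in> I i" by auto
        then obtain k where "from_nat_into C k = i" using from_nat_into_surj[OF C(1)] by blast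
        then have "x \<notin> D (Suc k)" using i by (auto simp: D_def)
        then show ?thesis by blast
      qed (auto simp: D_def)
      then show ?thesis by auto
    qed
    ultimately have "(\<lambda>n. measure lebesgue (D n)) \<longlonglongrightarrow> 0" by simp
    then obtain n where n: "measure lebesgue (D n) < e"
      using e by (metis (mono_tags, lifting) eventually_sequentially le_refl order_tendstoD(2))
    define F where "F = from_nat_into C ` {..<n}"
    define P where "P = fst ` F \<union> snd ` F \<union> (S - \<Union> (I ` C))"
    have fF: "finite F" by (simp add: F_def)
    have negP: "negligible P"
    proof -
      have "negligible (S - \<Union> (I ` C))" using C(4) by (simp add: I_def)
      then show ?thesis
        unfolding P_def using fF by (simp add: negligible_Un negligible_finite)
    qed
    show ?thesis
    proof (rule that[of F "D n \<union> P"])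
      show FK: "F \<subseteq> K" using C(2) inn by (auto simp: F_def)
      show "separated_intervals F"
        by (rule separated_intervals_subset[OF C(3)]) (use inn in \<open>auto simp: F_def\<close>)
      show "S \<subseteq> D n \<union> P \<union> (\<Union>(y, z)\<in>F. {y<..<z})"
      proof
        fix x assume "x \<in> S"
        show "x \<in> D n \<union> P \<union> (\<Union>(y, z)\<in>F. {y<..<z})"
        proof (cases "x \<in> \<Union> (I ` C) \<and> x \<notin> D n")
          case True
          then obtain i where i: "i \<in> F" "x \<in> I i" unfolding D_def F_def by blast
          show ?thesis
          proof (cases "x = fst i \<or> x = snd i")
            case True then show ?thesis using i by (auto simp: P_def)
          next
            case False then show ?thesis using i by (auto simp: I_def split: prod.splits intro!: bexI[of _ i])
          qed
        qed (use \<open>x \<in> S\<close> in \<open>auto simp: P_def\<close>)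
      qed
      show "D n \<union> P \<in> lmeasurable"
        using Dm negP by (intro fmeasurable.Un) (auto simp: negligible_imp_measurable)
      have "measure lebesgue (D n \<union> P) \<le> measure lebesgue (D n) + measure lebesgue P"
        by (rule measure_Un_le) (use Dm negP negligible_imp_sets in auto)
      then show "measure lebesgue (D n \<union> P) < e"
        using n negP by (simp add: negligible_imp_measure0)
    qed (rule fF)
  qed
qed

lemma measure_disjoint_intervals:
  fixes F :: "(real \<times> real) set"
  assumes "finite F" "\<And>y z. (y, z) \<in> F \<Longrightarrow> y \<le> z"
    "separated_intervals F"
  shows "measure lebesgue (\<Union>(y, z)\<in>F. {y..z}) = (\<Sum>(y, z)\<in>F. z - y)"
proof -
  have "measure lebesgue (\<Union>i\<in>F. {fst i..snd i}) = (\<Sum>i\<in>F. measure lebesgue {fst i..snd i})"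
    using assms by (intro measure_finite_Union) (auto simp: disjoint_family_on_def separated_intervals_def simp del: Int_atLeastAtMost atLeastatMost_empty_iff)
  also have "\<dots> = (\<Sum>i\<in>F. snd i - fst i)"
    using assms(2) by (intro sum.cong) auto
  finally show ?thesis by (simp add: case_prod_unfold)
qed

text \<open>\<open>H\<close> consists of the gaps that \<open>G\<close> leaves in \<open>F\<close>.
  The induction removes one interval of \<open>G\<close> at a time from the gap containing it; the
  clause on intervals avoiding \<open>G\<close> is what locates that gap. The last clause is
  telescoping, stated for all functions because it is applied both to the identity (total length)
  and to the function under study.\<close>

lemma complementary_intervals:
  fixes F :: "(real \<times> real) set"
  assumes "finite G" "finite F" "\<And>i. i \<in> F \<Longrightarrow> fst i < snd i" "separated_intervals F"
    and "\<And>i. i \<in> G \<Longrightarrow> fst i < snd i \<and> (\<exists>j\<in>F. {fst i..snd i} \<subseteq> {fst j<..<snd j})"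
    and "separated_intervals G"
  shows "\<exists>H. finite H \<and> (\<forall>i\<in>H. fst i < snd i \<and> (\<exists>j\<in>F. fst j \<le> fst i \<and> snd i \<le> snd j)) \<and>
     nonoverlapping H \<and>
     (\<forall>j\<in>F. \<forall>s t. s \<le> t \<and> {s..t} \<subseteq> {fst j<..<snd j} \<and> (\<forall>i\<in>G. {s..t} \<inter> {fst i..snd i} = {})
        \<longrightarrow> (\<exists>i\<in>H. fst i < s \<and> t < snd i)) \<and>
     (\<forall>\<phi> :: real \<Rightarrow> real. (\<Sum>i\<in>H. \<phi> (snd i) - \<phi> (fst i)) =
        (\<Sum>i\<in>F. \<phi> (snd i) - \<phi> (fst i)) - (\<Sum>i\<in>G. \<phi> (snd i) - \<phi> (fst i)))"
    (is "\<exists>H. ?P G H")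
  using assms(1,5,6)
proof (induction G)
  case empty
  have "\<exists>i\<in>F. fst i < s \<and> t < snd i" if "j \<in> F" "s \<le> t" "{s..t} \<subseteq> {fst j<..<snd j}" for j s t
    using that by (intro bexI[of _ j]) (auto simp: subset_eq)
  then show ?case
    using assms(2-4) separated_intervals_imp_nonoverlapping
    by (intro exI[of _ F] conjI ballI allI impI) (auto intro: bexI)
next
  case (insert J G)
  define s t where "s = fst J" and "t = snd J"
  have "\<exists>H. ?P G H"
    by (rule insert.IH) (use insert.prems separated_intervals_subset in blast)+
  then obtain H where H: "?P G H" by blast
  note fH = H[THEN conjunct1]
    and H1 = H[THEN conjunct2, THEN conjunct1, rule_format]
    and H2 = H[THEN conjunct2, THEN conjunct2, THEN conjunct1]
    and H3 = H[THEN conjunct2, THEN conjunct2, THEN conjunct2, THEN conjunct1, rule_format]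
    and H4 = H[THEN conjunct2, THEN conjunct2, THEN conjunct2, THEN conjunct2, rule_format]
  obtain j0 where st: "s < t" "j0 \<in> F" "{s..t} \<subseteq> {fst j0<..<snd j0}"
    using insert.prems(1)[of J] by (auto simp: s_def t_def)
  have disj: "\<forall>i\<in>G. {s..t} \<inter> {fst i..snd i} = {}"
    using insert.prems(2) insert.hyps(2) unfolding separated_intervals_def s_def t_def
    by (metis insertCI)
  \<comment> \<open>The gap strictly containing the new interval; it splits into two nondegenerate
    gaps.\<close>
  obtain k where k: "k \<in> H" "fst k < s" "t < snd k"
    using H3[OF st(2), of s t] st disj by auto
  define p q where "p = fst k" and "q = snd k"
  have pq: "p < s" "t < q" using k by (auto simp: p_def q_def)
  have *: "{p<..<q} \<inter> {fst i<..<snd i} = {}" if "i \<in> H - {k}" for i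
    using H2 k(1) that by (auto simp: nonoverlapping_def p_def q_def simp del: Int_greaterThanLessThan)
  have sub: "{p<..<s} \<subseteq> {p<..<q}" "{t<..<q} \<subseteq> {p<..<q}" using pq st(1) by auto
  \<comment> \<open>The two new gaps must differ from all remaining ones, or the sums over the
    enlarged set would lose a term.\<close>
  have ps: "(p, s) \<notin> H - {k}"
  proof
    assume "(p, s) \<in> H - {k}"
    then have "{p<..<q} \<inter> {p<..<s} = {}" using * by fastforce
    then show False using sub(1) pq by auto
  qed
  have tq: "(t, q) \<notin> H - {k}"
  proof
    assume "(t, q) \<in> H - {k}"
    then have "{p<..<q} \<inter> {t<..<q} = {}" using * by fastforce
    then show False using sub(2) pq by auto
  qed
  have pstq: "(p, s) \<noteq> (t, q)" using pq st by auto
  let ?H = "insert (p, s) (insert (t, q) (H - {k}))"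
  have "?P (insert J G) ?H"
  proof (intro conjI)
    show "finite ?H" using fH by simp
    obtain j where j: "j \<in> F" "fst j \<le> p" "q \<le> snd j" using H1[OF k(1)] by (auto simp: p_def q_def)
    then have "\<exists>j\<in>F. fst j \<le> p \<and> s \<le> snd j" "\<exists>j\<in>F. fst j \<le> t \<and> q \<le> snd j"
      using pq st(1) by (auto intro!: bexI[of _ j])
    then show "\<forall>i\<in>?H. fst i < snd i \<and> (\<exists>j\<in>F. fst j \<le> fst i \<and> snd i \<le> snd j)"
      using H1 pq by simp
    have 1: "{p<..<s} \<inter> {fst i<..<snd i} = {} \<and> {t<..<q} \<inter> {fst i<..<snd i} = {}" if "i \<in> H - {k}" for i
      using *[OF that] sub by blast
    have 2: "{p<..<s} \<inter> {t<..<q} = {}" using st(1) by auto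
    have 3: "nonoverlapping (H - {k})" by (rule nonoverlapping_subset[OF H2]) auto
    show "nonoverlapping ?H"
      unfolding nonoverlapping_def
    proof (intro ballI impI)
      fix i j assume ij: "i \<in> ?H" "j \<in> ?H" "i \<noteq> j"
      consider "i = (p, s)" "j = (t, q)" | "i = (t, q)" "j = (p, s)" | "i = (p, s)" "j \<in> H - {k}"
        | "i = (t, q)" "j \<in> H - {k}" | "j = (p, s)" "i \<in> H - {k}"
        | "j = (t, q)" "i \<in> H - {k}" | "i \<in> H - {k}" "j \<in> H - {k}"
        using ij by blast
      then show "{fst i<..<snd i} \<inter> {fst j<..<snd j} = {}"
        by cases (use 1 2 3 ij(3) in \<open>simp_all add: nonoverlapping_def Int_commute del: Int_greaterThanLessThan\<close>)
    qed
    show "\<forall>j\<in>F. \<forall>s t. s \<le> t \<and> {s..t} \<subseteq> {fst j<..<snd j} \<and> (\<forall>i\<in>insert J G. {s..t} \<inter> {fst i..snd i} = {})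
        \<longrightarrow> (\<exists>i\<in>?H. fst i < s \<and> t < snd i)"
    proof (intro ballI allI impI, elim conjE)
      fix j u v assume *: "j \<in> F" "u \<le> v" "{u..v} \<subseteq> {fst j<..<snd j}"
        "\<forall>i\<in>insert J G. {u..v} \<inter> {fst i..snd i} = {}"
      then obtain i where i: "i \<in> H" "fst i < u" "v < snd i"
        using H3[OF *(1), of u v] * by auto
      show "\<exists>i\<in>?H. fst i < u \<and> v < snd i"
      proof (cases "i = k")
        case True
        have "{u..v} \<inter> {s..t} = {}" using *(4) by (simp add: s_def t_def)
        then have "v < s \<or> t < u" using *(2) st(1) by (auto split: if_splits)
        then show ?thesis using True i by (auto simp: p_def q_def)
      qed (use i in auto)
    qed
    show "\<forall>\<phi> :: real \<Rightarrow> real. (\<Sum>i\<in>?H. \<phi> (snd i) - \<phi> (fst i)) =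
        (\<Sum>i\<in>F. \<phi> (snd i) - \<phi> (fst i)) - (\<Sum>i\<in>insert J G. \<phi> (snd i) - \<phi> (fst i))"
    proof
      fix \<phi> :: "real \<Rightarrow> real"
      let ?d = "\<lambda>i. \<phi> (snd i) - \<phi> (fst i)"
      have "sum ?d ?H = (\<phi> s - \<phi> p) + sum ?d (insert (t, q) (H - {k}))"
        using ps pstq fH by (subst sum.insert) auto
      also have "\<dots> = (\<phi> s - \<phi> p) + ((\<phi> q - \<phi> t) + sum ?d (H - {k}))"
        using tq fH by (subst sum.insert) auto
      also have "sum ?d (H - {k}) = sum ?d H - (\<phi> q - \<phi> p)"
        using fH k(1) by (simp add: sum_diff1 p_def q_def)
      also have "(\<phi> s - \<phi> p) + ((\<phi> q - \<phi> t) + (sum ?d H - (\<phi> q - \<phi> p))) = sum ?d H - (\<phi> t - \<phi> s)"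
        by simp
      also have "\<dots> = sum ?d F - sum ?d (insert J G)"
        unfolding H4 using insert.hyps by (simp add: s_def t_def)
      finally show "sum ?d ?H = sum ?d F - sum ?d (insert J G)" .
    qed
  qed
  then show ?case by blast
qed

section \<open>Absolutely continuous functions\<close>

definition small_families :: "real \<Rightarrow> real \<Rightarrow> real \<Rightarrow> (real \<times> real) set set" where
  "small_families a b d = {I. finite I \<and> (\<forall>i\<in>I. a \<le> fst i \<and> fst i \<le> snd i \<and> snd i \<le> b) \<and>
     nonoverlapping I \<and> (\<Sum>i\<in>I. snd i - fst i) < d}"

definition variation :: "(real \<Rightarrow> real) \<Rightarrow> (real \<times> real) set \<Rightarrow> real" where
  "variation f I = (\<Sum>i\<in>I. \<bar>f (snd i) - f (fst i)\<bar>)"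

lemma abs_cont_on_iff:
  "abs_cont_on a b f \<longleftrightarrow> (\<forall>e>0. \<exists>d>0. \<forall>I\<in>small_families a b d. variation f I < e)"
  unfolding abs_cont_on_def nonoverlapping_iff_pairwise[symmetric] small_families_def variation_def
  by (simp add: case_prod_unfold)

lemma abs_cont_on_subset:
  assumes "abs_cont_on a b f" "a \<le> c" "d \<le> b"
  shows "abs_cont_on c d f"
proof -
  have "small_families c d \<delta> \<subseteq> small_families a b \<delta>" for \<delta>
    using assms(2,3) unfolding small_families_def by force
  then show ?thesis
    using assms(1) unfolding abs_cont_on_iff by blast
qed

text \<open>Sums, products and Lipschitz functions all have increments dominated by those of two
  absolutely continuous functions, so one epsilon-delta argument covers them.\<close>

lemma abs_cont_on_lipschitz_bound:
  assumes f: "abs_cont_on a b f" and g: "abs_cont_on a b g" and "0 \<le> M"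
    and h: "\<And>s t. \<lbrakk>a \<le> s; s \<le> t; t \<le> b\<rbrakk> \<Longrightarrow> \<bar>h t - h s\<bar> \<le> M * (\<bar>f t - f s\<bar> + \<bar>g t - g s\<bar>)"
  shows "abs_cont_on a b h"
  unfolding abs_cont_on_iff
proof (intro allI impI)
  fix e :: real assume "0 < e"
  \<comment> \<open>Using \<open>M + 1\<close> instead of \<open>M\<close> keeps the divisor
    positive and the final inequality strict.\<close>
  define c where "c = e / (M + 1) / 2"
  have c: "0 < c" "(M + 1) * (c + c) = e"
    using \<open>0 < e\<close> \<open>0 \<le> M\<close> unfolding c_def field_sum_of_halves by auto
  obtain d1 where d1: "0 < d1" "\<forall>I\<in>small_families a b d1. variation f I < c"
    using f c(1) unfolding abs_cont_on_iff by blast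
  obtain d2 where d2: "0 < d2" "\<forall>I\<in>small_families a b d2. variation g I < c"
    using g c(1) unfolding abs_cont_on_iff by blast
  have "variation h I < e" if I: "I \<in> small_families a b (min d1 d2)" for I
  proof -
    have "I \<in> small_families a b d1" "I \<in> small_families a b d2"
      using I by (auto simp: small_families_def)
    then have *: "variation f I < c" "variation g I < c"
      using d1 d2 by auto
    have "variation h I \<le> (\<Sum>i\<in>I. M * (\<bar>f (snd i) - f (fst i)\<bar> + \<bar>g (snd i) - g (fst i)\<bar>))"
      unfolding variation_def using I h by (intro sum_mono) (auto simp: small_families_def)
    also have "\<dots> = M * (variation f I + variation g I)"
      by (simp add: variation_def sum.distrib flip: sum_distrib_left)
    also have "\<dots> \<le> (M + 1) * (variation f I + variation g I)"
      by (intro mult_right_mono) (auto simp: variation_def intro!: add_nonneg_nonneg sum_nonneg)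
    also have "\<dots> < (M + 1) * (c + c)"
      using * \<open>0 \<le> M\<close> by (intro mult_strict_left_mono add_strict_mono) auto
    finally show ?thesis unfolding c(2) .
  qed
  then show "\<exists>d>0. \<forall>I\<in>small_families a b d. variation h I < e"
    using d1 d2 by (intro exI[of _ "min d1 d2"]) auto
qed

lemma abs_cont_on_add:
  assumes "abs_cont_on a b f" "abs_cont_on a b g"
  shows "abs_cont_on a b (\<lambda>x. f x + g x)"
  by (rule abs_cont_on_lipschitz_bound[OF assms, of 1]) auto

lemma abs_cont_on_ident: "abs_cont_on a b (\<lambda>x. x)"
  unfolding abs_cont_on_iff
proof (intro allI impI)
  fix e :: real assume "0 < e"
  moreover have "variation (\<lambda>x. x) I < e" if "I \<in> small_families a b e" for I
  proof -
    have "variation (\<lambda>x. x) I = (\<Sum>i\<in>I. snd i - fst i)"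
      using that unfolding variation_def small_families_def by (intro sum.cong) auto
    then show ?thesis using that by (simp add: small_families_def)
  qed
  ultimately show "\<exists>d>0. \<forall>I\<in>small_families a b d. variation (\<lambda>x. x) I < e" by blast
qed

lemma abs_cont_on_lipschitz:
  assumes "0 \<le> M" "\<And>s t. \<lbrakk>a \<le> s; s \<le> t; t \<le> b\<rbrakk> \<Longrightarrow> \<bar>h t - h s\<bar> \<le> M * (t - s)"
  shows "abs_cont_on a b h"
proof (rule abs_cont_on_lipschitz_bound[OF abs_cont_on_ident abs_cont_on_ident assms(1)])
  fix s t assume st: "a \<le> s" "s \<le> t" "t \<le> b"
  have "\<bar>h t - h s\<bar> \<le> M * (t - s)" by (rule assms(2)[OF st])
  also have "\<dots> \<le> M * (\<bar>t - s\<bar> + \<bar>t - s\<bar>)" using assms(1) st by (intro mult_left_mono) auto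
  finally show "\<bar>h t - h s\<bar> \<le> M * (\<bar>t - s\<bar> + \<bar>t - s\<bar>)" .
qed

lemma abs_cont_on_imp_continuous_on:
  assumes "abs_cont_on a b f"
  shows "continuous_on {a..b} f"
  unfolding continuous_on_iff
proof (intro ballI allI impI)
  fix x e :: real assume x: "x \<in> {a..b}" and e: "0 < e"
  then obtain d where d: "0 < d" "\<forall>I\<in>small_families a b d. variation f I < e"
    using assms unfolding abs_cont_on_iff by blast
  show "\<exists>d>0. \<forall>x'\<in>{a..b}. dist x' x < d \<longrightarrow> dist (f x') (f x) < e"
  proof (intro exI[of _ d] conjI ballI impI)
    fix y assume y: "y \<in> {a..b}" "dist y x < d"
    have "{(min x y, max x y)} \<in> small_families a b d"
      using x y by (auto simp: small_families_def nonoverlapping_def dist_real_def)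
    then have "variation f {(min x y, max x y)} < e" using d by blast
    then show "dist (f y) (f x) < e"
      by (auto simp: variation_def dist_real_def min_def max_def abs_minus_commute split: if_splits)
  qed (rule d)
qed

lemma abs_cont_on_mult:
  assumes f: "abs_cont_on a b f" and g: "abs_cont_on a b g"
  shows "abs_cont_on a b (\<lambda>x. f x * g x)"
proof -
  have "bounded (f ` {a..b})" "bounded (g ` {a..b})"
    using f g by (auto intro!: compact_imp_bounded compact_continuous_image abs_cont_on_imp_continuous_on)
  then obtain M1 M2 where M: "\<And>x. x \<in> {a..b} \<Longrightarrow> \<bar>f x\<bar> \<le> M1" "\<And>x. x \<in> {a..b} \<Longrightarrow> \<bar>g x\<bar> \<le> M2"
    unfolding bounded_iff by (metis image_eqI real_norm_def)
  define M where "M = max 0 (max M1 M2)"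
  show ?thesis
  proof (rule abs_cont_on_lipschitz_bound[OF f g, of M])
    fix s t assume st: "a \<le> s" "s \<le> t" "t \<le> b"
    have "\<bar>f t * g t - f s * g s\<bar> = \<bar>(f t - f s) * g t + f s * (g t - g s)\<bar>" by (simp add: algebra_simps)
    also have "\<dots> \<le> \<bar>f t - f s\<bar> * \<bar>g t\<bar> + \<bar>f s\<bar> * \<bar>g t - g s\<bar>"
      by (metis abs_mult abs_triangle_ineq)
    also have "\<dots> \<le> \<bar>f t - f s\<bar> * M + M * \<bar>g t - g s\<bar>"
      using st M[of s] M[of t] by (intro add_mono mult_left_mono mult_right_mono) (auto simp: M_def)
    finally show "\<bar>f t * g t - f s * g s\<bar> \<le> M * (\<bar>f t - f s\<bar> + \<bar>g t - g s\<bar>)"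
      by (simp add: algebra_simps)
  qed (simp add: M_def)
qed

section \<open>Almost everywhere differentiability of absolutely continuous functions\<close>

text \<open>On disjoint intervals \<open>F\<close> covering almost all of \<open>E\<close> the
  function drops by at least \<eta> times their length \<open>lF\<close>. Intervals \<open>G\<close>
  inside \<open>F\<close>, on which it does not drop, again cover almost all of \<open>E\<close>.
  The whole drop therefore happens on the gaps between them. If \<open>F\<close> barely exceeds
  \<open>E\<close>, the gaps are so short that absolute continuity bounds the drop, and hence
  \<open>lF\<close>.\<close>

lemma negligible_slope_gap:
  fixes \<phi> :: "real \<Rightarrow> real"
  assumes ac: "abs_cont_on a b \<phi>" and \<eta>: "0 < \<eta>" and E: "E \<subseteq> {a<..<b}"
    and neg: "small_cover E {(y, z). a \<le> y \<and> y < z \<and> z \<le> b \<and> \<phi> z - \<phi> y \<le> - \<eta> * (z - y)}"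
    and pos: "small_cover E {(y, z). a \<le> y \<and> y < z \<and> z \<le> b \<and> 0 \<le> \<phi> z - \<phi> y}"
  shows "negligible E"
  unfolding negligible_outer_le
proof (intro allI impI)
  fix e :: real assume e: "0 < e"
  then have "0 < \<eta> * e / 2" using \<eta> by simp
  then obtain \<delta> where \<delta>: "0 < \<delta>" "\<forall>I\<in>small_families a b \<delta>. variation \<phi> I < \<eta> * e / 2"
    using ac unfolding abs_cont_on_iff by blast
  \<comment> \<open>Three errors below \<tau> separate \<open>lF\<close> from \<open>lG\<close>: the
    excess of the open set \<open>U0\<close> over \<open>E\<close>, and the two uncovered sets
    \<open>T1\<close> and \<open>T2\<close>. The bound \<open>e / 2\<close> is for the final cover
    by \<open>T1\<close> and \<open>F\<close>.\<close>
  define \<tau> where "\<tau> = min (\<delta> / 3) (e / 2)"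
  have \<tau>: "0 < \<tau>" "3 * \<tau> \<le> \<delta>" "\<tau> \<le> e / 2" using \<delta> e by (auto simp: \<tau>_def)
  define A where "A = measure lebesgue ` {T \<in> lmeasurable. E \<subseteq> T}"
  \<comment> \<open>The outer measure of \<open>E\<close>, which is not known to be measurable
    here.\<close>
  define m where "m = Inf A"
  have bdd: "bdd_below A" by (rule bdd_belowI[of _ 0]) (auto simp: A_def)
  have mle: "m \<le> measure lebesgue T" if "E \<subseteq> T" "T \<in> lmeasurable" for T
    unfolding m_def using that bdd by (intro cInf_lower) (auto simp: A_def)
  have "A \<noteq> {}" using E lmeasurable_interval(2)[of a b] by (auto simp: A_def intro!: exI[of _ "{a<..<b}"])
  then have "\<exists>t\<in>A. t < m + \<tau> / 2"
    using \<tau>(1) unfolding m_def by (intro cInf_lessD) auto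
  then obtain T0 where T0: "T0 \<in> lmeasurable" "E \<subseteq> T0" "measure lebesgue T0 < m + \<tau> / 2"
    unfolding A_def by blast
  obtain U0 where U0: "open U0" "T0 \<subseteq> U0" "U0 - T0 \<in> lmeasurable" "emeasure lebesgue (U0 - T0) < ennreal (\<tau> / 2)"
    using sets_lebesgue_outer_open[of T0 "\<tau> / 2"] T0(1) \<tau>(1) by (auto simp: fmeasurableD)
  have U0m: "U0 \<in> lmeasurable"
    using fmeasurable.Un[OF T0(1) U0(3)] U0(2) by (metis Un_Diff_cancel Un_absorb1)
  have "measure lebesgue (U0 - T0) < \<tau> / 2"
    using U0(3,4) \<tau>(1) by (simp add: emeasure_eq_measure2 ennreal_less_iff)
  moreover have "measure lebesgue (U0 - T0) = measure lebesgue U0 - measure lebesgue T0"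
    by (rule measurable_measure_Diff) (use T0 U0 U0m in auto)
  ultimately have U0l: "measure lebesgue U0 < m + \<tau>" using T0(3) by simp
  define K1 where "K1 = {(y, z). a \<le> y \<and> y < z \<and> z \<le> b \<and> \<phi> z - \<phi> y \<le> - \<eta> * (z - y) \<and> {y..z} \<subseteq> U0}"
  have K1: "small_cover E K1"
    unfolding small_cover_def
  proof (intro ballI allI impI)
    fix x d :: real assume x: "x \<in> E" "0 < d"
    then have "x \<in> U0" using T0 U0 by auto
    then obtain r where r: "0 < r" "ball x r \<subseteq> U0" using U0(1) openE by blast
    then have "0 < min d r" using x by simp
    then obtain y z where yz: "a \<le> y" "y < z" "z \<le> b" "\<phi> z - \<phi> y \<le> - \<eta> * (z - y)" "x \<in> {y..z}" "z - y < min d r"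
      using neg x(1) unfolding small_cover_def by blast
    have "{y..z} \<subseteq> ball x r" using yz by (auto simp: dist_real_def)
    then show "\<exists>(y, z)\<in>K1. x \<in> {y..z} \<and> z - y < d"
      using yz r by (intro bexI[of _ "(y, z)"]) (auto simp: K1_def)
  qed
  obtain F T1 where F: "finite F" "F \<subseteq> K1" "separated_intervals F"
    and T1: "E \<subseteq> T1 \<union> (\<Union>(y, z)\<in>F. {y<..<z})" "T1 \<in> lmeasurable" "measure lebesgue T1 < \<tau>"
    by (rule finite_Vitali_intervals[OF _ K1 \<tau>(1), of a b]) (auto simp: K1_def)
  have FK: "a \<le> fst i \<and> fst i < snd i \<and> snd i \<le> b \<and> \<phi> (snd i) - \<phi> (fst i) \<le> - \<eta> * (snd i - fst i) \<and> {fst i..snd i} \<subseteq> U0"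
    if "i \<in> F" for i
    using subsetD[OF F(2) that] by (cases i) (simp add: K1_def)
  define E' where "E' = E \<inter> (\<Union>(y, z)\<in>F. {y<..<z})"
  define K2 where "K2 = {(y, z). a \<le> y \<and> y < z \<and> z \<le> b \<and> 0 \<le> \<phi> z - \<phi> y \<and> (\<exists>j\<in>F. {y..z} \<subseteq> {fst j<..<snd j})}"
  have K2: "small_cover E' K2"
    unfolding small_cover_def
  proof (intro ballI allI impI)
    fix x d :: real assume x: "x \<in> E'" "0 < d"
    then obtain j where j: "j \<in> F" "x \<in> {fst j<..<snd j}" by (auto simp: E'_def)
    then obtain r where r: "0 < r" "ball x r \<subseteq> {fst j<..<snd j}" using openE[OF open_greaterThanLessThan] by blast
    then have "0 < min d r" "x \<in> E" using x by (auto simp: E'_def)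
    then obtain y z where yz: "a \<le> y" "y < z" "z \<le> b" "0 \<le> \<phi> z - \<phi> y" "x \<in> {y..z}" "z - y < min d r"
      using pos unfolding small_cover_def by blast
    have "{y..z} \<subseteq> ball x r" using yz by (auto simp: dist_real_def)
    then have "{y..z} \<subseteq> {fst j<..<snd j}" using r by blast
    then show "\<exists>(y, z)\<in>K2. x \<in> {y..z} \<and> z - y < d"
      using yz j(1) by (intro bexI[of _ "(y, z)"]) (auto simp: K2_def)
  qed
  obtain G T2 where G: "finite G" "G \<subseteq> K2" "separated_intervals G"
    and T2: "E' \<subseteq> T2 \<union> (\<Union>(y, z)\<in>G. {y<..<z})" "T2 \<in> lmeasurable" "measure lebesgue T2 < \<tau>"
    by (rule finite_Vitali_intervals[OF _ K2 \<tau>(1), of a b]) (auto simp: K2_def)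
  have GK: "a \<le> fst i \<and> fst i < snd i \<and> snd i \<le> b \<and> 0 \<le> \<phi> (snd i) - \<phi> (fst i) \<and>
      (\<exists>j\<in>F. {fst i..snd i} \<subseteq> {fst j<..<snd j})"
    if "i \<in> G" for i
    using subsetD[OF G(2) that] by (cases i) (simp add: K2_def)
  define lF where "lF = (\<Sum>i\<in>F. snd i - fst i)"
  define lG where "lG = (\<Sum>i\<in>G. snd i - fst i)"
  have lF: "measure lebesgue (\<Union>(y, z)\<in>F. {y..z}) = lF"
    unfolding lF_def using F FK by (subst measure_disjoint_intervals) (fastforce simp: case_prod_unfold)+
  have lG: "measure lebesgue (\<Union>(y, z)\<in>G. {y..z}) = lG"
    unfolding lG_def using G GK by (subst measure_disjoint_intervals) (fastforce simp: case_prod_unfold)+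
  have Fm: "(\<Union>(y, z)\<in>F. {y..z}) \<in> lmeasurable" and Gm: "(\<Union>(y, z)\<in>G. {y..z}) \<in> lmeasurable"
    using F(1) G(1) by (auto intro!: fmeasurable.finite_UN)
  have "lF \<le> measure lebesgue U0"
    unfolding lF[symmetric] using FK U0m Fm by (intro measure_mono_fmeasurable) (fastforce simp: fmeasurableD)+
  then have lFm: "lF < m + \<tau>" using U0l by simp
  have oc: "(\<Union>(y, z)\<in>X. {y<..<z::real}) \<subseteq> (\<Union>(y, z)\<in>X. {y..z})" for X by (rule UN_mono) auto
  have un3: "measure lebesgue (X \<union> Y) \<le> measure lebesgue X + measure lebesgue Y"
    if "X \<in> lmeasurable" "Y \<in> lmeasurable" for X Y :: "real set"
    using that by (intro measure_Un_le) auto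
  have "E \<subseteq> (T1 \<union> T2) \<union> (\<Union>(y, z)\<in>G. {y..z})"
    using T1(1) T2(1) oc[of G] unfolding E'_def by blast
  then have "m \<le> measure lebesgue ((T1 \<union> T2) \<union> (\<Union>(y, z)\<in>G. {y..z}))"
    by (rule mle) (use T1 T2 Gm in auto)
  also have "\<dots> \<le> measure lebesgue (T1 \<union> T2) + lG"
    unfolding lG[symmetric] by (rule un3) (use T1 T2 Gm in auto)
  also have "\<dots> \<le> measure lebesgue T1 + measure lebesgue T2 + lG"
    using un3[OF T1(2) T2(2)] by simp
  also have "\<dots> < \<tau> + \<tau> + lG" using T1 T2 by simp
  finally have gap: "lF - lG < \<delta>" using lFm \<tau> by linarith
  obtain H where H: "finite H" "\<forall>i\<in>H. fst i < snd i \<and> (\<exists>j\<in>F. fst j \<le> fst i \<and> snd i \<le> snd j)"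
     "nonoverlapping H"
     "\<forall>\<phi> :: real \<Rightarrow> real. (\<Sum>i\<in>H. \<phi> (snd i) - \<phi> (fst i)) =
        (\<Sum>i\<in>F. \<phi> (snd i) - \<phi> (fst i)) - (\<Sum>i\<in>G. \<phi> (snd i) - \<phi> (fst i))"
    using complementary_intervals[OF G(1) F(1) _ F(3) _ G(3)] FK GK by blast
  have "(\<Sum>i\<in>H. snd i - fst i) = lF - lG"
    using H(4)[rule_format, of "\<lambda>x. x"] by (simp add: lF_def lG_def)
  moreover have "\<forall>i\<in>H. a \<le> fst i \<and> fst i \<le> snd i \<and> snd i \<le> b"
    using H(2) FK by (meson less_imp_le order_trans)
  ultimately have "H \<in> small_families a b \<delta>"
    using H gap by (simp add: small_families_def)
  then have "variation \<phi> H < \<eta> * e / 2" using \<delta> by blast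
  moreover have "- (\<Sum>i\<in>H. \<phi> (snd i) - \<phi> (fst i)) \<le> variation \<phi> H"
    unfolding variation_def sum_negf[symmetric] by (intro sum_mono) auto
  moreover have "(\<Sum>i\<in>F. \<phi> (snd i) - \<phi> (fst i)) \<le> (\<Sum>i\<in>F. - \<eta> * (snd i - fst i))"
    using FK by (intro sum_mono) auto
  moreover have "0 \<le> (\<Sum>i\<in>G. \<phi> (snd i) - \<phi> (fst i))"
    using GK by (intro sum_nonneg) auto
  moreover have "(\<Sum>i\<in>F. - \<eta> * (snd i - fst i)) = - \<eta> * lF"
    by (simp add: lF_def sum_distrib_left)
  \<comment> \<open>The drop over \<open>F\<close> is at least \<open>\<eta> * lF\<close> and
    \<open>G\<close> contributes no drop, so the gaps \<open>H\<close> carry all of it.\<close>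
  ultimately have "\<eta> * lF < \<eta> * (e / 2)"
    using H(4)[rule_format, of \<phi>] by simp
  then have lFe: "lF < e / 2" using \<eta> by simp
  show "\<exists>T. E \<subseteq> T \<and> T \<in> lmeasurable \<and> measure lebesgue T \<le> e"
  proof (intro exI conjI)
    show "E \<subseteq> T1 \<union> (\<Union>(y, z)\<in>F. {y..z})" using T1(1) oc[of F] by blast
    show "T1 \<union> (\<Union>(y, z)\<in>F. {y..z}) \<in> lmeasurable" using T1 Fm by auto
    show "measure lebesgue (T1 \<union> (\<Union>(y, z)\<in>F. {y..z})) \<le> e"
      using un3[OF T1(2) Fm] T1(3) lFe \<tau> lF by linarith
  qed
qed

text \<open>Adding weights below \<open>t\<close> one at a time cannot jump over the window from
  \<open>t\<close> to \<open>2 * t\<close>. This trims a family of short intervals to a length that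
  absolute continuity can handle.\<close>

lemma subset_sum_between:
  fixes w :: "'a \<Rightarrow> real"
  assumes "finite F" "0 < t" "\<And>i. i \<in> F \<Longrightarrow> w i < t" "t \<le> sum w F"
  shows "\<exists>G\<subseteq>F. t \<le> sum w G \<and> sum w G < 2 * t"
  using assms
proof (induction F)
  case empty
  then show ?case by simp
next
  case (insert x F)
  show ?case
  proof (cases "t \<le> sum w F")
    case True
    then show ?thesis using insert.IH insert.prems by (metis insertI2 subset_insertI2)
  next
    case False
    then have "sum w (insert x F) < 2 * t" using insert.hyps insert.prems(2)[of x] by simp
    then show ?thesis using insert.prems by blast
  qed
qed

text \<open>Cover by intervals shorter than \<tau> with slopes at least 1/\<tau> in absolute value.
  If their total length reached \<tau>, a subfamily of length between \<tau> and 2\<tau> would have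
  variation at least 1, although its length is below \<delta>. So \<open>E\<close> is covered up to
  small measure by intervals of total length below \<tau>.\<close>

lemma negligible_unbounded_slopes:
  fixes \<phi> :: "real \<Rightarrow> real"
  assumes ac: "abs_cont_on a b \<phi>"
    and cov: "\<And>K. small_cover E {(y, z). a \<le> y \<and> y < z \<and> z \<le> b \<and> K * (z - y) \<le> \<bar>\<phi> z - \<phi> y\<bar>}"
  shows "negligible E"
  unfolding negligible_outer_le
proof (intro allI impI)
  fix e :: real assume e: "0 < e"
  obtain \<delta> where \<delta>: "0 < \<delta>" "\<forall>I\<in>small_families a b \<delta>. variation \<phi> I < 1"
    using ac unfolding abs_cont_on_iff by (meson zero_less_one)
  define \<tau> where "\<tau> = min (\<delta> / 2) (e / 2)"
  have \<tau>: "0 < \<tau>" "2 * \<tau> \<le> \<delta>" "\<tau> \<le> e / 2" using \<delta> e by (auto simp: \<tau>_def)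
  define K1 where "K1 = {(y, z). a \<le> y \<and> y < z \<and> z \<le> b \<and> (1/\<tau>) * (z - y) \<le> \<bar>\<phi> z - \<phi> y\<bar> \<and> z - y < \<tau>}"
  have K1: "small_cover E K1"
    unfolding small_cover_def
  proof (intro ballI allI impI)
    fix x d :: real assume x: "x \<in> E" "0 < d"
    then have "0 < min d \<tau>" using \<tau> by simp
    then obtain y z where yz: "a \<le> y" "y < z" "z \<le> b" "(1/\<tau>) * (z - y) \<le> \<bar>\<phi> z - \<phi> y\<bar>" "x \<in> {y..z}" "z - y < min d \<tau>"
      using cov[of "1/\<tau>"] x(1) unfolding small_cover_def by blast
    then show "\<exists>(y, z)\<in>K1. x \<in> {y..z} \<and> z - y < d"
      by (intro bexI[of _ "(y, z)"]) (auto simp: K1_def)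
  qed
  obtain F T1 where F: "finite F" "F \<subseteq> K1" "separated_intervals F"
    and T1: "E \<subseteq> T1 \<union> (\<Union>(y, z)\<in>F. {y<..<z})" "T1 \<in> lmeasurable" "measure lebesgue T1 < \<tau>"
    by (rule finite_Vitali_intervals[OF _ K1 \<tau>(1), of a b]) (auto simp: K1_def)
  have FK: "a \<le> fst i \<and> fst i < snd i \<and> snd i \<le> b \<and> (1/\<tau>) * (snd i - fst i) \<le> \<bar>\<phi> (snd i) - \<phi> (fst i)\<bar> \<and> snd i - fst i < \<tau>"
    if "i \<in> F" for i
    using subsetD[OF F(2) that] by (cases i) (simp add: K1_def)
  have lF: "(\<Sum>i\<in>F. snd i - fst i) < \<tau>"
  proof (rule ccontr)
    assume "\<not> ?thesis"
    then have "\<exists>G\<subseteq>F. \<tau> \<le> (\<Sum>i\<in>G. snd i - fst i) \<and> (\<Sum>i\<in>G. snd i - fst i) < 2 * \<tau>"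
      using FK F(1) \<tau>(1) by (intro subset_sum_between) auto
    then obtain G where G: "G \<subseteq> F" "\<tau> \<le> (\<Sum>i\<in>G. snd i - fst i)" "(\<Sum>i\<in>G. snd i - fst i) < 2 * \<tau>"
      by blast
    have "nonoverlapping G"
      using F(3) G(1) by (blast intro: separated_intervals_imp_nonoverlapping separated_intervals_subset)
    moreover have "finite G" using G(1) F(1) finite_subset by blast
    moreover have "\<forall>i\<in>G. a \<le> fst i \<and> fst i \<le> snd i \<and> snd i \<le> b"
      using G(1) FK by (meson less_imp_le subsetD)
    ultimately have "G \<in> small_families a b \<delta>"
      using G(3) \<tau>(2) by (simp add: small_families_def)
    then have "variation \<phi> G < 1" using \<delta> by blast
    moreover have "(\<Sum>i\<in>G. (1/\<tau>) * (snd i - fst i)) \<le> variation \<phi> G"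
      unfolding variation_def using G(1) FK by (intro sum_mono) auto
    moreover have "(\<Sum>i\<in>G. (1/\<tau>) * (snd i - fst i)) = (1/\<tau>) * (\<Sum>i\<in>G. snd i - fst i)"
      by (simp only: sum_distrib_left)
    moreover have "1 \<le> (1/\<tau>) * (\<Sum>i\<in>G. snd i - fst i)"
      using G(2) \<tau>(1) by (simp add: field_simps)
    ultimately show False by linarith
  qed
  have Fm: "(\<Union>(y, z)\<in>F. {y..z}) \<in> lmeasurable"
    using F(1) by (auto intro!: fmeasurable.finite_UN)
  have mF: "measure lebesgue (\<Union>(y, z)\<in>F. {y..z}) < \<tau>"
    using F FK lF by (subst measure_disjoint_intervals) (fastforce simp: case_prod_unfold)+
  show "\<exists>T. E \<subseteq> T \<and> T \<in> lmeasurable \<and> measure lebesgue T \<le> e"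
  proof (intro exI conjI)
    have "(\<Union>(y, z)\<in>F. {y<..<z}) \<subseteq> (\<Union>(y, z)\<in>F. {y..z})" by (rule UN_mono) auto
    then show "E \<subseteq> T1 \<union> (\<Union>(y, z)\<in>F. {y..z})" using T1(1) by blast
    show "T1 \<union> (\<Union>(y, z)\<in>F. {y..z}) \<in> lmeasurable" using T1 Fm by auto
    have "measure lebesgue (T1 \<union> (\<Union>(y, z)\<in>F. {y..z})) \<le> measure lebesgue T1 + measure lebesgue (\<Union>(y, z)\<in>F. {y..z})"
      using T1 Fm by (intro measure_Un_le) auto
    then show "measure lebesgue (T1 \<union> (\<Union>(y, z)\<in>F. {y..z})) \<le> e"
      using T1(3) mF \<tau> by linarith
  qed
qed

text \<open>Difference quotients are symmetric in their two points, so points approaching from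
  either side yield intervals with \<open>x\<close> as an endpoint. The set keeps away from
  \<open>a\<close> and \<open>b\<close>, so that short intervals stay inside.\<close>

lemma small_cover_slopes:
  fixes h :: "real \<Rightarrow> real"
  assumes S: "\<And>x. x \<in> S \<Longrightarrow> a < x \<and> x < b \<and> (\<exists>\<^sub>F y in at x. P ((h y - h x) / (y - x)))"
    and Q: "\<And>y z. \<lbrakk>y < z; P ((h z - h y) / (z - y))\<rbrakk> \<Longrightarrow> Q y z"
  shows "small_cover S {(y, z). a \<le> y \<and> y < z \<and> z \<le> b \<and> Q y z}"
  unfolding small_cover_def
proof (intro ballI allI impI)
  fix x d :: real assume "x \<in> S" and d: "0 < d"
  then have x: "a < x" "x < b" and fr: "\<exists>\<^sub>F y in at x. P ((h y - h x) / (y - x))" using S by auto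
  define r where "r = min d (min (x - a) (b - x))"
  have r: "0 < r" using x d by (simp add: r_def)
  have "\<exists>\<^sub>F y in at x. P ((h y - h x) / (y - x)) \<and> (y \<noteq> x \<and> dist y x < r)"
  proof (rule frequently_rev_mp[OF fr])
    show "\<forall>\<^sub>F y in at x. P ((h y - h x) / (y - x)) \<longrightarrow> P ((h y - h x) / (y - x)) \<and> (y \<noteq> x \<and> dist y x < r)"
      using r by (auto simp: eventually_at)
  qed
  then obtain y where y: "P ((h y - h x) / (y - x))" "y \<noteq> x" "dist y x < r"
    by (auto dest: frequently_ex)
  have "(h (max x y) - h (min x y)) / (max x y - min x y) = (h y - h x) / (y - x)"
  proof (cases "x \<le> y")
    case False
    then show ?thesis by simp (metis minus_diff_eq minus_divide_divide)
  qed simp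
  then have "Q (min x y) (max x y)" using y(1,2) by (intro Q) auto
  moreover have "a \<le> min x y" "min x y < max x y" "max x y \<le> b" "max x y - min x y < d"
      "x \<in> {min x y..max x y}"
    using x y by (auto simp: r_def dist_real_def)
  ultimately show "\<exists>(y, z)\<in>{(y, z). a \<le> y \<and> y < z \<and> z \<le> b \<and> Q y z}. x \<in> {y..z} \<and> z - y < d"
    by (intro bexI[of _ "(min x y, max x y)"]) auto
qed

text \<open>If the difference quotients at \<open>x\<close> have no finite limit, then either they
  are unbounded near \<open>x\<close>, or two rationals separate their lower and upper limits. Both
  possibilities define null sets, and the pairs of rationals are countable.\<close>

lemma abs_cont_on_differentiable_ae:
  assumes ac: "abs_cont_on a b h"
  shows "negligible {x \<in> {a<..<b}. \<not> h differentiable (at x)}"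
proof -
  define q where "q x y = (h y - h x) / (y - x)" for x y
  define B where "B r s = {x \<in> {a<..<b}. (\<exists>\<^sub>F y in at x. q x y \<le> r) \<and> (\<exists>\<^sub>F y in at x. s \<le> q x y)}" for r s
  define D where "D = {x \<in> {a<..<b}. \<forall>K. \<exists>\<^sub>F y in at x. K \<le> \<bar>q x y\<bar>}"
  have "negligible (B r s)" if "r < s" for r s
  proof (rule negligible_slope_gap)
    \<comment> \<open>Tilting by \<open>s\<close> turns slopes of \<open>h\<close> at most
      \<open>r\<close> into slopes at most \<open>-(s - r)\<close>, and slopes at least
      \<open>s\<close> into nonnegative ones.\<close>
    show "abs_cont_on a b (\<lambda>x. h x - s * x)"
    proof -
      have "abs_cont_on a b (\<lambda>x. - s * x)"
      proof (rule abs_cont_on_lipschitz)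
        fix u v :: real assume "u \<le> v"
        then show "\<bar>- s * v - - s * u\<bar> \<le> \<bar>s\<bar> * (v - u)"
          unfolding right_diff_distrib[symmetric] abs_mult by simp
      qed simp
      from abs_cont_on_add[OF ac this] show ?thesis by simp
    qed
    show "0 < s - r" using that by simp
    show "B r s \<subseteq> {a<..<b}" by (auto simp: B_def)
    show "small_cover (B r s) {(y, z). a \<le> y \<and> y < z \<and> z \<le> b \<and> h z - s * z - (h y - s * y) \<le> - (s - r) * (z - y)}"
      by (rule small_cover_slopes[where P = "\<lambda>t. t \<le> r" and h = h])
        (auto simp: B_def q_def pos_divide_le_eq algebra_simps)
    show "small_cover (B r s) {(y, z). a \<le> y \<and> y < z \<and> z \<le> b \<and> 0 \<le> h z - s * z - (h y - s * y)}"
      by (rule small_cover_slopes[where P = "\<lambda>t. s \<le> t" and h = h])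
        (auto simp: B_def q_def pos_le_divide_eq algebra_simps)
  qed
  then have NB: "negligible (\<Union>(r, s)\<in>{(r, s). r \<in> \<rat> \<and> s \<in> \<rat> \<and> r < s}. B r s)"
    by (intro negligible_countable_Union[OF countable_image])
       (auto intro: countable_subset[OF _ countable_SIGMA[OF countable_rat countable_rat]])
  have ND: "negligible D"
  proof (rule negligible_unbounded_slopes[OF ac])
    show "small_cover D {(y, z). a \<le> y \<and> y < z \<and> z \<le> b \<and> K * (z - y) \<le> \<bar>h z - h y\<bar>}" for K
      by (rule small_cover_slopes[where P = "\<lambda>t. K \<le> \<bar>t\<bar>" and h = h])
        (auto simp: D_def q_def abs_divide pos_le_divide_eq)
  qed
  have diff: "h differentiable (at x)"
    if x: "x \<in> {a<..<b}" and xB: "\<And>r s. \<lbrakk>r \<in> \<rat>; s \<in> \<rat>; r < s\<rbrakk> \<Longrightarrow> x \<notin> B r s" and xD: "x \<notin> D" for x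
  proof -
    obtain K where K: "\<forall>\<^sub>F y in at x. \<bar>q x y\<bar> < K"
      using xD x by (auto simp: D_def not_frequently not_le)
    define l u where "l = Liminf (at x) (\<lambda>y. ereal (q x y))" and "u = Limsup (at x) (\<lambda>y. ereal (q x y))"
    have lu: "l \<le> u" unfolding l_def u_def by (rule Liminf_le_Limsup) simp
    have "ereal (- K) \<le> l"
      unfolding l_def by (rule Liminf_bounded) (use K in \<open>auto elim!: eventually_mono\<close>)
    moreover have "u \<le> ereal K"
      unfolding u_def by (rule Limsup_bounded) (use K in \<open>auto elim!: eventually_mono\<close>)
    moreover have "\<not> l < u"
    proof
      assume "l < u"
      then obtain r' where r': "l < ereal r'" "ereal r' < u" using ereal_dense2 by blast
      then obtain s' where s': "ereal r' < ereal s'" "ereal s' < u" using ereal_dense2 by blast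
      \<comment> \<open>Choosing the rationals on the two sides of the midpoint of \<open>r'\<close>
        and \<open>s'\<close> gives \<open>r < s\<close> while both stay strictly between the lower
        and the upper limit.\<close>
      obtain r where r: "r \<in> \<rat>" "r' < r" "r < (r' + s') / 2"
        using Rats_dense_in_real[of r' "(r' + s') / 2"] s'(1) by auto
      obtain s where s: "s \<in> \<rat>" "(r' + s') / 2 < s" "s < s'"
        using Rats_dense_in_real[of "(r' + s') / 2" s'] s'(1) by auto
      have "\<exists>\<^sub>F y in at x. q x y \<le> r"
      proof (rule ccontr)
        assume "\<not> ?thesis"
        then have "\<forall>\<^sub>F y in at x. ereal r \<le> ereal (q x y)" by (auto simp: not_frequently elim!: eventually_mono)
        then have "ereal r \<le> l" unfolding l_def by (rule Liminf_bounded)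
        then show False using r'(1) r(2) by (meson ereal_less_eq(3) leD less_imp_le order_le_less_trans order_trans)
      qed
      moreover have "\<exists>\<^sub>F y in at x. s \<le> q x y"
      proof (rule ccontr)
        assume "\<not> ?thesis"
        then have "\<forall>\<^sub>F y in at x. ereal (q x y) \<le> ereal s" by (auto simp: not_frequently elim!: eventually_mono)
        then have "u \<le> ereal s" unfolding u_def by (rule Limsup_bounded)
        then show False using s'(2) s(3) by (meson ereal_less_eq(3) leD less_imp_le order_less_le_trans order_trans)
      qed
      ultimately show False using xB[OF r(1) s(1)] r s x by (simp add: B_def)
    qed
    ultimately have "l = u" "\<bar>l\<bar> \<noteq> \<infinity>" using lu by auto
    then obtain L where L: "l = ereal L" by (cases l) auto
    have "((\<lambda>y. ereal (q x y)) \<longlongrightarrow> ereal L) (at x)"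
      by (rule Liminf_eq_Limsup) (use \<open>l = u\<close> L in \<open>auto simp: l_def u_def\<close>)
    then have "(q x \<longlongrightarrow> L) (at x)" by simp
    then have "(h has_real_derivative L) (at x)"
      by (simp add: has_field_derivative_iff q_def[abs_def])
    then show ?thesis using real_differentiable_def by blast
  qed
  show ?thesis
  proof (rule negligible_subset[OF negligible_Un[OF NB ND]], rule subsetI, rule ccontr)
    fix x assume x: "x \<in> {x \<in> {a<..<b}. \<not> h differentiable (at x)}"
      and "x \<notin> (\<Union>(r, s)\<in>{(r, s). r \<in> \<rat> \<and> s \<in> \<rat> \<and> r < s}. B r s) \<union> D"
    then have "h differentiable (at x)" by (intro diff) auto
    then show False using x by simp
  qed
qed

section \<open>The fundamental theorem of calculus for absolutely continuous functions\<close>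

lemma AE_lebesgue_on_iff_negligible:
  assumes "S \<in> sets lebesgue"
  shows "(AE x in lebesgue_on S. P x) \<longleftrightarrow> negligible {x \<in> S. \<not> P x}"
proof -
  have "(AE x in lebesgue_on S. P x) \<longleftrightarrow> (AE x in lebesgue. x \<in> S \<longrightarrow> P x)"
    using assms by (subst AE_restrict_space_iff) auto
  also have "\<dots> \<longleftrightarrow> negligible {x. \<not> (x \<in> S \<longrightarrow> P x)}"
  proof
    assume "AE x in lebesgue. x \<in> S \<longrightarrow> P x"
    then obtain N where "{x \<in> space lebesgue. \<not> (x \<in> S \<longrightarrow> P x)} \<subseteq> N" "N \<in> null_sets lebesgue"
      by (auto elim!: AE_E simp: null_sets_def)
    then show "negligible {x. \<not> (x \<in> S \<longrightarrow> P x)}"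
      using negligible_subset[of N] by (auto simp: negligible_iff_null_sets[symmetric])
  next
    assume "negligible {x. \<not> (x \<in> S \<longrightarrow> P x)}"
    then show "AE x in lebesgue. x \<in> S \<longrightarrow> P x"
      by (intro AE_I'[of "{x. \<not> (x \<in> S \<longrightarrow> P x)}"]) (auto simp: negligible_iff_null_sets)
  qed
  also have "{x. \<not> (x \<in> S \<longrightarrow> P x)} = {x \<in> S. \<not> P x}" by auto
  finally show ?thesis .
qed

text \<open>A gauge argument. At a tag outside \<open>M\<close>, differentiability compares the
  increment of \<open>h\<close> with the Riemann term up to \<epsilon> times the length. At a tag in
  \<open>M\<close>, the gauge confines the piece to an open set of measure below \<delta>, and
  absolute continuity bounds the sum of these increments.\<close>

lemma abs_cont_on_has_integral:
  fixes h q :: "real \<Rightarrow> real"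
  assumes "a \<le> b" and ac: "abs_cont_on a b h" and N: "negligible N"
    and der: "\<And>x. x \<in> {a<..<b} - N \<Longrightarrow> (h has_real_derivative q x) (at x)"
  shows "(q has_integral (h b - h a)) {a..b}"
proof -
  \<comment> \<open>Differentiability is assumed only in the open interval, so the endpoints count
    as exceptional.\<close>
  define M where "M = insert a (insert b N)"
  have M: "negligible M" using N by (simp add: M_def)
  \<comment> \<open>Changing the integrand to 0 on the null set \<open>M\<close> removes the terms
    with exceptional tags from the Riemann sums.\<close>
  define q0 where "q0 x = (if x \<in> M then 0 else q x)" for x
  have "(q0 has_integral (h b - h a)) {a..b}"
    unfolding has_integral_real
  proof (intro allI impI)
    fix e :: real assume e: "0 < e"
    define \<epsilon> where "\<epsilon> = e / (2 * (b - a + 1))"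
    have \<epsilon>: "0 < \<epsilon>" "\<epsilon> * (b - a) < e / 2"
      using e \<open>a \<le> b\<close> by (auto simp: \<epsilon>_def field_simps)
    obtain \<delta> where \<delta>: "0 < \<delta>" "\<forall>I\<in>small_families a b \<delta>. variation h I < e / 2"
      using ac e unfolding abs_cont_on_iff by (meson half_gt_zero)
    obtain T where T: "open T" "M \<subseteq> T" "T - M \<in> lmeasurable" "emeasure lebesgue (T - M) < ennreal \<delta>"
      using sets_lebesgue_outer_open[OF negligible_imp_sets[OF M] \<delta>(1)] by blast
    have Tm: "T \<in> lmeasurable"
      using fmeasurable.Un[OF negligible_imp_measurable[OF M] T(3)] T(2) by (metis Un_Diff_cancel Un_absorb1)
    have "measure lebesgue T = measure lebesgue (T - M)"
      using M Tm by (subst measure_Diff_null_set) (auto simp: negligible_iff_null_sets)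
    also have "\<dots> < \<delta>"
      using T(3,4) \<delta>(1) by (simp add: emeasure_eq_measure2 ennreal_less_iff)
    finally have Tl: "measure lebesgue T < \<delta>" .
    have "\<exists>d>0. (x \<in> M \<longrightarrow> ball x d \<subseteq> T) \<and> (x \<in> {a..b} - M \<longrightarrow>
         (\<forall>y. norm (y - x) < d \<longrightarrow> norm (h y - h x - (y - x) * q x) \<le> \<epsilon> * norm (y - x)))" for x
    proof (cases "x \<in> M")
      case True
      then show ?thesis using T(1,2) by (meson DiffD2 openE subsetD)
    next
      case False
      show ?thesis
      proof (cases "x \<in> {a..b}")
        case True
        then have "(h has_real_derivative q x) (at x)" using False by (intro der) (auto simp: M_def less_le)
        then have "(h has_derivative (\<lambda>t. t * q x)) (at x)"
          unfolding has_field_derivative_def by (rule has_derivative_eq_rhs) auto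
        then show ?thesis using False \<epsilon>(1) unfolding has_derivative_at_alt by auto
      qed (use False in \<open>auto intro: exI[of _ 1]\<close>)
    qed
    then obtain d where d0: "\<And>x. 0 < d x" and dM: "\<And>x. x \<in> M \<Longrightarrow> ball x (d x) \<subseteq> T"
      and d: "\<And>x y. \<lbrakk>x \<in> {a..b} - M; norm (y - x) < d x\<rbrakk> \<Longrightarrow> norm (h y - h x - (y - x) * q x) \<le> \<epsilon> * norm (y - x)"
      by metis
    show "\<exists>\<gamma>. gauge \<gamma> \<and> (\<forall>p. p tagged_division_of {a..b} \<and> \<gamma> fine p \<longrightarrow>
        norm ((\<Sum>(x, k)\<in>p. measure lborel k *\<^sub>R q0 x) - (h b - h a)) < e)"
    proof (intro exI conjI allI impI; (elim conjE)?)
      show "gauge (\<lambda>x. ball x (d x))" using d0 by (simp add: gauge_ball_dependent)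
      fix p assume p: "p tagged_division_of {a..b}" and fine: "(\<lambda>x. ball x (d x)) fine p"
      have fp: "finite p" using p by blast
      have pk: "\<exists>u v. k = {u..v} \<and> u \<le> x \<and> x \<le> v \<and> a \<le> u \<and> v \<le> b \<and> {u..v} \<subseteq> ball x (d x)" if "(x, k) \<in> p" for x k
      proof -
        note xk = that
        obtain u v where k: "k = {u..v}" using tagged_division_ofD(4)[OF p xk] by (auto simp: box_real)
        have "x \<in> k" "k \<subseteq> {a..b}" "k \<subseteq> ball x (d x)"
          using tagged_division_ofD(2,3)[OF p xk] fineD[OF fine xk] by simp_all
        then show ?thesis unfolding k by (intro exI[of _ u] exI[of _ v]) auto
      qed
      \<comment> \<open>Degenerate pieces are left out because they have increment 0; the others
        have nonempty disjoint interiors, which makes passing to endpoint pairs injective.\<close>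
      define P where "P = {(x, k) \<in> p. x \<in> M \<and> Inf k < Sup k}"
      define g where "g = (\<lambda>(x :: real, k :: real set). (Inf k, Sup k))"
      define I where "I = g ` P"
      have Pp: "P \<subseteq> p" by (auto simp: P_def)
      have gdisj: "{fst (g i)<..<snd (g i)} \<inter> {fst (g j)<..<snd (g j)} = {}" if "i \<in> P" "j \<in> P" "i \<noteq> j" for i j
      proof -
        have i1: "interior (snd i) \<inter> interior (snd j) = {}"
          using tagged_division_ofD(5)[OF p, of "fst i" "snd i" "fst j" "snd j"] that Pp by auto
        have i2: "interior (snd i) = {fst (g i)<..<snd (g i)}" if iP: "i \<in> P" for i
        proof -
          have "(fst i, snd i) \<in> p" using iP Pp by auto
          then obtain u v where uv: "snd i = {u..v}" "u \<le> fst i" "fst i \<le> v"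
            using pk by blast
          then have "Inf (snd i) = u" "Sup (snd i) = v" by simp_all
          then show ?thesis unfolding g_def case_prod_unfold uv(1) by simp
        qed
        show ?thesis using i1 unfolding i2[OF that(1)] i2[OF that(2)] .
      qed
      have ne: "fst (g i) < snd (g i)" if "i \<in> P" for i using that by (auto simp: P_def g_def)
      have inj: "inj_on g P"
      proof (rule inj_onI, rule ccontr)
        fix i j assume "i \<in> P" "j \<in> P" "g i = g j" "i \<noteq> j"
        then have "{fst (g i)<..<snd (g i)} = {}" using gdisj[of i j] by simp
        then show False using ne[OF \<open>i \<in> P\<close>] by simp
      qed
      have fI: "finite I" using fp Pp by (auto simp: I_def intro: finite_subset)
      have nI: "nonoverlapping I" unfolding nonoverlapping_def I_def using gdisj by blast
      have bI: "a \<le> fst i \<and> fst i < snd i \<and> snd i \<le> b \<and> {fst i..snd i} \<subseteq> T" if iI: "i \<in> I" for i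
      proof -
        obtain x k where xk: "i = g (x, k)" "(x, k) \<in> P" using iI unfolding I_def by auto
        then have "(x, k) \<in> p" and xM: "x \<in> M" by (auto simp: P_def)
        then obtain u v where uv: "k = {u..v}" "u \<le> x" "x \<le> v" "a \<le> u" "v \<le> b" "{u..v} \<subseteq> ball x (d x)"
          using pk by blast
        moreover have "i = (u, v)" using xk(1) uv(1-3) by (simp add: g_def)
        ultimately show ?thesis using ne[OF xk(2)] dM[OF xM] xk(1) by auto
      qed
      have "(\<Sum>i\<in>I. snd i - fst i) = (\<Sum>i\<in>I. measure lebesgue {fst i<..<snd i})"
        using bI by (intro sum.cong) (auto simp: less_imp_le)
      also have "\<dots> = measure lebesgue (\<Union>i\<in>I. {fst i<..<snd i})"
      proof (rule measure_finite_Union[symmetric, OF fI])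
        show "disjoint_family_on (\<lambda>i. {fst i<..<snd i}) I"
          using nI unfolding disjoint_family_on_def nonoverlapping_def by blast
        show "emeasure lebesgue {fst i<..<snd i} \<noteq> \<infinity>" if "i \<in> I" for i
          using bI[OF that] by (simp add: less_imp_le)
      qed auto
      also have "\<dots> \<le> measure lebesgue T"
      proof (rule measure_mono_fmeasurable)
        have "{fst i<..<snd i} \<subseteq> T" if "i \<in> I" for i
        proof -
          have "{fst i<..<snd i} \<subseteq> {fst i..snd i}" by auto
          then show ?thesis using bI[OF that] by blast
        qed
        then show "(\<Union>i\<in>I. {fst i<..<snd i}) \<subseteq> T" by blast
      qed (use fI Tm in auto)
      finally have "I \<in> small_families a b \<delta>"
        using fI nI bI Tl by (auto simp: small_families_def less_imp_le)
      then have "variation h I < e / 2" using \<delta> by blast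
      also have "variation h I = (\<Sum>(x, k)\<in>P. \<bar>h (Sup k) - h (Inf k)\<bar>)"
        unfolding variation_def I_def using inj by (subst sum.reindex) (auto simp: g_def case_prod_unfold)
      finally have vP: "(\<Sum>(x, k)\<in>P. \<bar>h (Sup k) - h (Inf k)\<bar>) < e / 2" .
      define w where "w = (\<lambda>(x, k). measure lborel k * q0 x - (h (Sup k) - h (Inf k)))"
      have w1: "\<bar>w i\<bar> \<le> \<epsilon> * (case i of (x, k) \<Rightarrow> Sup k - Inf k) + (if i \<in> P then (case i of (x, k) \<Rightarrow> \<bar>h (Sup k) - h (Inf k)\<bar>) else 0)"
        if ip: "i \<in> p" for i
      proof -
        obtain x k where i: "i = (x, k)" by (cases i)
        then obtain u v where uv: "k = {u..v}" "u \<le> x" "x \<le> v" "a \<le> u" "v \<le> b" "{u..v} \<subseteq> ball x (d x)"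
          using pk ip by blast
        show ?thesis
        proof (cases "x \<in> M")
          case True
          then have "\<bar>w i\<bar> = \<bar>h v - h u\<bar>" using uv(1-3) i by (simp add: w_def q0_def abs_minus_commute)
          moreover have "0 \<le> \<epsilon> * (v - u)" using \<epsilon>(1) uv(2,3) by simp
          moreover have "i \<in> P" if "u \<noteq> v" using that ip i True uv(1-3) by (simp add: P_def)
          ultimately show ?thesis using i uv(1-3) by (cases "u = v") auto
        next
          case False
          have xab: "x \<in> {a..b} - M" using uv(2-5) False by simp
          have "u \<in> ball x (d x)" "v \<in> ball x (d x)" using uv(2,3,6) by (auto simp: subset_eq)
          then have *: "norm (u - x) < d x" "norm (v - x) < d x" by (simp_all add: dist_real_def abs_minus_commute)
          have bd: "\<bar>h u - h x - (u - x) * q x\<bar> \<le> \<epsilon> * (x - u)" "\<bar>h v - h x - (v - x) * q x\<bar> \<le> \<epsilon> * (v - x)"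
            using d[OF xab *(1)] d[OF xab *(2)] uv(2,3) by simp_all
          have "w i = (h u - h x - (u - x) * q x) - (h v - h x - (v - x) * q x)"
            using uv(1-3) i False by (simp add: w_def q0_def algebra_simps)
          then have "\<bar>w i\<bar> \<le> \<epsilon> * (x - u) + \<epsilon> * (v - x)"
            using bd by linarith
          also have "\<dots> = \<epsilon> * (v - u)" by (simp add: algebra_simps)
          finally have "\<bar>w i\<bar> \<le> \<epsilon> * (v - u)" .
          moreover have "0 \<le> \<bar>h v - h u\<bar>" by simp
          ultimately show ?thesis using uv(1-3) i by auto
        qed
      qed
      have "(\<Sum>(x, k)\<in>p. measure lborel k *\<^sub>R q0 x) - (h b - h a) = sum w p"
      proof -
        have "sum w p = (\<Sum>(x, k)\<in>p. measure lborel k *\<^sub>R q0 x) - (\<Sum>(x, k)\<in>p. h (Sup k) - h (Inf k))"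
          unfolding sum_subtractf[symmetric] w_def by (rule sum.cong) auto
        then show ?thesis using additive_tagged_division_1[OF \<open>a \<le> b\<close> p, of h] by simp
      qed
      also have "norm \<dots> \<le> (\<Sum>i\<in>p. \<bar>w i\<bar>)" unfolding real_norm_def by (rule sum_abs)
      also have "\<dots> \<le> (\<Sum>i\<in>p. \<epsilon> * (case i of (x, k) \<Rightarrow> Sup k - Inf k) + (if i \<in> P then (case i of (x, k) \<Rightarrow> \<bar>h (Sup k) - h (Inf k)\<bar>) else 0))"
        by (intro sum_mono w1)
      also have "\<dots> = \<epsilon> * (\<Sum>(x, k)\<in>p. Sup k - Inf k) + (\<Sum>(x, k)\<in>P. \<bar>h (Sup k) - h (Inf k)\<bar>)"
        unfolding sum.distrib sum_distrib_left[symmetric] using fp Pp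
        by (subst sum.inter_restrict[symmetric]) (auto simp: Int_absorb1)
      also have "(\<Sum>(x, k)\<in>p. Sup k - Inf k) = b - a"
        using additive_tagged_division_1[OF \<open>a \<le> b\<close> p, of "\<lambda>x. x"] by simp
      finally show "norm ((\<Sum>(x, k)\<in>p. measure lborel k *\<^sub>R q0 x) - (h b - h a)) < e"
        using vP \<epsilon>(2) by linarith
    qed
  qed
  then show ?thesis
    by (rule has_integral_spike[OF M, rotated]) (auto simp: q0_def)
qed

section \<open>Differentiation of indefinite integrals\<close>

lemma has_integral_0_nonneg_imp_negligible:
  fixes f :: "real \<Rightarrow> real"
  assumes "(f has_integral 0) {a..b}" "\<And>x. x \<in> {a..b} \<Longrightarrow> 0 \<le> f x"
  shows "negligible {x \<in> {a..b}. f x \<noteq> 0}"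
proof -
  have "f absolutely_integrable_on {a..b}"
    using assms by (intro nonnegative_absolutely_integrable_1) auto
  then have int: "integrable (lebesgue_on {a..b}) f"
    by (simp add: absolutely_integrable_imp_integrable)
  then have "integral\<^sup>L (lebesgue_on {a..b}) f = 0"
    using assms(1) by (simp add: lebesgue_integral_eq_integral integral_unique)
  moreover have "AE x in lebesgue_on {a..b}. 0 \<le> f x" using assms(2) by (auto intro: AE_I2)
  ultimately have "AE x in lebesgue_on {a..b}. f x = 0"
    using integral_nonneg_eq_0_iff_AE[OF int] by simp
  then show ?thesis by (simp add: AE_lebesgue_on_iff_negligible)
qed

text \<open>By Henstock's lemma the Riemann sums of \<open>\<bar>f\<bar>\<close> tend to \<open>0\<close>.\<close>

lemma negligible_if_all_integrals_0:
  fixes f :: "real \<Rightarrow> real"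
  assumes f: "\<And>c d. \<lbrakk>a \<le> c; c \<le> d; d \<le> b\<rbrakk> \<Longrightarrow> (f has_integral 0) {c..d}"
  shows "negligible {x \<in> {a..b}. f x \<noteq> 0}"
proof (cases "a \<le> b")
  case True
  have "((\<lambda>x. \<bar>f x\<bar>) has_integral 0) {a..b}"
    unfolding has_integral_real
  proof (intro allI impI)
    fix e :: real assume "0 < e"
    have int: "f integrable_on cbox a b" using f[of a b] True by auto
    have "\<exists>\<gamma>. gauge \<gamma> \<and> (\<forall>p. p tagged_partial_division_of (cbox a b) \<longrightarrow> \<gamma> fine p \<longrightarrow>
             sum (\<lambda>(x,k). norm (measure lborel k *\<^sub>R f x - integral k f)) p < e)"
    proof (rule Henstock_lemma[OF int \<open>0 < e\<close>])
      fix \<gamma> :: "real \<Rightarrow> real set"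
      assume "gauge \<gamma>" and *: "\<And>p. \<lbrakk>p tagged_partial_division_of (cbox a b); \<gamma> fine p\<rbrakk> \<Longrightarrow>
             sum (\<lambda>(x,k). norm (measure lborel k *\<^sub>R f x - integral k f)) p < e"
      then show ?thesis by (intro exI conjI allI impI *)
    qed
    then obtain \<gamma> where \<gamma>: "gauge \<gamma>"
      and sm: "\<And>p. \<lbrakk>p tagged_partial_division_of (cbox a b); \<gamma> fine p\<rbrakk> \<Longrightarrow>
             sum (\<lambda>(x,k). norm (measure lborel k *\<^sub>R f x - integral k f)) p < e"
      by blast
    show "\<exists>\<gamma>. gauge \<gamma> \<and> (\<forall>p. p tagged_division_of {a..b} \<and> \<gamma> fine p \<longrightarrow>
        norm ((\<Sum>(x, k)\<in>p. measure lborel k *\<^sub>R \<bar>f x\<bar>) - 0) < e)"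
    proof (intro exI conjI allI impI; (elim conjE)?)
      fix p assume p: "p tagged_division_of {a..b}" and fine: "\<gamma> fine p"
      have "integral k f = 0" if "(x, k) \<in> p" for x k
      proof -
        note xk = that
        obtain u v where k: "k = {u..v}" using tagged_division_ofD(4)[OF p xk] by (auto simp: box_real)
        have "x \<in> k" "k \<subseteq> {a..b}" using tagged_division_ofD(2,3)[OF p xk] by simp_all
        then show ?thesis unfolding k by (intro integral_unique f) auto
      qed
      then have "(\<Sum>(x, k)\<in>p. measure lborel k *\<^sub>R \<bar>f x\<bar>) = (\<Sum>(x, k)\<in>p. norm (measure lborel k *\<^sub>R f x - integral k f))"
        by (intro sum.cong) (auto simp: abs_mult)
      moreover have "\<dots> < e"
        using p fine by (intro sm) (simp_all add: tagged_division_of_def)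
      moreover have "0 \<le> (\<Sum>(x, k)\<in>p. measure lborel k *\<^sub>R \<bar>f x\<bar>)"
        by (intro sum_nonneg) auto
      ultimately show "norm ((\<Sum>(x, k)\<in>p. measure lborel k *\<^sub>R \<bar>f x\<bar>) - 0) < e" by simp
    qed (rule \<gamma>)
  qed
  then show ?thesis
    using has_integral_0_nonneg_imp_negligible[of "\<lambda>x. \<bar>f x\<bar>"] by simp
qed simp

lemma sum_integral_nonoverlapping_le:
  fixes f :: "real \<Rightarrow> real"
  assumes f: "f integrable_on {a..b}" "\<And>x. x \<in> {a..b} \<Longrightarrow> 0 \<le> f x"
    and I: "finite I" "nonoverlapping I" "\<And>i. i \<in> I \<Longrightarrow> a \<le> fst i \<and> fst i \<le> snd i \<and> snd i \<le> b"
  shows "(\<Sum>i\<in>I. integral {fst i..snd i} f) \<le> integral {a..b} f"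
proof (rule has_integral_subset_le)
  show "(f has_integral (\<Sum>i\<in>I. integral {fst i..snd i} f)) (\<Union>i\<in>I. {fst i<..<snd i})"
  proof (rule has_integral_UN[OF I(1)])
    show "(f has_integral integral {fst i..snd i} f) {fst i<..<snd i}" if "i \<in> I" for i
      unfolding has_integral_Icc_iff_Ioo[symmetric]
      using I(3)[OF that] f(1) by (intro integrable_integral integrable_on_subinterval[OF f(1)]) auto
    show "pairwise (\<lambda>i j. negligible ({fst i<..<snd i} \<inter> {fst j<..<snd j})) I"
      using I(2) by (simp add: nonoverlapping_def pairwise_def)
  qed
  show "(\<Union>i\<in>I. {fst i<..<snd i}) \<subseteq> {a..b}" using I(3) by fastforce
  show "(f has_integral integral {a..b} f) {a..b}" using f(1) by (rule integrable_integral)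
qed (use f in auto)

text \<open>Young's inequality \<open>\<bar>g\<bar> \<le> 1 / (2\<eta>) + \<eta> g\<^sup>2 / 2\<close> takes the place of uniform integrability here.\<close>

lemma abs_cont_on_indefinite_integral:
  fixes g :: "real \<Rightarrow> real"
  assumes g: "g integrable_on {a..b}" and g2: "(\<lambda>x. (g x)\<^sup>2) integrable_on {a..b}"
  shows "abs_cont_on a b (\<lambda>x. integral {a..x} g)"
  unfolding abs_cont_on_iff
proof (intro allI impI)
  fix e :: real assume e: "0 < e"
  define J where "J = integral {a..b} (\<lambda>x. (g x)\<^sup>2)"
  have J: "0 \<le> J" unfolding J_def by (rule integral_nonneg[OF g2]) simp
  \<comment> \<open>In Young's inequality, a family of length below \<open>\<eta> * e\<close>
    contributes at most \<open>e / 2\<close> through the constant term, and the square term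
    contributes at most \<open>\<eta> / 2 * J\<close>, which is below \<open>e / 2\<close>.\<close>
  define \<eta> where "\<eta> = e / (J + 1)"
  have \<eta>: "0 < \<eta>" "\<eta> / 2 * J < e / 2" using e J by (auto simp: \<eta>_def field_simps)
  have "variation (\<lambda>x. integral {a..x} g) I < e" if I: "I \<in> small_families a b (\<eta> * e)" for I
  proof -
    have I': "finite I" "nonoverlapping I" "\<And>i. i \<in> I \<Longrightarrow> a \<le> fst i \<and> fst i \<le> snd i \<and> snd i \<le> b"
      "(\<Sum>i\<in>I. snd i - fst i) < \<eta> * e"
      using I by (auto simp: small_families_def)
    have "\<bar>integral {a..snd i} g - integral {a..fst i} g\<bar>
        \<le> (snd i - fst i) / (2 * \<eta>) + \<eta> / 2 * integral {fst i..snd i} (\<lambda>x. (g x)\<^sup>2)" if "i \<in> I" for i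
    proof -
      note i = I'(3)[OF that]
      have int: "h integrable_on {fst i..snd i}" if "h integrable_on {a..b}" for h :: "real \<Rightarrow> real"
        by (rule integrable_on_subinterval[OF that]) (use i in auto)
      have "g integrable_on {a..snd i}"
        by (rule integrable_on_subinterval[OF g]) (use i in auto)
      then have "integral {a..fst i} g + integral {fst i..snd i} g = integral {a..snd i} g"
        using i by (intro Henstock_Kurzweil_Integration.integral_combine) auto
      then have "\<bar>integral {a..snd i} g - integral {a..fst i} g\<bar> = norm (integral {fst i..snd i} g)" by simp
      also have "\<dots> \<le> integral {fst i..snd i} (\<lambda>x. 1 / (2 * \<eta>) + \<eta> / 2 * (g x)\<^sup>2)"
      proof (rule integral_norm_bound_integral[OF int[OF g]])
        show "(\<lambda>x. 1 / (2 * \<eta>) + \<eta> / 2 * (g x)\<^sup>2) integrable_on {fst i..snd i}"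
          using int[OF g2] by (intro integrable_add integrable_on_mult_right) auto
        show "norm (g x) \<le> 1 / (2 * \<eta>) + \<eta> / 2 * (g x)\<^sup>2" for x
        proof -
          have "0 \<le> (1 - \<eta> * \<bar>g x\<bar>)\<^sup>2 / (2 * \<eta>)" using \<eta>(1) by simp
          also have "\<dots> = 1 / (2 * \<eta>) + \<eta> / 2 * (g x)\<^sup>2 - \<bar>g x\<bar>"
            using \<eta>(1) by (simp add: field_simps power2_eq_square)
          finally show ?thesis by simp
        qed
      qed
      also have "\<dots> = (snd i - fst i) / (2 * \<eta>) + \<eta> / 2 * integral {fst i..snd i} (\<lambda>x. (g x)\<^sup>2)"
        using int[OF g2] i by (subst integral_add) (auto intro!: integrable_on_mult_right)
      finally show ?thesis .
    qed
    then have "variation (\<lambda>x. integral {a..x} g) I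
        \<le> (\<Sum>i\<in>I. (snd i - fst i) / (2 * \<eta>) + \<eta> / 2 * integral {fst i..snd i} (\<lambda>x. (g x)\<^sup>2))"
      unfolding variation_def by (rule sum_mono)
    also have "\<dots> = (\<Sum>i\<in>I. snd i - fst i) / (2 * \<eta>) + \<eta> / 2 * (\<Sum>i\<in>I. integral {fst i..snd i} (\<lambda>x. (g x)\<^sup>2))"
      by (simp add: sum.distrib sum_distrib_left sum_divide_distrib)
    also have "\<dots> \<le> (\<eta> * e) / (2 * \<eta>) + \<eta> / 2 * J"
      using I' \<eta>(1) sum_integral_nonoverlapping_le[OF g2 _ I'(1-3)]
      by (intro add_mono divide_right_mono mult_left_mono) (auto simp: J_def)
    also have "\<dots> < e" using \<eta> by simp
    finally show ?thesis .
  qed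
  then show "\<exists>d>0. \<forall>I\<in>small_families a b d. variation (\<lambda>x. integral {a..x} g) I < e"
    using \<eta>(1) e by (intro exI[of _ "\<eta> * e"]) auto
qed

text \<open>The indefinite integral \<open>H\<close> is absolutely continuous, so its almost
  everywhere derivative \<open>p\<close> exists. Both \<open>p\<close> and \<open>g\<close>
  integrate to the increments of \<open>H\<close> on every subinterval, which forces
  \<open>p\<close> and \<open>g\<close> to agree almost everywhere.\<close>

lemma indefinite_integral_has_derivative_ae:
  fixes g :: "real \<Rightarrow> real"
  assumes g: "g integrable_on {a..b}" and g2: "(\<lambda>x. (g x)\<^sup>2) integrable_on {a..b}"
  obtains N where "negligible N"
    "\<And>x. x \<in> {a<..<b} - N \<Longrightarrow> ((\<lambda>x. integral {a..x} g) has_real_derivative g x) (at x)"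
proof -
  define H where "H x = integral {a..x} g" for x
  have ac: "abs_cont_on a b H"
    unfolding H_def by (rule abs_cont_on_indefinite_integral[OF assms])
  define N1 where "N1 = {x \<in> {a<..<b}. \<not> H differentiable (at x)}"
  have N1: "negligible N1" unfolding N1_def by (rule abs_cont_on_differentiable_ae[OF ac])
  define p where "p = deriv H"
  have p: "(H has_real_derivative p x) (at x)" if "x \<in> {a<..<b} - N1" for x
    using that unfolding N1_def p_def by (auto simp: DERIV_deriv_iff_real_differentiable)
  have "((\<lambda>x. p x - g x) has_integral 0) {c..d}" if cd: "a \<le> c" "c \<le> d" "d \<le> b" for c d
  proof -
    have P: "(p has_integral (H d - H c)) {c..d}"
      by (rule abs_cont_on_has_integral[OF cd(2) abs_cont_on_subset[OF ac cd(1,3)] N1])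
         (use cd in \<open>intro p; auto\<close>)
    have G: "(g has_integral (H d - H c)) {c..d}"
    proof -
      have "g integrable_on {c..d}" "g integrable_on {a..d}"
        using cd by (auto intro!: integrable_on_subinterval[OF g])
      then show ?thesis
        using Henstock_Kurzweil_Integration.integral_combine[of a c d g] cd by (auto simp: H_def has_integral_iff)
    qed
    show ?thesis using has_integral_diff[OF P G] by simp
  qed
  then have N2: "negligible {x \<in> {a..b}. p x - g x \<noteq> 0}" by (rule negligible_if_all_integrals_0)
  show thesis
  proof (rule that)
    show "negligible (N1 \<union> {x \<in> {a..b}. p x - g x \<noteq> 0})" using N1 N2 by (rule negligible_Un)
    show "((\<lambda>x. integral {a..x} g) has_real_derivative g x) (at x)"
      if "x \<in> {a<..<b} - (N1 \<union> {x \<in> {a..b}. p x - g x \<noteq> 0})" for x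
    proof -
      have "p x = g x" using that by auto
      then show ?thesis using p[of x] that unfolding H_def by auto
    qed
  qed
qed

section \<open>Square integrable functions\<close>

definition square_integrable :: "real \<Rightarrow> real \<Rightarrow> (real \<Rightarrow> real) \<Rightarrow> bool" where
  "square_integrable a b g \<longleftrightarrow> g \<in> borel_measurable (lebesgue_on {a..b}) \<and>
     integrable (lebesgue_on {a..b}) (\<lambda>x. (g x)\<^sup>2)"

lemma square_integrable_add:
  assumes "square_integrable a b f" "square_integrable a b g"
  shows "square_integrable a b (\<lambda>x. f x + g x)"
proof -
  have m: "f \<in> borel_measurable (lebesgue_on {a..b})" "g \<in> borel_measurable (lebesgue_on {a..b})"
    using assms by (auto simp: square_integrable_def)
  have "integrable (lebesgue_on {a..b}) (\<lambda>x. (f x + g x)\<^sup>2)"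
  proof (rule Bochner_Integration.integrable_bound)
    show "integrable (lebesgue_on {a..b}) (\<lambda>x. 2 * (f x)\<^sup>2 + 2 * (g x)\<^sup>2)"
      using assms by (auto simp: square_integrable_def)
    show "AE x in lebesgue_on {a..b}. norm ((f x + g x)\<^sup>2) \<le> norm (2 * (f x)\<^sup>2 + 2 * (g x)\<^sup>2)"
    proof (rule AE_I2)
      fix x
      have "0 \<le> (f x - g x)\<^sup>2" by simp
      then have "(f x + g x)\<^sup>2 \<le> 2 * (f x)\<^sup>2 + 2 * (g x)\<^sup>2"
        unfolding power2_sum power2_diff by linarith
      also have "\<dots> \<le> norm (2 * (f x)\<^sup>2 + 2 * (g x)\<^sup>2)" unfolding real_norm_def by (rule abs_ge_self)
      finally show "norm ((f x + g x)\<^sup>2) \<le> norm (2 * (f x)\<^sup>2 + 2 * (g x)\<^sup>2)" by simp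
    qed
  qed (use m in measurable)
  then show ?thesis using m by (simp add: square_integrable_def)
qed

lemma square_integrable_mult_continuous:
  assumes f: "continuous_on {a..b} f" and g: "square_integrable a b g"
  shows "square_integrable a b (\<lambda>x. f x * g x)"
proof -
  have m: "f \<in> borel_measurable (lebesgue_on {a..b})" "g \<in> borel_measurable (lebesgue_on {a..b})"
    using g continuous_imp_measurable_on_sets_lebesgue[OF f] by (auto simp: square_integrable_def)
  have "bounded (f ` {a..b})" using f by (intro compact_imp_bounded compact_continuous_image) auto
  then have "\<exists>M. \<forall>x\<in>{a..b}. \<bar>f x\<bar> \<le> M" by (auto simp: bounded_iff)
  then obtain M where M: "\<And>x. x \<in> {a..b} \<Longrightarrow> \<bar>f x\<bar> \<le> M" by blast
  have "integrable (lebesgue_on {a..b}) (\<lambda>x. (f x * g x)\<^sup>2)"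
  proof (rule Bochner_Integration.integrable_bound)
    show "integrable (lebesgue_on {a..b}) (\<lambda>x. M\<^sup>2 * (g x)\<^sup>2)"
      using g by (auto simp: square_integrable_def)
    show "AE x in lebesgue_on {a..b}. norm ((f x * g x)\<^sup>2) \<le> norm (M\<^sup>2 * (g x)\<^sup>2)"
    proof (rule AE_I2)
      fix x assume "x \<in> space (lebesgue_on {a..b})"
      then have "\<bar>f x\<bar> \<le> \<bar>M\<bar>" using M[of x] by simp
      then have "(f x)\<^sup>2 \<le> M\<^sup>2" by (rule abs_le_square_iff[THEN iffD1])
      then show "norm ((f x * g x)\<^sup>2) \<le> norm (M\<^sup>2 * (g x)\<^sup>2)"
        by (simp add: power_mult_distrib mult_right_mono)
    qed
  qed (use m in measurable)
  then show ?thesis using m by (simp add: square_integrable_def)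
qed

lemma square_integrable_continuous:
  assumes "continuous_on {a..b} f"
  shows "square_integrable a b f"
proof -
  have "square_integrable a b (\<lambda>x. 1)"
    by (simp add: square_integrable_def)
  from square_integrable_mult_continuous[OF assms this] show ?thesis by simp
qed

text \<open>The Laplacian of a solution is controlled only off a null set, so square integrability
  has to survive arbitrary changes there. Completeness of Lebesgue measure preserves
  measurability.\<close>

lemma square_integrable_cong_AE:
  assumes f: "square_integrable a b f" and N: "negligible N" and eq: "\<And>x. x \<in> {a..b} - N \<Longrightarrow> g x = f x"
  shows "square_integrable a b g"
proof -
  have ae: "AE x in lebesgue. (if x \<in> {a..b} then f x else 0) = (if x \<in> {a..b} then g x else 0)"
  proof (rule AE_I'[of N])
    show "N \<in> null_sets lebesgue" using N by (simp add: negligible_iff_null_sets)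
    have "(if x \<in> {a..b} then f x else 0) = (if x \<in> {a..b} then g x else 0)" if "x \<notin> N" for x
      using eq[of x] that by simp
    then show "{x \<in> space lebesgue. (if x \<in> {a..b} then f x else 0) \<noteq> (if x \<in> {a..b} then g x else 0)} \<subseteq> N"
      by blast
  qed
  have "(\<lambda>x. if x \<in> {a..b} then f x else 0) \<in> borel_measurable lebesgue"
    using f by (intro borel_measurable_if_I) (auto simp: square_integrable_def)
  from borel_measurable_AE[OF this ae]
  have gm: "g \<in> borel_measurable (lebesgue_on {a..b})" by (rule borel_measurable_if_D)
  have "AE x in lebesgue_on {a..b}. (g x)\<^sup>2 = (f x)\<^sup>2"
    unfolding AE_lebesgue_on_iff_negligible[OF lmeasurable_cbox[THEN fmeasurableD, of a b, unfolded box_real]]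
  proof (rule negligible_subset[OF N])
    have "(g x)\<^sup>2 = (f x)\<^sup>2" if "x \<in> {a..b} - N" for x using eq[OF that] by simp
    then show "{x \<in> {a..b}. (g x)\<^sup>2 \<noteq> (f x)\<^sup>2} \<subseteq> N" by blast
  qed
  moreover have "(\<lambda>x. (g x)\<^sup>2) \<in> borel_measurable (lebesgue_on {a..b})"
    "(\<lambda>x. (f x)\<^sup>2) \<in> borel_measurable (lebesgue_on {a..b})"
    using gm f by (auto simp: square_integrable_def)
  ultimately have "integrable (lebesgue_on {a..b}) (\<lambda>x. (g x)\<^sup>2)"
    using f integrable_cong_AE[of "\<lambda>x. (g x)\<^sup>2" "lebesgue_on {a..b}" "\<lambda>x. (f x)\<^sup>2"]
    by (auto simp: square_integrable_def)
  then show ?thesis using gm by (simp add: square_integrable_def)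
qed

lemma square_integrable_imp_integrable:
  assumes "square_integrable a b g"
  shows "integrable (lebesgue_on {a..b}) g"
proof (rule Bochner_Integration.integrable_bound)
  show "integrable (lebesgue_on {a..b}) (\<lambda>x. 1 + (g x)\<^sup>2)"
    using assms by (auto simp: square_integrable_def)
  show "g \<in> borel_measurable (lebesgue_on {a..b})"
    using assms by (simp add: square_integrable_def)
  show "AE x in lebesgue_on {a..b}. norm (g x) \<le> norm (1 + (g x)\<^sup>2)"
  proof (rule AE_I2)
    fix x
    have "0 \<le> (1 - \<bar>g x\<bar>)\<^sup>2 + 1 + (g x)\<^sup>2" by (intro add_nonneg_nonneg) auto
    then show "norm (g x) \<le> norm (1 + (g x)\<^sup>2)"
      by (simp add: power2_eq_square algebra_simps)
  qed
qed

lemma square_integrable_integrable_on: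
  assumes "square_integrable a b g"
  shows "g integrable_on {a..b}" "(\<lambda>x. \<bar>g x\<bar>) integrable_on {a..b}" "(\<lambda>x. (g x)\<^sup>2) integrable_on {a..b}"
  using square_integrable_imp_integrable[OF assms] integrable_abs[OF square_integrable_imp_integrable[OF assms]] assms
  by (auto simp: square_integrable_def intro!: integrable_on_lebesgue_on)

text \<open>Cauchy-Schwarz against the constant 1: integrate the square of
  \<open>t - \<bar>g x\<bar>\<close>, with \<open>t\<close> the mean of \<bar>g\<bar>, the constant
  that minimises this integral.\<close>

lemma integral_abs_le_sqrt:
  assumes g: "square_integrable a b g" and "a < b"
  shows "integral {a..b} (\<lambda>x. \<bar>g x\<bar>) \<le> sqrt (b - a) * sqrt (integral {a..b} (\<lambda>x. (g x)\<^sup>2))"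
proof -
  define I where "I = integral {a..b} (\<lambda>x. \<bar>g x\<bar>)"
  define J where "J = integral {a..b} (\<lambda>x. (g x)\<^sup>2)"
  define t where "t = I / (b - a)"
  note int = square_integrable_integrable_on[OF g]
  have "((\<lambda>x. t\<^sup>2 - 2 * t * \<bar>g x\<bar> + (g x)\<^sup>2) has_integral (b - a) * t\<^sup>2 - 2 * t * I + J) {a..b}"
    unfolding I_def J_def using \<open>a < b\<close> has_integral_const_real[of "t\<^sup>2" a b]
    by (intro has_integral_add has_integral_diff has_integral_mult_right integrable_integral int) auto
  then have "0 \<le> (b - a) * t\<^sup>2 - 2 * t * I + J"
  proof (rule has_integral_nonneg)
    fix x
    have "t\<^sup>2 - 2 * t * \<bar>g x\<bar> + (g x)\<^sup>2 = (t - \<bar>g x\<bar>)\<^sup>2" by (simp add: power2_diff)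
    then show "0 \<le> t\<^sup>2 - 2 * t * \<bar>g x\<bar> + (g x)\<^sup>2" by simp
  qed
  also have "\<dots> = J - I\<^sup>2 / (b - a)"
  proof -
    have "d * (I / d)\<^sup>2 - 2 * (I / d) * I + J = J - I\<^sup>2 / d" if "0 < d" for d
      using that by (simp add: field_simps power2_eq_square)
    then show ?thesis using \<open>a < b\<close> by (simp add: t_def)
  qed
  finally have "I\<^sup>2 \<le> (b - a) * J" using \<open>a < b\<close> by (simp add: field_simps)
  then have "I \<le> sqrt ((b - a) * J)" by (rule real_le_rsqrt)
  then show ?thesis by (simp add: I_def J_def real_sqrt_mult)
qed

lemma abs_integral_le:
  assumes g: "square_integrable 0 l g" and f: "continuous_on {0..l} f"
    and M: "\<And>x. x \<in> {0..l} \<Longrightarrow> \<bar>f x\<bar> \<le> M" and x: "x \<in> {0..l}"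
  shows "\<bar>integral {0..x} (\<lambda>t. f t * g t)\<bar> \<le> M * integral {0..l} (\<lambda>t. \<bar>g t\<bar>)"
proof -
  have M0: "0 \<le> M" using M[OF x] by linarith
  note int = square_integrable_integrable_on[OF g]
  have fg: "(\<lambda>t. f t * g t) integrable_on {0..x}"
    using x by (intro integrable_on_subinterval[OF square_integrable_integrable_on(1)[OF square_integrable_mult_continuous[OF f g]]]) auto
  have g0: "(\<lambda>t. \<bar>g t\<bar>) integrable_on {0..x}"
    using x by (intro integrable_on_subinterval[OF int(2)]) auto
  have "norm (integral {0..x} (\<lambda>t. f t * g t)) \<le> integral {0..x} (\<lambda>t. M * \<bar>g t\<bar>)"
  proof (rule integral_norm_bound_integral[OF fg])
    show "(\<lambda>t. M * \<bar>g t\<bar>) integrable_on {0..x}" using g0 by (rule integrable_on_mult_right)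
    show "norm (f t * g t) \<le> M * \<bar>g t\<bar>" if "t \<in> {0..x}" for t
      using M[of t] that x by (simp add: abs_mult mult_right_mono)
  qed
  also have "\<dots> = M * integral {0..x} (\<lambda>t. \<bar>g t\<bar>)" by simp
  also have "\<dots> \<le> M * integral {0..l} (\<lambda>t. \<bar>g t\<bar>)"
    using x int(2) g0 M0 by (intro mult_left_mono integral_subset_le) auto
  finally show ?thesis by simp
qed

section \<open>The equation \<open>- f'' = \<mu> f + g\<close> on an interval\<close>

text \<open>Together with \<open>sinf\<close>, the fundamental system of
  \<open>- f'' = \<mu> f\<close> whose values and derivatives at 0 are (1, 0) and (0, 1). The
  divisor in \<open>sinf\<close> gives this normalisation, and \<mu> = 0 is the limiting
  case.\<close>

definition cosf :: "real \<Rightarrow> real \<Rightarrow> real" where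
  "cosf \<mu> x = (if \<mu> > 0 then cos (sqrt \<mu> * x) else if \<mu> = 0 then 1 else cosh (sqrt (- \<mu>) * x))"

definition sinf :: "real \<Rightarrow> real \<Rightarrow> real" where
  "sinf \<mu> x = (if \<mu> > 0 then sin (sqrt \<mu> * x) / sqrt \<mu> else if \<mu> = 0 then x
     else sinh (sqrt (- \<mu>) * x) / sqrt (- \<mu>))"

lemma cosf_0 [simp]: "cosf \<mu> 0 = 1" and sinf_0 [simp]: "sinf \<mu> 0 = 0"
  by (auto simp: cosf_def sinf_def)

lemma DERIV_sinf: "(sinf \<mu> has_real_derivative cosf \<mu> x) (at x within S)"
proof -
  consider "\<mu> > 0" | "\<mu> = 0" | "\<mu> < 0" by linarith
  then show ?thesis
  proof cases
    case 1
    have "((\<lambda>x. sin (k * x) / k) has_real_derivative cos (k * x)) (at x within S)" if "k \<noteq> 0" for k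
      using that by (auto intro!: derivative_eq_intros)
    from this[of "sqrt \<mu>"] have "((\<lambda>x. sin (sqrt \<mu> * x) / sqrt \<mu>) has_real_derivative cos (sqrt \<mu> * x)) (at x within S)"
      using 1 by simp
    then show ?thesis using 1 by (simp add: sinf_def[abs_def] cosf_def)
  next
    case 2
    then show ?thesis by (simp add: sinf_def[abs_def] cosf_def)
  next
    case 3
    have "((\<lambda>x. sinh (k * x) / k) has_real_derivative cosh (k * x)) (at x within S)" if "k \<noteq> 0" for k
      using that by (auto intro!: derivative_eq_intros)
    from this[of "sqrt (- \<mu>)"] have "((\<lambda>x. sinh (sqrt (- \<mu>) * x) / sqrt (- \<mu>)) has_real_derivative cosh (sqrt (- \<mu>) * x)) (at x within S)"
      using 3 by simp
    then show ?thesis using 3 by (simp add: sinf_def[abs_def] cosf_def)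
  qed
qed

lemma DERIV_cosf: "(cosf \<mu> has_real_derivative - \<mu> * sinf \<mu> x) (at x within S)"
proof -
  consider "\<mu> > 0" | "\<mu> = 0" | "\<mu> < 0" by linarith
  then show ?thesis
  proof cases
    case 1
    have "((\<lambda>x. cos (sqrt \<mu> * x)) has_real_derivative - sqrt \<mu> * sin (sqrt \<mu> * x)) (at x within S)"
      by (auto intro!: derivative_eq_intros)
    moreover have "- sqrt \<mu> * sin (sqrt \<mu> * x) = - \<mu> * sinf \<mu> x"
    proof -
      have "- k * s = - (k * k) * (s / k)" if "k \<noteq> 0" for k s :: real using that by simp
      from this[of "sqrt \<mu>"] show ?thesis using 1 by (simp add: sinf_def)
    qed
    ultimately show ?thesis using 1 by (simp add: cosf_def[abs_def])
  next
    case 2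
    then show ?thesis by (simp add: cosf_def[abs_def])
  next
    case 3
    have "((\<lambda>x. cosh (sqrt (- \<mu>) * x)) has_real_derivative sqrt (- \<mu>) * sinh (sqrt (- \<mu>) * x)) (at x within S)"
      by (auto intro!: derivative_eq_intros)
    moreover have "sqrt (- \<mu>) * sinh (sqrt (- \<mu>) * x) = - \<mu> * sinf \<mu> x"
    proof -
      have "k * s = (k * k) * (s / k)" if "k \<noteq> 0" for k s :: real using that by simp
      from this[of "sqrt (- \<mu>)"] show ?thesis using 3 by (simp add: sinf_def)
    qed
    ultimately show ?thesis using 3 by (simp add: cosf_def[abs_def])
  qed
qed

lemma cosf_sinf_identity: "(cosf \<mu> x)\<^sup>2 + \<mu> * (sinf \<mu> x)\<^sup>2 = 1"
proof -
  consider "\<mu> > 0" | "\<mu> = 0" | "\<mu> < 0" by linarith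
  then show ?thesis
    by cases (auto simp: cosf_def sinf_def power_divide cosh_square_eq)
qed

lemma continuous_on_cosf: "continuous_on S (cosf \<mu>)"
  by (rule DERIV_continuous_on[OF DERIV_cosf])

lemma continuous_on_sinf: "continuous_on S (sinf \<mu>)"
  by (rule DERIV_continuous_on[OF DERIV_sinf])

lemma abs_cont_on_C1:
  assumes der: "\<And>x. x \<in> {a..b} \<Longrightarrow> (f has_real_derivative f' x) (at x within {a..b})"
    and cont: "continuous_on {a..b} f'"
  shows "abs_cont_on a b f"
proof -
  have "bounded (f' ` {a..b})" using cont by (intro compact_imp_bounded compact_continuous_image) auto
  then have "\<exists>M. \<forall>x\<in>{a..b}. \<bar>f' x\<bar> \<le> M" by (auto simp: bounded_iff)
  then obtain M where M: "\<And>x. x \<in> {a..b} \<Longrightarrow> \<bar>f' x\<bar> \<le> M" by blast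
  show ?thesis
  proof (rule abs_cont_on_lipschitz[of "\<bar>M\<bar>"])
    fix s t assume st: "a \<le> s" "s \<le> t" "t \<le> b"
    have "norm (f t - f s) \<le> \<bar>M\<bar> * norm (t - s)"
      by (rule field_differentiable_bound[where S = "{a..b}" and f' = f'])
         (use der st M in \<open>auto intro: order_trans[OF _ abs_ge_self]\<close>)
    then show "\<bar>f t - f s\<bar> \<le> \<bar>M\<bar> * (t - s)" using st by simp
  qed simp
qed

lemma abs_cont_on_cosf: "abs_cont_on a b (cosf \<mu>)"
  by (rule abs_cont_on_C1[OF DERIV_cosf]) (intro continuous_intros continuous_on_sinf)

lemma abs_cont_on_sinf: "abs_cont_on a b (sinf \<mu>)"
  by (rule abs_cont_on_C1[OF DERIV_sinf]) (rule continuous_on_cosf)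

lemma abs_cont_on_const: "abs_cont_on a b (\<lambda>x. c)"
  by (rule abs_cont_on_lipschitz[of 0]) auto

lemma abs_cont_on_cmult: "abs_cont_on a b f \<Longrightarrow> abs_cont_on a b (\<lambda>x. c * f x)"
  by (rule abs_cont_on_mult[OF abs_cont_on_const])

lemma abs_cont_on_diff:
  "abs_cont_on a b f \<Longrightarrow> abs_cont_on a b g \<Longrightarrow> abs_cont_on a b (\<lambda>x. f x - g x)"
  using abs_cont_on_add[of a b f "\<lambda>x. (-1) * g x"] abs_cont_on_cmult[of a b g "-1"] by simp

definition Cint :: "real \<Rightarrow> (real \<Rightarrow> real) \<Rightarrow> real \<Rightarrow> real" where
  "Cint \<mu> g x = integral {0..x} (\<lambda>t. cosf \<mu> t * g t)"

definition Sint :: "real \<Rightarrow> (real \<Rightarrow> real) \<Rightarrow> real \<Rightarrow> real" where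
  "Sint \<mu> g x = integral {0..x} (\<lambda>t. sinf \<mu> t * g t)"

text \<open>Variation of parameters for \<open>- f'' = \<mu> f + g\<close> with \<open>f 0 = A\<close> and \<open>f' 0 = B\<close>.\<close>

definition ode_sol :: "real \<Rightarrow> real \<Rightarrow> real \<Rightarrow> (real \<Rightarrow> real) \<Rightarrow> real \<Rightarrow> real" where
  "ode_sol \<mu> A B g x = (A + Sint \<mu> g x) * cosf \<mu> x + (B - Cint \<mu> g x) * sinf \<mu> x"

definition ode_sol' :: "real \<Rightarrow> real \<Rightarrow> real \<Rightarrow> (real \<Rightarrow> real) \<Rightarrow> real \<Rightarrow> real" where
  "ode_sol' \<mu> A B g x = (B - Cint \<mu> g x) * cosf \<mu> x - \<mu> * ((A + Sint \<mu> g x) * sinf \<mu> x)"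

lemma Cint_0 [simp]: "Cint \<mu> g 0 = 0" and Sint_0 [simp]: "Sint \<mu> g 0 = 0"
  by (simp_all add: Cint_def Sint_def)

lemma ode_sol_0 [simp]: "ode_sol \<mu> A B g 0 = A" and ode_sol'_0 [simp]: "ode_sol' \<mu> A B g 0 = B"
  by (simp_all add: ode_sol_def ode_sol'_def)

context
  fixes l \<mu> :: real and g :: "real \<Rightarrow> real"
  assumes l: "0 < l" and g: "square_integrable 0 l g"
begin

lemma Cint_integrable:
  "(\<lambda>t. cosf \<mu> t * g t) integrable_on {0..l}" "(\<lambda>t. (cosf \<mu> t * g t)\<^sup>2) integrable_on {0..l}"
  using square_integrable_integrable_on[OF square_integrable_mult_continuous[OF continuous_on_cosf g]] by auto

lemma Sint_integrable:
  "(\<lambda>t. sinf \<mu> t * g t) integrable_on {0..l}" "(\<lambda>t. (sinf \<mu> t * g t)\<^sup>2) integrable_on {0..l}"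
  using square_integrable_integrable_on[OF square_integrable_mult_continuous[OF continuous_on_sinf g]] by auto

lemma abs_cont_on_Cint: "abs_cont_on 0 l (Cint \<mu> g)"
  unfolding Cint_def[abs_def] by (rule abs_cont_on_indefinite_integral[OF Cint_integrable])

lemma abs_cont_on_Sint: "abs_cont_on 0 l (Sint \<mu> g)"
  unfolding Sint_def[abs_def] by (rule abs_cont_on_indefinite_integral[OF Sint_integrable])

lemma Cint_Sint_derivative_ae:
  obtains N where "negligible N"
    "\<And>x. x \<in> {0<..<l} - N \<Longrightarrow> (Cint \<mu> g has_real_derivative cosf \<mu> x * g x) (at x)"
    "\<And>x. x \<in> {0<..<l} - N \<Longrightarrow> (Sint \<mu> g has_real_derivative sinf \<mu> x * g x) (at x)"
proof -
  obtain N1 where N1: "negligible N1"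
    "\<And>x. x \<in> {0<..<l} - N1 \<Longrightarrow> (Cint \<mu> g has_real_derivative cosf \<mu> x * g x) (at x)"
    using indefinite_integral_has_derivative_ae[OF Cint_integrable, folded Cint_def] by blast
  obtain N2 where N2: "negligible N2"
    "\<And>x. x \<in> {0<..<l} - N2 \<Longrightarrow> (Sint \<mu> g has_real_derivative sinf \<mu> x * g x) (at x)"
    using indefinite_integral_has_derivative_ae[OF Sint_integrable, folded Sint_def] by blast
  show thesis
    by (rule that[of "N1 \<union> N2"]) (use N1 N2 in auto)
qed

lemma abs_cont_on_ode_sol: "abs_cont_on 0 l (ode_sol \<mu> A B g)"
  unfolding ode_sol_def[abs_def]
  by (intro abs_cont_on_add abs_cont_on_mult abs_cont_on_diff abs_cont_on_const abs_cont_on_cosf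
      abs_cont_on_sinf abs_cont_on_Cint abs_cont_on_Sint)

lemma abs_cont_on_ode_sol': "abs_cont_on 0 l (ode_sol' \<mu> A B g)"
  unfolding ode_sol'_def[abs_def]
  by (intro abs_cont_on_add abs_cont_on_mult abs_cont_on_diff abs_cont_on_const abs_cont_on_cosf
      abs_cont_on_sinf abs_cont_on_Cint abs_cont_on_Sint)

lemma ode_sol'_derivative_ae:
  obtains N where "negligible N"
    "\<And>x. x \<in> {0<..<l} - N \<Longrightarrow>
       (ode_sol' \<mu> A B g has_real_derivative - \<mu> * ode_sol \<mu> A B g x - g x) (at x)"
proof -
  obtain N where N: "negligible N"
    "\<And>x. x \<in> {0<..<l} - N \<Longrightarrow> (Cint \<mu> g has_real_derivative cosf \<mu> x * g x) (at x)"
    "\<And>x. x \<in> {0<..<l} - N \<Longrightarrow> (Sint \<mu> g has_real_derivative sinf \<mu> x * g x) (at x)"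
    using Cint_Sint_derivative_ae by blast
  show thesis
  proof (rule that[OF N(1)])
    fix x assume x: "x \<in> {0<..<l} - N"
    have "(ode_sol' \<mu> A B g has_real_derivative
        ((B - Cint \<mu> g x) * (- \<mu> * sinf \<mu> x) + (0 - cosf \<mu> x * g x) * cosf \<mu> x)
        - \<mu> * ((A + Sint \<mu> g x) * cosf \<mu> x + (0 + sinf \<mu> x * g x) * sinf \<mu> x)) (at x)"
      unfolding ode_sol'_def[abs_def]
      by (rule derivative_eq_intros N(2)[OF x] N(3)[OF x] DERIV_cosf DERIV_sinf refl)+ (simp add: algebra_simps)
    moreover have "((B - Cint \<mu> g x) * (- \<mu> * sinf \<mu> x) + (0 - cosf \<mu> x * g x) * cosf \<mu> x)
        - \<mu> * ((A + Sint \<mu> g x) * cosf \<mu> x + (0 + sinf \<mu> x * g x) * sinf \<mu> x)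
        = - \<mu> * ode_sol \<mu> A B g x - ((cosf \<mu> x)\<^sup>2 + \<mu> * (sinf \<mu> x)\<^sup>2) * g x"
      by (simp add: ode_sol_def algebra_simps power2_eq_square)
    ultimately show "(ode_sol' \<mu> A B g has_real_derivative - \<mu> * ode_sol \<mu> A B g x - g x) (at x)"
      by (simp add: cosf_sinf_identity)
  qed
qed

text \<open>The product rule gives this derivative only almost everywhere; there the two terms
  containing \<open>g\<close> cancel. Since \<open>ode_sol\<close> is absolutely continuous, it is
  the integral of \<open>ode_sol'\<close>. The latter is continuous, so the derivative exists at
  every point, one-sided at the endpoints.\<close>

lemma ode_sol_derivative:
  assumes x: "x \<in> {0..l}"
  shows "(ode_sol \<mu> A B g has_real_derivative ode_sol' \<mu> A B g x) (at x within {0..l})"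
proof -
  obtain N where N: "negligible N"
    "\<And>x. x \<in> {0<..<l} - N \<Longrightarrow> (Cint \<mu> g has_real_derivative cosf \<mu> x * g x) (at x)"
    "\<And>x. x \<in> {0<..<l} - N \<Longrightarrow> (Sint \<mu> g has_real_derivative sinf \<mu> x * g x) (at x)"
    using Cint_Sint_derivative_ae by blast
  have der: "(ode_sol \<mu> A B g has_real_derivative ode_sol' \<mu> A B g x) (at x)" if x: "x \<in> {0<..<l} - N" for x
  proof -
    have "(ode_sol \<mu> A B g has_real_derivative
        ((A + Sint \<mu> g x) * (- \<mu> * sinf \<mu> x) + (0 + sinf \<mu> x * g x) * cosf \<mu> x)
        + ((B - Cint \<mu> g x) * cosf \<mu> x + (0 - cosf \<mu> x * g x) * sinf \<mu> x)) (at x)"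
      unfolding ode_sol_def[abs_def]
      by (rule derivative_eq_intros N(2)[OF x] N(3)[OF x] DERIV_cosf DERIV_sinf refl)+ (simp add: algebra_simps)
    then show ?thesis
      by (rule DERIV_cong) (simp add: ode_sol'_def algebra_simps)
  qed
  have "(ode_sol' \<mu> A B g has_integral (ode_sol \<mu> A B g y - ode_sol \<mu> A B g 0)) {0..y}" if "y \<in> {0..l}" for y
    by (rule abs_cont_on_has_integral[OF _ abs_cont_on_subset[OF abs_cont_on_ode_sol] N(1)])
       (use that in \<open>auto intro!: der\<close>)
  then have eq: "ode_sol \<mu> A B g y = A + integral {0..y} (ode_sol' \<mu> A B g)" if "y \<in> {0..l}" for y
    using that by (simp add: has_integral_iff)
  have "((\<lambda>y. A + integral {0..y} (ode_sol' \<mu> A B g)) has_real_derivative 0 + ode_sol' \<mu> A B g x) (at x within {0..l})"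
    by (intro DERIV_add DERIV_const integral_has_real_derivative x
        abs_cont_on_imp_continuous_on abs_cont_on_ode_sol')
  then show ?thesis
    using eq x by (subst has_field_derivative_cong_eventually[where g = "\<lambda>y. A + integral {0..y} (ode_sol' \<mu> A B g)"])
      (auto simp: eventually_at_filter)
qed

text \<open>Uniqueness: \<open>f C - f' S\<close> and \<open>f' C + \<mu> f S\<close> have the derivatives \<open>g S\<close> and \<open>- g C\<close> almost everywhere.\<close>

lemma ode_sol_unique:
  assumes f: "\<And>x. x \<in> {0..l} \<Longrightarrow> (f has_real_derivative f' x) (at x within {0..l})"
    and f': "abs_cont_on 0 l f'" and N: "negligible N"
    and f'': "\<And>x. x \<in> {0<..<l} - N \<Longrightarrow> (f' has_real_derivative - \<mu> * f x - g x) (at x)"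
    and x: "x \<in> {0..l}"
  shows "f x = ode_sol \<mu> (f 0) (f' 0) g x" "f' x = ode_sol' \<mu> (f 0) (f' 0) g x"
proof -
  have acf: "abs_cont_on 0 l f"
    by (rule abs_cont_on_C1[OF f abs_cont_on_imp_continuous_on[OF f']])
  have f1: "(f has_real_derivative f' x) (at x)" if "x \<in> {0<..<l}" for x
    using f[of x] that at_within_Icc_at[of 0 x l] by auto
  define U where "U x = f x * cosf \<mu> x - f' x * sinf \<mu> x" for x
  define V where "V x = f' x * cosf \<mu> x + \<mu> * (f x * sinf \<mu> x)" for x
  have acU: "abs_cont_on 0 l U" and acV: "abs_cont_on 0 l V"
    unfolding U_def V_def
    by (intro abs_cont_on_add abs_cont_on_mult abs_cont_on_diff abs_cont_on_const abs_cont_on_cosf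
      abs_cont_on_sinf acf f')+
  have dU: "(U has_real_derivative sinf \<mu> x * g x) (at x)" if x: "x \<in> {0<..<l} - N" for x
  proof -
    have x': "x \<in> {0<..<l}" using x by simp
    have "(U has_real_derivative (f x * (- \<mu> * sinf \<mu> x) + f' x * cosf \<mu> x)
        - (f' x * cosf \<mu> x + (- \<mu> * f x - g x) * sinf \<mu> x)) (at x)"
      unfolding U_def
      by (rule derivative_eq_intros f1[OF x'] f''[OF x] DERIV_cosf DERIV_sinf refl)+ (simp add: algebra_simps)
    then show ?thesis by (rule DERIV_cong) (simp add: algebra_simps)
  qed
  have dV: "(V has_real_derivative - (cosf \<mu> x * g x)) (at x)" if x: "x \<in> {0<..<l} - N" for x
  proof -
    have x': "x \<in> {0<..<l}" using x by simp
    have "(V has_real_derivative (f' x * (- \<mu> * sinf \<mu> x) + (- \<mu> * f x - g x) * cosf \<mu> x)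
        + \<mu> * (f x * cosf \<mu> x + f' x * sinf \<mu> x)) (at x)"
      unfolding V_def
      by (rule derivative_eq_intros f1[OF x'] f''[OF x] DERIV_cosf DERIV_sinf refl)+ (simp add: algebra_simps)
    then show ?thesis by (rule DERIV_cong) (simp add: algebra_simps)
  qed
  have "((\<lambda>t. sinf \<mu> t * g t) has_integral (U x - U 0)) {0..x}"
    by (rule abs_cont_on_has_integral[OF _ abs_cont_on_subset[OF acU] N]) (use x in \<open>auto intro!: dU\<close>)
  then have U: "U x = f 0 + Sint \<mu> g x" by (simp add: has_integral_iff Sint_def U_def)
  have "((\<lambda>t. - (cosf \<mu> t * g t)) has_integral (V x - V 0)) {0..x}"
    by (rule abs_cont_on_has_integral[OF _ abs_cont_on_subset[OF acV] N]) (use x in \<open>auto intro!: dV\<close>)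
  then have V: "V x = f' 0 - Cint \<mu> g x" by (simp add: has_integral_iff Cint_def V_def)
  \<comment> \<open>The pair (f, f') is recovered from (U, V) by inverting a 2 by 2 matrix whose
    determinant is the left-hand side of \<open>cosf_sinf_identity\<close>.\<close>
  have "f x = f x * ((cosf \<mu> x)\<^sup>2 + \<mu> * (sinf \<mu> x)\<^sup>2)" by (simp add: cosf_sinf_identity)
  also have "\<dots> = U x * cosf \<mu> x + V x * sinf \<mu> x"
    by (simp add: U_def V_def algebra_simps power2_eq_square)
  finally show "f x = ode_sol \<mu> (f 0) (f' 0) g x" by (simp add: U V ode_sol_def)
  have "f' x = f' x * ((cosf \<mu> x)\<^sup>2 + \<mu> * (sinf \<mu> x)\<^sup>2)" by (simp add: cosf_sinf_identity)
  also have "\<dots> = V x * cosf \<mu> x - \<mu> * (U x * sinf \<mu> x)"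
    by (simp add: U_def V_def algebra_simps power2_eq_square)
  finally show "f' x = ode_sol' \<mu> (f 0) (f' 0) g x" by (simp add: U V ode_sol'_def)
qed

end

lemma ode_sol_no_source [simp]:
  "ode_sol \<mu> A B (\<lambda>x. 0) x = A * cosf \<mu> x + B * sinf \<mu> x"
  "ode_sol' \<mu> A B (\<lambda>x. 0) x = B * cosf \<mu> x - \<mu> * (A * sinf \<mu> x)"
  by (simp_all add: ode_sol_def ode_sol'_def Cint_def Sint_def)

lemma abs_cont_on_cong:
  assumes "\<And>x. x \<in> {a..b} \<Longrightarrow> f x = g x"
  shows "abs_cont_on a b f \<longleftrightarrow> abs_cont_on a b g"
proof -
  have "variation f I = variation g I" if "I \<in> small_families a b d" for I d
    using that assms unfolding variation_def small_families_def by (intro sum.cong) fastforce+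
  then show ?thesis unfolding abs_cont_on_iff by (metis (no_types, lifting))
qed

section \<open>Functions on an equilateral graph\<close>

locale equilateral_graph =
  fixes E :: "('v::finite \<times> 'v) set" and len :: "'v \<times> 'v \<Rightarrow> real" and le :: real
  assumes graph: "metric_graph E len" and equi: "equilateral E len le"
begin

lemma len_eq: "e \<in> E \<Longrightarrow> len e = le"
  using equi by (simp add: equilateral_def)

lemma le_pos: "0 < le"
  using graph len_eq by (metis ex_in_conv metric_graph_def)

lemma fst_neq_snd: "e \<in> E \<Longrightarrow> fst e \<noteq> snd e"
  using graph by (cases e) (auto simp: metric_graph_def)

lemma connected_rtrancl: "(u, v) \<in> (E \<union> E\<inverse>)\<^sup>*"
  using graph by (auto simp: metric_graph_def)

text \<open>A path from \<open>v\<close> to an endpoint \<open>a\<close> of some edge either has a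
  first step or is trivial, and then \<open>v\<close> is \<open>a\<close>. Positive degrees are
  needed for the transition matrix and for means over incident edges.\<close>

lemma incident_nonempty: "incident E v \<noteq> {}"
proof -
  obtain a b where ab: "(a, b) \<in> E" using graph by (auto simp: metric_graph_def)
  have "(v, a) \<in> (E \<union> E\<inverse>)\<^sup>*" by (rule connected_rtrancl)
  then show ?thesis
  proof (cases rule: converse_rtranclE)
    case base
    then show ?thesis using ab by (auto simp: incident_def)
  next
    case (step w)
    then show ?thesis by (force simp: incident_def)
  qed
qed

lemma L2_iff:
  "f \<in> L2 E len \<longleftrightarrow> (\<forall>e x. \<not> (e \<in> E \<and> x \<in> {0..le}) \<longrightarrow> f e x = 0) \<and> (\<forall>e\<in>E. square_integrable 0 le (f e))"
  unfolding L2_def square_integrable_def using len_eq by (auto simp: Ball_def)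

lemma L2_zero: "(\<lambda>e x. 0) \<in> L2 E len"
  by (simp add: L2_iff square_integrable_continuous)

lemma ae_eq_iff:
  "ae_eq E len f g \<longleftrightarrow> (\<forall>e\<in>E. negligible {x \<in> {0..le}. f e x \<noteq> g e x})"
  unfolding ae_eq_def using len_eq by (simp add: AE_lebesgue_on_iff_negligible)

lemma gderiv_off_graph:
  assumes "\<not> (e \<in> E \<and> x \<in> {0..le})"
  shows "gderiv E len f e x = 0"
  using assms by (cases "e \<in> E") (simp_all add: gderiv_def len_eq, blast)

lemma gderiv_eq:
  assumes "e \<in> E" "x \<in> {0..le}" "(f e has_real_derivative d) (at x within {0..le})"
  shows "gderiv E len f e x = d"
proof -
  have "vector_derivative (f e) (at x within {0..le}) = d"
    using assms(2,3) le_pos vector_derivative_within_cbox[of 0 le x "f e" d]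
    by (simp add: has_real_derivative_iff_has_vector_derivative)
  then show ?thesis using assms(1,2) by (simp add: gderiv_def len_eq)
qed

lemma laplacian_eq:
  assumes e: "e \<in> E" and x: "x \<in> {0<..<le}" and d: "(gderiv E len f e has_real_derivative d) (at x)"
  shows "laplacian E len f e x = - d"
  unfolding laplacian_def using e x gderiv_eq[of e x "gderiv E len f" d] has_field_derivative_at_within[OF d]
  by (simp add: fun_Compl_def)

lemma maximal_domainD:
  assumes f: "f \<in> maximal_domain E len" and e: "e \<in> E"
  shows "abs_cont_on 0 le (gderiv E len f e)"
    and "x \<in> {0..le} \<Longrightarrow> (f e has_real_derivative gderiv E len f e x) (at x within {0..le})"
proof -
  show "abs_cont_on 0 le (gderiv E len f e)"
    using f e len_eq by (auto simp: maximal_domain_def)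
  assume x: "x \<in> {0..le}"
  have "f e differentiable_on {0..le}" using f e len_eq by (auto simp: maximal_domain_def)
  then have "\<exists>d. (f e has_real_derivative d) (at x within {0..le})"
    using x by (auto simp: differentiable_on_def real_differentiable_def)
  then obtain d where d: "(f e has_real_derivative d) (at x within {0..le})" by blast
  then show "(f e has_real_derivative gderiv E len f e x) (at x within {0..le})"
    using gderiv_eq[of e x f d, OF e x d] by simp
qed

definition gsol :: "real \<Rightarrow> ('v \<times> 'v \<Rightarrow> real) \<Rightarrow> ('v \<times> 'v \<Rightarrow> real) \<Rightarrow> 'v gfun \<Rightarrow> 'v gfun" where
  "gsol \<mu> A B g = (\<lambda>e x. if e \<in> E \<and> x \<in> {0..le} then ode_sol \<mu> (A e) (B e) (g e) x else 0)"

definition gsol' :: "real \<Rightarrow> ('v \<times> 'v \<Rightarrow> real) \<Rightarrow> ('v \<times> 'v \<Rightarrow> real) \<Rightarrow> 'v gfun \<Rightarrow> 'v gfun" where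
  "gsol' \<mu> A B g = (\<lambda>e x. if e \<in> E \<and> x \<in> {0..le} then ode_sol' \<mu> (A e) (B e) (g e) x else 0)"

text \<open>The first derivative of \<open>f\<close> is absolutely continuous, hence differentiable
  off a null set. Off a second null set the equation holds. So off their union it is a genuine
  equation for two-sided derivatives, as \<open>ode_sol_unique\<close> demands.\<close>

lemma maximal_domain_representation:
  assumes f: "f \<in> maximal_domain E len" and g: "g \<in> L2 E len"
    and eq: "ae_eq E len (\<lambda>e x. laplacian E len f e x - \<mu> * f e x) g"
  shows "f = gsol \<mu> (\<lambda>e. f e 0) (\<lambda>e. gderiv E len f e 0) g" (is ?A)
    and "gderiv E len f = gsol' \<mu> (\<lambda>e. f e 0) (\<lambda>e. gderiv E len f e 0) g" (is ?B)
proof -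
  have fL2: "f \<in> L2 E len" using f by (simp add: maximal_domain_def)
  have *: "f e x = ode_sol \<mu> (f e 0) (gderiv E len f e 0) (g e) x \<and>
      gderiv E len f e x = ode_sol' \<mu> (f e 0) (gderiv E len f e 0) (g e) x"
    if e: "e \<in> E" and x: "x \<in> {0..le}" for e x
  proof -
    define D where "D = gderiv E len f e"
    note D = maximal_domainD[OF f e, folded D_def]
    define N1 where "N1 = {x \<in> {0<..<le}. \<not> D differentiable (at x)}"
    define N2 where "N2 = {x \<in> {0..le}. laplacian E len f e x - \<mu> * f e x \<noteq> g e x}"
    have N1: "negligible N1" unfolding N1_def by (rule abs_cont_on_differentiable_ae[OF D(1)])
    have N2: "negligible N2" using eq e by (simp add: ae_eq_iff N2_def)
    have der: "(D has_real_derivative - \<mu> * f e x - g e x) (at x)" if x: "x \<in> {0<..<le} - (N1 \<union> N2)" for x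
    proof -
      obtain d where d: "(D has_real_derivative d) (at x)"
        using x by (auto simp: N1_def real_differentiable_def)
      have "laplacian E len f e x = - d"
        by (rule laplacian_eq[OF e]) (use x d in \<open>auto simp: D_def\<close>)
      moreover have "laplacian E len f e x - \<mu> * f e x = g e x"
        using x by (auto simp: N2_def)
      ultimately have "d = - \<mu> * f e x - g e x" by simp
      then show ?thesis using d by simp
    qed
    have ge: "square_integrable 0 le (g e)" using g e by (simp add: L2_iff)
    show ?thesis
      using ode_sol_unique[OF le_pos ge D(2) D(1) negligible_Un[OF N1 N2] der x] by (simp add: D_def)
  qed
  show ?A
    unfolding gsol_def using * fL2[unfolded L2_iff] by (intro ext) metis
  show ?B
    unfolding gsol'_def using * gderiv_off_graph by (intro ext) metis
qed

lemma gsol_derivative: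
  assumes g: "g \<in> L2 E len" and "e \<in> E" "x \<in> {0..le}"
  shows "(gsol \<mu> A B g e has_real_derivative ode_sol' \<mu> (A e) (B e) (g e) x) (at x within {0..le})"
proof -
  have ge: "square_integrable 0 le (g e)" using assms by (simp add: L2_iff)
  show ?thesis
    unfolding has_field_derivative_def
    by (rule has_derivative_transform[OF _ _ ode_sol_derivative[OF le_pos ge, unfolded has_field_derivative_def]])
       (use assms in \<open>auto simp: gsol_def\<close>)
qed

lemma gderiv_gsol:
  assumes g: "g \<in> L2 E len"
  shows "gderiv E len (gsol \<mu> A B g) = gsol' \<mu> A B g"
proof (intro ext)
  fix e x
  show "gderiv E len (gsol \<mu> A B g) e x = gsol' \<mu> A B g e x"
  proof (cases "e \<in> E \<and> x \<in> {0..le}")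
    case True
    then show ?thesis using gderiv_eq[OF _ _ gsol_derivative[OF g]] by (simp add: gsol'_def)
  next
    case False
    then show ?thesis using gderiv_off_graph[OF False] by (auto simp: gsol'_def)
  qed
qed

lemma laplacian_gsol_ae:
  assumes g: "g \<in> L2 E len" and e: "e \<in> E"
  obtains N where "negligible N"
    "\<And>x. x \<in> {0..le} - N \<Longrightarrow> laplacian E len (gsol \<mu> A B g) e x = \<mu> * ode_sol \<mu> (A e) (B e) (g e) x + g e x"
proof -
  have ge: "square_integrable 0 le (g e)" using g e by (simp add: L2_iff)
  obtain N where N: "negligible N"
    "\<And>x. x \<in> {0<..<le} - N \<Longrightarrow>
       (ode_sol' \<mu> (A e) (B e) (g e) has_real_derivative - \<mu> * ode_sol \<mu> (A e) (B e) (g e) x - g e x) (at x)"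
    using ode_sol'_derivative_ae[OF le_pos ge, of \<mu> "A e" "B e"] by blast
  show thesis
  proof (rule that[of "insert 0 (insert le N)"])
    show "negligible (insert 0 (insert le N))" using N(1) by simp
    fix x assume "x \<in> {0..le} - insert 0 (insert le N)"
    then have x: "x \<in> {0<..<le}" "x \<in> {0<..<le} - N" by auto
    have "(gsol' \<mu> A B g e has_real_derivative - \<mu> * ode_sol \<mu> (A e) (B e) (g e) x - g e x) (at x)"
      by (rule has_field_derivative_transform_within_open[OF N(2)[OF x(2)] open_greaterThanLessThan x(1)])
         (use e in \<open>auto simp: gsol'_def\<close>)
    then show "laplacian E len (gsol \<mu> A B g) e x = \<mu> * ode_sol \<mu> (A e) (B e) (g e) x + g e x"
      using laplacian_eq[OF e x(1), of "gsol \<mu> A B g"] by (simp add: gderiv_gsol[OF g])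
  qed
qed

lemma ae_eq_gsol:
  assumes g: "g \<in> L2 E len"
  shows "ae_eq E len (\<lambda>e x. laplacian E len (gsol \<mu> A B g) e x - \<mu> * gsol \<mu> A B g e x) g"
  unfolding ae_eq_iff
proof
  fix e assume e: "e \<in> E"
  obtain N where N: "negligible N"
    "\<And>x. x \<in> {0..le} - N \<Longrightarrow> laplacian E len (gsol \<mu> A B g) e x = \<mu> * ode_sol \<mu> (A e) (B e) (g e) x + g e x"
    using laplacian_gsol_ae[OF g e] by blast
  show "negligible {x \<in> {0..le}. laplacian E len (gsol \<mu> A B g) e x - \<mu> * gsol \<mu> A B g e x \<noteq> g e x}"
  proof (rule negligible_subset[OF N(1)], clarify, rule ccontr)
    fix x assume "x \<in> {0..le}" "x \<notin> N" "laplacian E len (gsol \<mu> A B g) e x - \<mu> * gsol \<mu> A B g e x \<noteq> g e x"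
    then show False using N(2)[of x] e by (simp add: gsol_def)
  qed
qed

lemma gsol_maximal_domain:
  assumes g: "g \<in> L2 E len"
  shows "gsol \<mu> A B g \<in> maximal_domain E len"
proof -
  have ge: "square_integrable 0 le (g e)" if "e \<in> E" for e using g that by (simp add: L2_iff)
  have ac: "abs_cont_on 0 le (gsol \<mu> A B g e)" if "e \<in> E" for e
    using abs_cont_on_ode_sol[OF le_pos ge[OF that]] that
    by (subst abs_cont_on_cong[where g = "ode_sol \<mu> (A e) (B e) (g e)"]) (auto simp: gsol_def)
  have ac': "abs_cont_on 0 le (gsol' \<mu> A B g e)" if "e \<in> E" for e
    using abs_cont_on_ode_sol'[OF le_pos ge[OF that]] that
    by (subst abs_cont_on_cong[where g = "ode_sol' \<mu> (A e) (B e) (g e)"]) (auto simp: gsol'_def)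
  have si: "square_integrable 0 le (ode_sol \<mu> (A e) (B e) (g e))" if "e \<in> E" for e
    by (intro square_integrable_continuous abs_cont_on_imp_continuous_on abs_cont_on_ode_sol[OF le_pos ge[OF that]])
  have 1: "gsol \<mu> A B g \<in> L2 E len"
    unfolding L2_iff
    using square_integrable_continuous[OF abs_cont_on_imp_continuous_on[OF ac]] by (auto simp: gsol_def)
  have 2: "gsol \<mu> A B g e differentiable_on {0..le}" if e: "e \<in> E" for e
    unfolding differentiable_on_def real_differentiable_def using gsol_derivative[OF g e] by blast
  have 3: "laplacian E len (gsol \<mu> A B g) \<in> L2 E len"
    unfolding L2_iff
  proof (intro conjI allI impI ballI)
    fix e x assume "\<not> (e \<in> E \<and> x \<in> {0..le})"
    then show "laplacian E len (gsol \<mu> A B g) e x = 0"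
      using gderiv_off_graph[of e x "gderiv E len (gsol \<mu> A B g)"] by (simp add: laplacian_def fun_Compl_def)
  next
    fix e assume e: "e \<in> E"
    obtain N where N: "negligible N"
      "\<And>x. x \<in> {0..le} - N \<Longrightarrow> laplacian E len (gsol \<mu> A B g) e x = \<mu> * ode_sol \<mu> (A e) (B e) (g e) x + g e x"
      using laplacian_gsol_ae[OF g e] by blast
    have "square_integrable 0 le (\<lambda>x. \<mu> * ode_sol \<mu> (A e) (B e) (g e) x + g e x)"
      by (intro square_integrable_add square_integrable_mult_continuous si ge e) auto
    then show "square_integrable 0 le (laplacian E len (gsol \<mu> A B g) e)"
      by (rule square_integrable_cong_AE[OF _ N])
  qed
  show ?thesis
    unfolding maximal_domain_def using 1 2 3 ac ac' by (simp add: gderiv_gsol[OF g] len_eq)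
qed

section \<open>Vertex conditions in terms of edge data\<close>

text \<open>
  In \<open>vsum\<close> and \<open>vertex_cond\<close>, \<open>A\<close> and \<open>B\<close> are the values and derivatives at the endpoints \<open>0\<close> of the edges,
  \<open>F\<close> and \<open>D\<close> those at the endpoints \<open>le\<close>.
\<close>

definition vsum :: "('v \<times> 'v \<Rightarrow> real) \<Rightarrow> ('v \<times> 'v \<Rightarrow> real) \<Rightarrow> 'v \<Rightarrow> real" where
  "vsum A F v = (\<Sum>e\<in>incident E v. if fst e = v then A e else F e)"

lemma vsum_add: "vsum (\<lambda>e. A e + A' e) (\<lambda>e. F e + F' e) v = vsum A F v + vsum A' F' v"
  unfolding vsum_def sum.distrib[symmetric] by (intro sum.cong) auto

lemma vsum_scale: "vsum (\<lambda>e. c * A e) (\<lambda>e. c * F e) v = c * vsum A F v"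
  unfolding vsum_def sum_distrib_left by (intro sum.cong) auto

lemma vsum_zero [simp]: "vsum (\<lambda>e. 0) (\<lambda>e. 0) v = 0"
  by (simp add: vsum_def)

lemma vsum_cong:
  assumes "\<And>e. e \<in> E \<Longrightarrow> A e = A' e" "\<And>e. e \<in> E \<Longrightarrow> F e = F' e"
  shows "vsum A F v = vsum A' F' v"
  unfolding vsum_def by (rule sum.cong) (use assms in \<open>auto simp: incident_def\<close>)

text \<open>Double counting: each edge meets exactly its two distinct endpoints. This makes
  \<open>vsum\<close> the adjoint of evaluation at edge ends, both for the energy identity with
  \<mu> \<le> 0 and for the duality of the incidence kernels.\<close>

lemma sum_vsum:
  "(\<Sum>v\<in>UNIV. y v * vsum A F v) = (\<Sum>e\<in>E. y (fst e) * A e + y (snd e) * F e)"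
proof -
  let ?h = "\<lambda>v e. y v * (if fst e = v then A e else F e)"
  have "(\<Sum>v\<in>UNIV. y v * vsum A F v) = (\<Sum>v\<in>UNIV. \<Sum>e\<in>{e \<in> E. fst e = v \<or> snd e = v}. ?h v e)"
    by (simp add: vsum_def sum_distrib_left incident_def)
  also have "\<dots> = (\<Sum>v\<in>UNIV. \<Sum>e\<in>E. if fst e = v \<or> snd e = v then ?h v e else 0)"
    by (rule sum.cong[OF refl], rule sum.inter_filter) simp
  also have "\<dots> = (\<Sum>e\<in>E. \<Sum>v\<in>UNIV. if fst e = v \<or> snd e = v then ?h v e else 0)"
    by (rule sum.swap)
  also have "\<dots> = (\<Sum>e\<in>E. y (fst e) * A e + y (snd e) * F e)"
  proof (rule sum.cong[OF refl])
    fix e assume e: "e \<in> E"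
    have "(\<Sum>v\<in>UNIV. if fst e = v \<or> snd e = v then ?h v e else 0) = (\<Sum>v\<in>{fst e, snd e}. ?h v e)"
      by (intro sum.mono_neutral_cong_right) auto
    then show "(\<Sum>v\<in>UNIV. if fst e = v \<or> snd e = v then ?h v e else 0) = y (fst e) * A e + y (snd e) * F e"
      using fst_neq_snd[OF e] by simp
  qed
  finally show ?thesis .
qed

definition vertex_cond ::
    "('v \<times> 'v \<Rightarrow> real) \<Rightarrow> ('v \<times> 'v \<Rightarrow> real) \<Rightarrow> ('v \<times> 'v \<Rightarrow> real) \<Rightarrow> ('v \<times> 'v \<Rightarrow> real) \<Rightarrow> bool" where
  "vertex_cond A B F D \<longleftrightarrow> (\<forall>v.
     (\<forall>e\<in>incident E v. \<forall>e'\<in>incident E v.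
        (if fst e = v then B e else - D e) = (if fst e' = v then B e' else - D e')) \<and>
     vsum A F v = 0)"

lemma vertex_cond_cong:
  assumes "\<And>e. e \<in> E \<Longrightarrow> A e = A' e" "\<And>e. e \<in> E \<Longrightarrow> B e = B' e"
    "\<And>e. e \<in> E \<Longrightarrow> F e = F' e" "\<And>e. e \<in> E \<Longrightarrow> D e = D' e"
  shows "vertex_cond A B F D \<longleftrightarrow> vertex_cond A' B' F' D'"
proof -
  have "vsum A F v = vsum A' F' v" for v by (rule vsum_cong) (simp_all add: assms)
  moreover have "(if fst e = v then B e else - D e) = (if fst e = v then B' e else - D' e)" if "e \<in> incident E v" for e v
    using assms(2,4)[of e] that by (simp add: incident_def)
  ultimately show ?thesis unfolding vertex_cond_def by simp
qed

lemma anti_standard_domain_iff: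
  "f \<in> anti_standard_domain E len \<longleftrightarrow> f \<in> maximal_domain E len \<and>
     vertex_cond (\<lambda>e. f e 0) (\<lambda>e. gderiv E len f e 0) (\<lambda>e. f e le) (\<lambda>e. gderiv E len f e le)"
proof -
  have "vertex_cond (\<lambda>e. f e 0) (\<lambda>e. gderiv E len f e 0) (\<lambda>e. f e le) (\<lambda>e. gderiv E len f e le)
    \<longleftrightarrow> vertex_cond (\<lambda>e. f e 0) (\<lambda>e. gderiv E len f e 0) (\<lambda>e. f e (len e)) (\<lambda>e. gderiv E len f e (len e))"
    by (rule vertex_cond_cong) (auto simp: len_eq)
  then show ?thesis
    unfolding anti_standard_domain_def vertex_cond_def vsum_def outgoing_deriv_def vertex_value_def by simp
qed

lemma gsol_anti_standard_iff:
  assumes g: "g \<in> L2 E len"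
  shows "gsol \<mu> A B g \<in> anti_standard_domain E len \<longleftrightarrow>
    vertex_cond A B (\<lambda>e. ode_sol \<mu> (A e) (B e) (g e) le) (\<lambda>e. ode_sol' \<mu> (A e) (B e) (g e) le)"
  unfolding anti_standard_domain_iff gderiv_gsol[OF g] using gsol_maximal_domain[OF g] le_pos
  by (simp, intro vertex_cond_cong) (auto simp: gsol_def gsol'_def)

text \<open>Agreement of the outgoing derivatives at each vertex means that they come from one
  function \<open>y\<close> on the vertices. The minus sign reverses the direction at the endpoint
  \<open>le\<close>.\<close>

lemma vertex_cond_iff:
  "vertex_cond A B F D \<longleftrightarrow> (\<exists>y. (\<forall>e\<in>E. B e = y (fst e) \<and> D e = - y (snd e)) \<and>
     (\<forall>v. vsum A F v = 0))"
proof
  assume vc: "vertex_cond A B F D"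
  \<comment> \<open>Any incident edge will do, and there always is one for the edges considered
    below.\<close>
  define y where "y v = (let e = (SOME e. e \<in> incident E v) in if fst e = v then B e else - D e)" for v
  have y: "y v = (if fst e = v then B e else - D e)" if e: "e \<in> incident E v" for e v
  proof -
    have "(SOME e. e \<in> incident E v) \<in> incident E v" using e by (rule someI)
    then show ?thesis using vc e unfolding vertex_cond_def y_def Let_def by blast
  qed
  have "B e = y (fst e) \<and> D e = - y (snd e)" if e: "e \<in> E" for e
    using y[of e "fst e"] y[of e "snd e"] e fst_neq_snd[OF e] by (simp add: incident_def)
  then show "\<exists>y. (\<forall>e\<in>E. B e = y (fst e) \<and> D e = - y (snd e)) \<and>
     (\<forall>v. vsum A F v = 0)"
    using vc unfolding vertex_cond_def by blast
next
  assume "\<exists>y. (\<forall>e\<in>E. B e = y (fst e) \<and> D e = - y (snd e)) \<and>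
     (\<forall>v. vsum A F v = 0)"
  then obtain y where y: "\<And>e. e \<in> E \<Longrightarrow> B e = y (fst e) \<and> D e = - y (snd e)"
     "\<And>v. vsum A F v = 0" by blast
  have "(if fst e = v then B e else - D e) = y v" if "e \<in> incident E v" for e v
    using that y(1)[of e] by (auto simp: incident_def)
  then show "vertex_cond A B F D" using y(2) unfolding vertex_cond_def by simp
qed

end

section \<open>Eigenspaces\<close>

text \<open>\<open>T\<close> is injective on the orthogonal complement \<open>M\<close> of its
  kernel and maps it onto the whole range.\<close>

lemma rank_nullity_linear:
  fixes T :: "'a::euclidean_space \<Rightarrow> 'b::euclidean_space"
  assumes T: "linear T"
  shows "dim (range T) + dim {x. T x = 0} = DIM('a)"
proof -
  define N where "N = {x. T x = 0}"
  define M where "M = {y \<in> UNIV. \<forall>x\<in>N. orthogonal x y}"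
  have sN: "subspace N" unfolding N_def by (rule linear_subspace_kernel[OF T])
  have sM: "subspace M" unfolding M_def by (auto simp: subspace_def orthogonal_clauses)
  have MN: "dim M + dim N = DIM('a)"
    unfolding M_def using dim_subspace_orthogonal_to_vectors[OF sN subspace_UNIV] by simp
  have "inj_on T (span M)"
    unfolding span_eq_iff[THEN iffD2, OF sM]
  proof (rule inj_onI)
    fix x y assume xy: "x \<in> M" "y \<in> M" "T x = T y"
    then have "x - y \<in> N" "x - y \<in> M"
      using sM by (auto simp: N_def linear_diff[OF T] subspace_diff)
    then have "orthogonal (x - y) (x - y)" by (auto simp: M_def)
    then show "x = y" by (simp add: orthogonal_self)
  qed
  then have "dim (T ` M) = dim M" by (rule dim_image_eq[OF T])
  moreover have "T ` M = range T"
  proof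
    show "range T \<subseteq> T ` M"
    proof clarify
      fix x
      obtain n m where nm: "n \<in> span N" "\<And>w. w \<in> span N \<Longrightarrow> orthogonal m w" "x = n + m"
        using orthogonal_subspace_decomp_exists[of N x] by metis
      have "m \<in> M" using nm(2) by (auto simp: M_def span_base orthogonal_commute)
      moreover have "n \<in> N" using nm(1) sN by (metis span_eq_iff)
      then have "T x = T m" by (simp add: nm(3) linear_add[OF T] N_def)
      ultimately show "T x \<in> T ` M" by blast
    qed
  qed auto
  ultimately show ?thesis using MN by (simp add: N_def)
qed

text \<open>Carries dimensions from a Euclidean parameter space to the space of functions on the
  graph. The finite spanning set certifies that the dimension is genuine and not the default value 0
  for infinite dimension.\<close>

lemma gfun_dim_image_eq:
  fixes f :: "'a::euclidean_space \<Rightarrow> 'v gfun"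
  assumes f: "Vector_Spaces.linear scaleR (\<lambda>(c::real) (f::'v gfun) e x. c * f e x) f"
    and S: "subspace S" and inj: "inj_on f S"
  shows "gfun.dim (f ` S) = dim S" and "\<exists>B. finite B \<and> f ` S = gfun.span B"
proof -
  interpret pr: finite_dimensional_vector_space_pair_1 "scaleR :: real \<Rightarrow> 'a \<Rightarrow> 'a" Basis
    "\<lambda>(c::real) (f::'v gfun) e x. c * f e x"
    by unfold_locales
  have span: "module.span scaleR S = S"
    unfolding span_raw_def[symmetric] using S by (simp only: span_eq_iff)
  show "gfun.dim (f ` S) = dim S"
    unfolding dim_raw_def
    by (rule pr.dim_image_eq[OF f]) (simp add: span inj)
  obtain B where B: "B \<subseteq> S" "independent B" "S \<subseteq> span B" "card B = dim S"
    using basis_exists by blast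
  have "finite B" using B(2) by (rule independent_imp_finite)
  moreover have "span B = S" using B S by (simp add: span_subspace)
  then have "f ` S = gfun.span (f ` B)"
    using pr.linear_span_image[OF f, of B] by (simp add: span_raw_def)
  ultimately show "\<exists>B. finite B \<and> f ` S = gfun.span B" by blast
qed

lemma vec_nth_fun:
  "($) 0 = (\<lambda>i. 0)" "($) (x + y) = (\<lambda>i. x $ i + y $ i)" "($) (c *\<^sub>R z) = (\<lambda>i. c * z $ i)"
  "($) (vec_lambda f) = f"
  by (simp_all add: fun_eq_iff)

lemma matrix_inv_diag_matrix:
  fixes d :: "real^'n"
  assumes "\<And>i. d $ i \<noteq> 0"
  shows "matrix_inv (diag_matrix d) = diag_matrix (\<chi> i. 1 / d $ i)"
proof -
  have *: "diag_matrix a ** diag_matrix b = mat 1" if "\<And>i. a $ i * b $ i = 1" for a b :: "real^'n"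
  proof -
    have "(\<Sum>k\<in>UNIV. (if i = k then a $ i else 0) * (if k = j then b $ k else 0)) = (if i = j then 1 else 0)" for i j
    proof -
      have "(\<Sum>k\<in>UNIV. (if i = k then a $ i else 0) * (if k = j then b $ k else 0))
          = (\<Sum>k\<in>UNIV. if k = i then a $ i * (if k = j then b $ k else 0) else 0)"
        by (intro sum.cong) auto
      then show ?thesis using that by simp
    qed
    then show ?thesis by (simp add: diag_matrix_def matrix_matrix_mult_def mat_def vec_eq_iff)
  qed
  define A where "A = diag_matrix d"
  define B where "B = diag_matrix (\<chi> i. 1 / d $ i)"
  have AB: "A ** B = mat 1" and BA: "B ** A = mat 1"
    unfolding A_def B_def using assms by (auto intro!: *)
  then have inv: "matrix_inv A ** A = mat 1"
    unfolding matrix_inv_def using someI_ex[of "\<lambda>A'. A ** A' = mat 1 \<and> A' ** A = mat 1"] by blast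
  have "matrix_inv A = matrix_inv A ** (A ** B)" by (simp add: AB)
  also have "\<dots> = B" by (simp add: matrix_mul_assoc inv)
  finally show ?thesis by (simp add: A_def B_def)
qed

lemma diag_matrix_vector_mult: "(diag_matrix d *v x) $ i = d $ i * x $ i"
proof -
  have "(\<Sum>j\<in>UNIV. (if i = j then d $ i else 0) * x $ j) = (\<Sum>j\<in>UNIV. if j = i then d $ i * x $ j else 0)"
    by (intro sum.cong) auto
  then show ?thesis by (simp add: diag_matrix_def matrix_vector_mult_def)
qed

context equilateral_graph
begin

text \<open>
  \<open>a $ e\<close> is the value of an eigenfunction at the endpoint \<open>0\<close> of \<open>e\<close>, and \<open>y $ v\<close> its outgoing derivative at \<open>v\<close>
  along every edge. The equation for \<open>e\<close> says that the outgoing derivative at the endpoint \<open>le\<close> is \<open>y $ snd e\<close>.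
\<close>

definition eigen_params :: "real \<Rightarrow> ((real^('v \<times> 'v)) \<times> (real^'v)) set" where
  "eigen_params \<mu> = {(a, y). (\<forall>e. e \<notin> E \<longrightarrow> a $ e = 0) \<and>
     (\<forall>e\<in>E. \<mu> * sinf \<mu> le * a $ e = y $ snd e + cosf \<mu> le * y $ fst e) \<and>
     (\<forall>v. vsum (\<lambda>e. a $ e) (\<lambda>e. cosf \<mu> le * a $ e + sinf \<mu> le * y $ fst e) v = 0)}"

definition eigen_fun :: "real \<Rightarrow> (real^('v \<times> 'v)) \<times> (real^'v) \<Rightarrow> 'v gfun" where
  "eigen_fun \<mu> p = gsol \<mu> (\<lambda>e. fst p $ e) (\<lambda>e. snd p $ fst e) (\<lambda>e x. 0)"

lemma eigen_fun_apply:
  "eigen_fun \<mu> p e x = (if e \<in> E \<and> x \<in> {0..le} then fst p $ e * cosf \<mu> x + snd p $ fst e * sinf \<mu> x else 0)"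
  by (simp add: eigen_fun_def gsol_def)

lemma eigenspace_iff:
  "f \<in> anti_standard_eigenspace E len \<mu> \<longleftrightarrow> f \<in> anti_standard_domain E len \<and>
     ae_eq E len (\<lambda>e x. laplacian E len f e x - \<mu> * f e x) (\<lambda>e x. 0)"
  by (auto simp: anti_standard_eigenspace_def ae_eq_iff)

lemma eigenspace_eq: "anti_standard_eigenspace E len \<mu> = eigen_fun \<mu> ` eigen_params \<mu>"
proof (intro equalityI subsetI)
  fix f assume "f \<in> eigen_fun \<mu> ` eigen_params \<mu>"
  then obtain a y where f: "f = eigen_fun \<mu> (a, y)" and p: "(a, y) \<in> eigen_params \<mu>" by auto
  have "vertex_cond (\<lambda>e. a $ e) (\<lambda>e. y $ fst e) (\<lambda>e. cosf \<mu> le * a $ e + sinf \<mu> le * y $ fst e)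
      (\<lambda>e. y $ fst e * cosf \<mu> le - \<mu> * (a $ e * sinf \<mu> le))"
    unfolding vertex_cond_iff
    by (rule exI[of _ "\<lambda>v. y $ v"]) (use p in \<open>auto simp: eigen_params_def algebra_simps\<close>)
  then have "f \<in> anti_standard_domain E len"
    unfolding f eigen_fun_def gsol_anti_standard_iff[OF L2_zero] by (simp add: mult.commute)
  then show "f \<in> anti_standard_eigenspace E len \<mu>"
    unfolding eigenspace_iff using ae_eq_gsol[OF L2_zero, of \<mu>] by (simp add: f eigen_fun_def)
next
  fix f assume "f \<in> anti_standard_eigenspace E len \<mu>"
  then have dom: "f \<in> anti_standard_domain E len"
    and ae: "ae_eq E len (\<lambda>e x. laplacian E len f e x - \<mu> * f e x) (\<lambda>e x. 0)"
    by (auto simp: eigenspace_iff)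
  define A where "A e = f e 0" for e
  define B where "B e = gderiv E len f e 0" for e
  have md: "f \<in> maximal_domain E len" using dom by (simp add: anti_standard_domain_iff)
  have rep: "f = gsol \<mu> A B (\<lambda>e x. 0)"
    using maximal_domain_representation(1)[OF md L2_zero ae] by (simp add: A_def[abs_def] B_def[abs_def])
  have A0: "A e = 0" if "e \<notin> E" for e
    using md that unfolding A_def maximal_domain_def L2_iff by blast
  have "vertex_cond A B (\<lambda>e. A e * cosf \<mu> le + B e * sinf \<mu> le) (\<lambda>e. B e * cosf \<mu> le - \<mu> * (A e * sinf \<mu> le))"
    using dom gsol_anti_standard_iff[OF L2_zero, of \<mu> A B] by (simp flip: rep)
  then obtain y where y: "\<And>e. e \<in> E \<Longrightarrow> B e = y (fst e) \<and> B e * cosf \<mu> le - \<mu> * (A e * sinf \<mu> le) = - y (snd e)"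
    and sum: "\<And>v. vsum A (\<lambda>e. A e * cosf \<mu> le + B e * sinf \<mu> le) v = 0"
    unfolding vertex_cond_iff by blast
  define p where "p = ((\<chi> e. A e) :: real^('v \<times> 'v), (\<chi> v. y v) :: real^'v)"
  have "f = eigen_fun \<mu> p"
    unfolding rep eigen_fun_def gsol_def p_def using y by (auto simp: fun_eq_iff)
  moreover have "p \<in> eigen_params \<mu>"
  proof -
    have "vsum A (\<lambda>e. cosf \<mu> le * A e + sinf \<mu> le * y (fst e)) v = 0" for v
      using y by (subst vsum_cong[OF refl, of _ "\<lambda>e. A e * cosf \<mu> le + B e * sinf \<mu> le"])
        (simp_all add: sum mult.commute)
    moreover have "\<mu> * sinf \<mu> le * A e = y (snd e) + cosf \<mu> le * y (fst e)" if "e \<in> E" for e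
      using y[OF that, THEN conjunct2] unfolding y[OF that, THEN conjunct1] by (simp add: algebra_simps)
    ultimately show ?thesis using A0 by (simp add: eigen_params_def p_def vec_nth_fun)
  qed
  ultimately show "f \<in> eigen_fun \<mu> ` eigen_params \<mu>" by blast
qed

lemma linear_eigen_fun:
  "Vector_Spaces.linear scaleR (\<lambda>(c::real) (f::'v gfun) e x. c * f e x) (eigen_fun \<mu>)"
  by unfold_locales (auto simp: fun_eq_iff eigen_fun_apply algebra_simps)

lemma subspace_eigen_params: "subspace (eigen_params \<mu>)"
proof (rule subspaceI)
  show "0 \<in> eigen_params \<mu>" by (simp add: eigen_params_def zero_prod_def vec_nth_fun)
next
  fix p q assume pq: "p \<in> eigen_params \<mu>" "q \<in> eigen_params \<mu>"
  obtain a y where p: "p = (a, y)" by (cases p)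
  obtain b z where q: "q = (b, z)" by (cases q)
  have "vsum (\<lambda>e. a $ e + b $ e) (\<lambda>e. cosf \<mu> le * (a $ e + b $ e) + sinf \<mu> le * (y $ fst e + z $ fst e)) v
      = vsum (\<lambda>e. a $ e) (\<lambda>e. cosf \<mu> le * a $ e + sinf \<mu> le * y $ fst e) v
      + vsum (\<lambda>e. b $ e) (\<lambda>e. cosf \<mu> le * b $ e + sinf \<mu> le * z $ fst e) v" for v
    unfolding vsum_add[symmetric] by (simp add: algebra_simps)
  moreover have "\<mu> * sinf \<mu> le * (a $ e + b $ e) = y $ snd e + z $ snd e + cosf \<mu> le * (y $ fst e + z $ fst e)"
    if "e \<in> E" for e
  proof -
    have "\<mu> * sinf \<mu> le * a $ e + \<mu> * sinf \<mu> le * b $ e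
        = (y $ snd e + cosf \<mu> le * y $ fst e) + (z $ snd e + cosf \<mu> le * z $ fst e)"
      using pq that by (simp add: p q eigen_params_def)
    then show ?thesis by (simp add: algebra_simps)
  qed
  ultimately show "p + q \<in> eigen_params \<mu>"
    using pq by (simp add: p q eigen_params_def vec_nth_fun)
next
  fix c p assume p: "p \<in> eigen_params \<mu>"
  obtain a y where py: "p = (a, y)" by (cases p)
  have "vsum (\<lambda>e. c * a $ e) (\<lambda>e. cosf \<mu> le * (c * a $ e) + sinf \<mu> le * (c * y $ fst e)) v
      = c * vsum (\<lambda>e. a $ e) (\<lambda>e. cosf \<mu> le * a $ e + sinf \<mu> le * y $ fst e) v" for v
    unfolding vsum_scale[symmetric] by (simp add: algebra_simps)
  moreover have "\<mu> * sinf \<mu> le * (c * a $ e) = c * y $ snd e + cosf \<mu> le * (c * y $ fst e)" if "e \<in> E" for e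
  proof -
    have "c * (\<mu> * sinf \<mu> le * a $ e) = c * (y $ snd e + cosf \<mu> le * y $ fst e)"
      using p that by (simp add: py eigen_params_def)
    then show ?thesis by (simp add: algebra_simps)
  qed
  ultimately show "c *\<^sub>R p \<in> eigen_params \<mu>"
    using p by (simp add: py eigen_params_def vec_nth_fun)
qed

lemma vertex_vector_eqI:
  fixes y z :: "real^'v"
  assumes "\<And>e. e \<in> E \<Longrightarrow> y $ fst e = z $ fst e" "\<And>e. e \<in> E \<Longrightarrow> y $ snd e = z $ snd e"
  shows "y = z"
  unfolding vec_eq_iff
proof
  fix v
  obtain e where "e \<in> incident E v" using incident_nonempty by blast
  then show "y $ v = z $ v" using assms[of e] by (auto simp: incident_def)
qed

text \<open>Values and derivatives at the endpoints 0 determine \<open>a\<close> and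
  \<open>y\<close> at starting vertices. A vertex may occur only as a terminal endpoint; there
  \<open>y\<close> is recovered from the edge equation in \<open>eigen_params\<close>.\<close>

lemma inj_on_eigen_fun: "inj_on (eigen_fun \<mu>) (eigen_params \<mu>)"
proof (rule inj_onI)
  fix p q assume pq: "p \<in> eigen_params \<mu>" "q \<in> eigen_params \<mu>" and eq: "eigen_fun \<mu> p = eigen_fun \<mu> q"
  obtain a y where p: "p = (a, y)" by (cases p)
  obtain b z where q: "q = (b, z)" by (cases q)
  have ab: "a $ e = b $ e" for e
  proof (cases "e \<in> E")
    case True
    have "eigen_fun \<mu> p e 0 = eigen_fun \<mu> q e 0" by (simp add: eq)
    then show ?thesis using True le_pos by (simp add: eigen_fun_apply p q)
  next
    case False
    then have "a $ e = 0" "b $ e = 0" using pq unfolding p q eigen_params_def by blast+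
    then show ?thesis by simp
  qed
  have "gsol' \<mu> (\<lambda>e. a $ e) (\<lambda>e. y $ fst e) (\<lambda>e x. 0) = gsol' \<mu> (\<lambda>e. b $ e) (\<lambda>e. z $ fst e) (\<lambda>e x. 0)"
    using arg_cong[OF eq, of "gderiv E len"] by (simp add: eigen_fun_def gderiv_gsol[OF L2_zero] p q)
  then have H: "gsol' \<mu> (\<lambda>e. a $ e) (\<lambda>e. y $ fst e) (\<lambda>e x. 0) e 0 = gsol' \<mu> (\<lambda>e. b $ e) (\<lambda>e. z $ fst e) (\<lambda>e x. 0) e 0" for e
    by simp
  have yz: "y $ fst e = z $ fst e" if "e \<in> E" for e
    using H[of e] that le_pos by (simp add: gsol'_def)
  have "y $ snd e = z $ snd e" if "e \<in> E" for e
  proof -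
    have "\<mu> * sinf \<mu> le * a $ e = y $ snd e + cosf \<mu> le * y $ fst e"
      "\<mu> * sinf \<mu> le * b $ e = z $ snd e + cosf \<mu> le * z $ fst e"
      using pq that by (auto simp: p q eigen_params_def)
    then show ?thesis using ab[of e] yz[OF that] by simp
  qed
  then have "y = z" using yz by (intro vertex_vector_eqI) auto
  moreover have "a = b" using ab by (simp add: vec_eq_iff)
  ultimately show "p = q" by (simp add: p q)
qed

lemma mult_eq_dim: "anti_standard_mult E len \<mu> = dim (eigen_params \<mu>)"
  unfolding anti_standard_mult_def eigenspace_eq
  by (rule gfun_dim_image_eq(1)[OF linear_eigen_fun subspace_eigen_params inj_on_eigen_fun])

lemma eigenspace_finite_span: "\<exists>B. finite B \<and> anti_standard_eigenspace E len \<mu> = gfun.span B"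
  unfolding eigenspace_eq
  by (rule gfun_dim_image_eq(2)[OF linear_eigen_fun subspace_eigen_params inj_on_eigen_fun])

section \<open>Incidence kernels, connectedness and bipartiteness\<close>

definition edge_kernel :: "real \<Rightarrow> (real^('v \<times> 'v)) set" where
  "edge_kernel \<sigma> = {a. (\<forall>e. e \<notin> E \<longrightarrow> a $ e = 0) \<and>
     (\<forall>v. vsum (\<lambda>e. a $ e) (\<lambda>e. \<sigma> * a $ e) v = 0)}"

definition vertex_kernel :: "real \<Rightarrow> (real^'v) set" where
  "vertex_kernel \<sigma> = {y. \<forall>e\<in>E. y $ fst e + \<sigma> * y $ snd e = 0}"

text \<open>The two kernels belong to the (signless, if \<open>\<sigma> = 1\<close>) incidence matrix and its transpose.\<close>

lemma dim_edge_kernel: "dim (edge_kernel \<sigma>) + CARD('v) = card E + dim (vertex_kernel \<sigma>)"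
proof -
  define D where "D = {a :: real^('v \<times> 'v). \<forall>e. e \<notin> E \<longrightarrow> a $ e = 0}"
  define T where "T y = (\<chi> e. if e \<in> E then y $ fst e + \<sigma> * y $ snd e else 0)" for y :: "real^'v"
  have T: "linear T"
    by (rule linearI) (auto simp: T_def vec_eq_iff algebra_simps)
  have ker: "{y. T y = 0} = vertex_kernel \<sigma>"
    by (auto simp: T_def vertex_kernel_def vec_eq_iff)
  have sD: "subspace D" by (auto simp: D_def subspace_def)
  have dD: "dim D = card E" unfolding D_def using dim_substandard_cart[where 'a = real, of E] by (simp add: dim_vec_eq)
  have sR: "subspace (range T)" using T by (intro linear_subspace_image) auto
  \<comment> \<open>Adjointness makes the edge kernel the orthogonal complement of
    \<open>range T\<close> inside \<open>D\<close>, the vectors supported on \<open>E\<close>. Its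
    dimension is therefore \<open>card E\<close> minus the rank of \<open>T\<close>.\<close>
  have adj: "T y \<bullet> a = (\<Sum>v\<in>UNIV. y $ v * vsum (\<lambda>e. a $ e) (\<lambda>e. \<sigma> * a $ e) v)" for y a
  proof -
    have "(\<Sum>e\<in>E. y $ fst e * a $ e + y $ snd e * (\<sigma> * a $ e)) = (\<Sum>e\<in>UNIV. T y $ e * a $ e)"
      by (rule sum.mono_neutral_cong_left) (auto simp: T_def algebra_simps)
    then show ?thesis by (simp add: sum_vsum inner_vec_def)
  qed
  have "{a \<in> D. \<forall>x\<in>range T. orthogonal x a} = edge_kernel \<sigma>"
  proof (intro equalityI subsetI)
    fix a assume a: "a \<in> {a \<in> D. \<forall>x\<in>range T. orthogonal x a}"
    have "vsum (\<lambda>e. a $ e) (\<lambda>e. \<sigma> * a $ e) v = 0" for v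
    proof -
      have "T (axis v 1) \<bullet> a = 0" using a by (auto simp: orthogonal_def)
      then have "(\<Sum>w\<in>UNIV. axis v 1 $ w * vsum (\<lambda>e. a $ e) (\<lambda>e. \<sigma> * a $ e) w) = 0"
        by (simp only: adj)
      moreover have "(\<Sum>w\<in>UNIV. axis v 1 $ w * vsum (\<lambda>e. a $ e) (\<lambda>e. \<sigma> * a $ e) w)
          = (\<Sum>w\<in>{v}. vsum (\<lambda>e. a $ e) (\<lambda>e. \<sigma> * a $ e) w)"
        by (rule sum.mono_neutral_cong_right) (auto simp: axis_def)
      ultimately show ?thesis by simp
    qed
    then show "a \<in> edge_kernel \<sigma>" using a by (auto simp: edge_kernel_def D_def)
  next
    fix a assume "a \<in> edge_kernel \<sigma>"
    then show "a \<in> {a \<in> D. \<forall>x\<in>range T. orthogonal x a}"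
      by (auto simp: edge_kernel_def D_def orthogonal_def adj)
  qed
  moreover have "dim {a \<in> D. \<forall>x\<in>range T. orthogonal x a} + dim (range T) = dim D"
    by (rule dim_subspace_orthogonal_to_vectors[OF sR sD]) (auto simp: D_def T_def)
  ultimately show ?thesis
    using rank_nullity_linear[OF T] dD by (simp add: ker)
qed

lemma subspace_edge_kernel: "subspace (edge_kernel \<sigma>)"
proof (rule subspaceI)
  fix a b assume "a \<in> edge_kernel \<sigma>" "b \<in> edge_kernel \<sigma>"
  moreover have "vsum (\<lambda>e. a $ e + b $ e) (\<lambda>e. \<sigma> * (a $ e + b $ e)) v
      = vsum (\<lambda>e. a $ e) (\<lambda>e. \<sigma> * a $ e) v + vsum (\<lambda>e. b $ e) (\<lambda>e. \<sigma> * b $ e) v" for v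
    unfolding vsum_add[symmetric] by (simp add: algebra_simps)
  ultimately show "a + b \<in> edge_kernel \<sigma>" by (simp add: edge_kernel_def vec_nth_fun)
next
  fix c a assume "a \<in> edge_kernel \<sigma>"
  moreover have "vsum (\<lambda>e. c * a $ e) (\<lambda>e. \<sigma> * (c * a $ e)) v = c * vsum (\<lambda>e. a $ e) (\<lambda>e. \<sigma> * a $ e) v" for v
    unfolding vsum_scale[symmetric] by (simp add: algebra_simps)
  ultimately show "c *\<^sub>R a \<in> edge_kernel \<sigma>" by (simp add: edge_kernel_def vec_nth_fun)
qed (simp add: edge_kernel_def vec_nth_fun)

lemma subspace_vertex_kernel: "subspace (vertex_kernel \<sigma>)"
proof (rule subspaceI)
  fix c y assume "y \<in> vertex_kernel \<sigma>"
  then have "c * (y $ fst e + \<sigma> * y $ snd e) = 0" if "e \<in> E" for e using that by (simp add: vertex_kernel_def)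
  then show "c *\<^sub>R y \<in> vertex_kernel \<sigma>" by (simp add: vertex_kernel_def algebra_simps)
next
  fix y z assume "y \<in> vertex_kernel \<sigma>" "z \<in> vertex_kernel \<sigma>"
  then have "(y $ fst e + \<sigma> * y $ snd e) + (z $ fst e + \<sigma> * z $ snd e) = 0" if "e \<in> E" for e
    using that by (simp add: vertex_kernel_def)
  then show "y + z \<in> vertex_kernel \<sigma>" by (simp add: vertex_kernel_def algebra_simps)
qed (simp add: vertex_kernel_def)

text \<open>For nonzero \<open>\<sigma>\<close> the value at one end of an edge determines the value
  at the other, so a zero spreads along paths. Consequently the kernel has dimension at most
  1.\<close>

lemma vertex_kernel_eq_0:
  assumes y: "y \<in> vertex_kernel \<sigma>" and "\<sigma> \<noteq> 0" and v: "y $ v = 0"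
  shows "y = 0"
proof -
  have "y $ w = 0" for w
    using connected_rtrancl[of v w]
  proof (induction rule: rtrancl_induct)
    case base
    show ?case by (rule v)
  next
    case (step w z)
    then have "y $ w + \<sigma> * y $ z = 0 \<or> y $ z + \<sigma> * y $ w = 0"
      using y by (force simp: vertex_kernel_def)
    then show ?case using step.IH \<open>\<sigma> \<noteq> 0\<close> by auto
  qed
  then show ?thesis by (simp add: vec_eq_iff)
qed

lemma dim_vertex_kernel:
  assumes "\<sigma> \<noteq> 0"
  shows "dim (vertex_kernel \<sigma>) = (if \<exists>w\<in>vertex_kernel \<sigma>. w \<noteq> 0 then 1 else 0)"
proof (cases "\<exists>w\<in>vertex_kernel \<sigma>. w \<noteq> 0")
  case True
  then obtain w where w: "w \<in> vertex_kernel \<sigma>" "w \<noteq> 0" by blast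
  \<comment> \<open>Here \<open>undefined\<close> is just an arbitrary base vertex, at which a
    nonzero kernel vector cannot vanish.\<close>
  have wv: "w $ undefined \<noteq> 0" using vertex_kernel_eq_0[OF w(1) assms] w(2) by blast
  have "vertex_kernel \<sigma> \<subseteq> span {w}"
  proof
    fix y assume y: "y \<in> vertex_kernel \<sigma>"
    define c where "c = y $ undefined / w $ undefined"
    have "y - c *\<^sub>R w \<in> vertex_kernel \<sigma>"
      using y w by (intro subspace_diff subspace_scale subspace_vertex_kernel)
    moreover have "(y - c *\<^sub>R w) $ undefined = 0" using wv by (simp add: c_def)
    ultimately have "y - c *\<^sub>R w = 0" by (rule vertex_kernel_eq_0[OF _ assms])
    then have "y = c *\<^sub>R w" by simp
    then show "y \<in> span {w}" by (simp add: span_base span_scale)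
  qed
  then have "span {w} = vertex_kernel \<sigma>"
    using w by (intro equalityI span_minimal subspace_vertex_kernel) auto
  then have "dim (vertex_kernel \<sigma>) = dim {w}" by (metis dim_span)
  also have "\<dots> = 1" using w(2) by simp
  finally show ?thesis using True by simp
next
  case False
  then have "vertex_kernel \<sigma> = {0}" using subspace_0[OF subspace_vertex_kernel] by blast
  then show ?thesis using False by simp
qed

lemma dim_vertex_kernel_minus_one: "dim (vertex_kernel (-1)) = 1"
proof -
  have "(\<chi> v. 1) \<in> vertex_kernel (-1)" by (simp add: vertex_kernel_def)
  moreover have "(\<chi> v. 1) \<noteq> (0 :: real^'v)" by (simp add: vec_eq_iff)
  ultimately show ?thesis by (subst dim_vertex_kernel) auto
qed

text \<open>The entries of a nonzero kernel vector never vanish and change sign along every edge, so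
  their signs form a 2-colouring. Conversely, a 2-colouring with the colours 1 and -1 is a kernel
  vector.\<close>

lemma dim_vertex_kernel_one: "dim (vertex_kernel 1) = (if bipartite E then 1 else 0)"
proof -
  have "(\<exists>w\<in>vertex_kernel 1. w \<noteq> 0) \<longleftrightarrow> bipartite E"
  proof
    assume "\<exists>w\<in>vertex_kernel 1. w \<noteq> 0"
    then obtain w where w: "w \<in> vertex_kernel 1" "w \<noteq> 0" by blast
    have nz: "w $ v \<noteq> 0" for v using vertex_kernel_eq_0[OF w(1) one_neq_zero, of v] w(2) by blast
    have "w $ u = - w $ v" if "(u, v) \<in> E" for u v
      using w(1) that by (fastforce simp: vertex_kernel_def)
    then have "(u \<in> {v. 0 < w $ v} \<and> v \<in> {v. w $ v < 0}) \<or> (u \<in> {v. w $ v < 0} \<and> v \<in> {v. 0 < w $ v})"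
      if "(u, v) \<in> E" for u v
      using that nz[of v] by (auto simp: neq_iff)
    then show "bipartite E"
      unfolding bipartite_def using nz
      by (intro exI[of _ "{v. 0 < w $ v}"] exI[of _ "{v. w $ v < 0}"]) (auto simp: neq_iff)
  next
    assume "bipartite E"
    then obtain A B where *: "A \<union> B = UNIV \<and> A \<inter> B = {} \<and>
        (\<forall>(u, v)\<in>E. (u \<in> A \<and> v \<in> B) \<or> (u \<in> B \<and> v \<in> A))"
      unfolding bipartite_def by (elim exE) (rule that)
    then have AB: "A \<inter> B = {}" and edges: "\<forall>(u, v)\<in>E. (u \<in> A \<and> v \<in> B) \<or> (u \<in> B \<and> v \<in> A)"
      by simp_all
    define w :: "real^'v" where "w = (\<chi> v. if v \<in> A then 1 else -1)"
    have "w $ fst e + 1 * w $ snd e = 0" if "e \<in> E" for e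
      using bspec[OF edges that] AB by (auto simp: w_def split: prod.splits)
    then have "w \<in> vertex_kernel 1" by (simp add: vertex_kernel_def)
    moreover have "w \<noteq> 0" by (simp add: w_def vec_eq_iff)
    ultimately show "\<exists>w\<in>vertex_kernel 1. w \<noteq> 0" by blast
  qed
  then show ?thesis by (subst dim_vertex_kernel) auto
qed

section \<open>The transition matrix as a sum over incident edges\<close>

definition opposite :: "'v \<Rightarrow> 'v \<times> 'v \<Rightarrow> 'v" where
  "opposite v e = (if fst e = v then snd e else fst e)"

text \<open>Injectivity is where simplicity enters: \<open>(v, j)\<close> and \<open>(j, v)\<close>
  are never both edges, so a neighbour is reached by a single incident edge.\<close>

lemma bij_betw_opposite:
  "bij_betw (opposite v) (incident E v) {j. (v, j) \<in> E \<or> (j, v) \<in> E}"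
proof (rule bij_betw_imageI)
  have asym: "(b, a) \<notin> E" if "(a, b) \<in> E" for a b
    using graph that by (auto simp: metric_graph_def)
  show "inj_on (opposite v) (incident E v)"
    using asym by (auto simp: inj_on_def opposite_def incident_def split: if_splits)
  show "opposite v ` incident E v = {j. (v, j) \<in> E \<or> (j, v) \<in> E}"
  proof (intro equalityI subsetI)
    fix j assume "j \<in> {j. (v, j) \<in> E \<or> (j, v) \<in> E}"
    then have "j = opposite v (v, j) \<and> (v, j) \<in> incident E v \<or> j = opposite v (j, v) \<and> (j, v) \<in> incident E v"
      using fst_neq_snd[of "(j, v)"] by (auto simp: opposite_def incident_def)
    then show "j \<in> opposite v ` incident E v" by blast
  qed (auto simp: opposite_def incident_def split: if_splits)
qed

lemma adjacency_matrix_mult: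
  "(adjacency_matrix E *v x) $ v = (\<Sum>e\<in>incident E v. x $ opposite v e)"
proof -
  have "(adjacency_matrix E *v x) $ v = (\<Sum>j\<in>UNIV. if (v, j) \<in> E \<or> (j, v) \<in> E then x $ j else 0)"
    unfolding adjacency_matrix_def matrix_vector_mult_def by (auto intro!: sum.cong)
  also have "\<dots> = (\<Sum>j\<in>{j. (v, j) \<in> E \<or> (j, v) \<in> E}. x $ j)"
    by (rule sum.mono_neutral_cong_right) auto
  also have "\<dots> = (\<Sum>e\<in>incident E v. x $ opposite v e)"
    by (rule sum.reindex_bij_betw[OF bij_betw_opposite, symmetric])
  finally show ?thesis .
qed

lemma card_incident_pos: "0 < card (incident E v)"
  using incident_nonempty by (simp add: card_gt_0_iff)

lemma transition_matrix_mult: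
  "(transition_matrix E *v x) $ v = (\<Sum>e\<in>incident E v. x $ opposite v e) / card (incident E v)"
proof -
  define d where "d = adjacency_matrix E *v vec 1"
  have d: "d $ v = card (incident E v)" for v
    unfolding d_def adjacency_matrix_mult by simp
  then have "matrix_inv (diag_matrix d) = diag_matrix (\<chi> i. 1 / d $ i)"
    using card_incident_pos by (intro matrix_inv_diag_matrix) (simp add: less_imp_neq[symmetric])
  then have "transition_matrix E *v x = diag_matrix (\<chi> i. 1 / d $ i) *v (adjacency_matrix E *v x)"
    unfolding transition_matrix_def d_def[symmetric] by (simp add: matrix_vector_mul_assoc)
  then show ?thesis
    by (simp add: diag_matrix_vector_mult adjacency_matrix_mult d)
qed

text \<open>Row \<open>v\<close> is multiplied by the degree of \<open>v\<close>. The diagonal term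
  is then spread over the incident edges, which matches the edgewise form of the vertex
  sums.\<close>

lemma transition_kernel_iff:
  "(transition_matrix E + c *\<^sub>R mat 1) *v x = 0 \<longleftrightarrow>
     (\<forall>v. (\<Sum>e\<in>incident E v. x $ opposite v e + c * x $ v) = 0)"
proof -
  have "((transition_matrix E + c *\<^sub>R mat 1) *v x) $ v
      = (\<Sum>e\<in>incident E v. x $ opposite v e + c * x $ v) / card (incident E v)" for v
  proof -
    have "((transition_matrix E + c *\<^sub>R mat 1) *v x) $ v = (transition_matrix E *v x) $ v + c * x $ v"
      by (simp add: matrix_vector_mult_add_rdistrib scaleR_matrix_vector_assoc[symmetric])
    then show ?thesis
      using incident_nonempty[of v] unfolding transition_matrix_mult
      by (simp add: sum.distrib add_divide_distrib)
  qed
  then show ?thesis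
    using card_incident_pos by (simp add: vec_eq_iff less_imp_neq[symmetric])
qed

section \<open>Multiplicities in the different ranges of \<mu>\<close>

lemma eigen_params_sin_0:
  assumes s: "sinf \<mu> le = 0"
  shows "eigen_params \<mu> = edge_kernel (cosf \<mu> le) \<times> vertex_kernel (cosf \<mu> le)"
proof -
  define c where "c = cosf \<mu> le"
  have c2: "c * c = 1" using cosf_sinf_identity[of \<mu> le] s by (simp add: c_def power2_eq_square)
  \<comment> \<open>With \<open>c * c = 1\<close>, multiplication by \<open>c\<close> exchanges the
    two ends of an edge, turning the edge equation into the one defining
    \<open>vertex_kernel\<close>.\<close>
  have "0 = z + c * w \<longleftrightarrow> w + c * z = 0" for w z :: real
  proof -
    have c0: "c \<noteq> 0" using c2 by auto
    have "w + c * z = c * (z + c * w)" using c2 by (simp add: distrib_left flip: mult.assoc)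
    then show ?thesis using c0 by auto
  qed
  then show ?thesis
    by (simp add: eigen_params_def edge_kernel_def vertex_kernel_def s c_def[symmetric] set_eq_iff) blast
qed

text \<open>An energy identity: after multiplication by \<open>- c\<close> the paired sum becomes
  the sum of \<open>s * ((y $ fst e)\<^sup>2 - \<mu> * (F e)\<^sup>2)\<close>, where
  \<open>F e\<close> is the value at the endpoint \<open>le\<close>. For \<mu> \<le> 0 all terms are
  nonnegative, hence zero. For \<mu> < 0 the vanishing of \<open>F\<close> also forces
  \<open>a\<close> to vanish.\<close>

lemma eigen_params_nonpos:
  assumes \<mu>: "\<mu> \<le> 0" and p: "(a, y) \<in> eigen_params \<mu>"
  shows "y = 0" and "\<mu> < 0 \<Longrightarrow> a = 0"
proof -
  define s where "s = sinf \<mu> le"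
  define c where "c = cosf \<mu> le"
  have cs: "c\<^sup>2 + \<mu> * s\<^sup>2 = 1" unfolding c_def s_def by (rule cosf_sinf_identity)
  have s: "0 < s" using \<mu> le_pos by (auto simp: s_def sinf_def)
  have c: "0 < c" using \<mu> by (auto simp: c_def cosf_def)
  have a0: "a $ e = 0" if "e \<notin> E" for e using p that unfolding eigen_params_def by blast
  have rel: "y $ snd e = \<mu> * s * a $ e - c * y $ fst e" if "e \<in> E" for e
    using p that by (simp add: eigen_params_def s_def c_def)
  define F where "F e = c * a $ e + s * y $ fst e" for e
  have "vsum (\<lambda>e. a $ e) F v = 0" for v
    using p by (simp add: eigen_params_def s_def c_def F_def[abs_def])
  then have "(\<Sum>v\<in>UNIV. y $ v * vsum (\<lambda>e. a $ e) F v) = 0" by simp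
  then have "(\<Sum>e\<in>E. y $ fst e * a $ e + y $ snd e * F e) = 0" by (simp only: sum_vsum)
  \<comment> \<open>The factor \<open>- c\<close> is what lets
    \<open>c\<^sup>2 + \<mu> * s\<^sup>2 = 1\<close> remove the mixed products of \<open>a\<close>
    and \<open>y\<close>.\<close>
  then have "(\<Sum>e\<in>E. - c * (y $ fst e * a $ e + y $ snd e * F e)) = 0"
    unfolding sum_distrib_left[symmetric] by simp
  moreover have "- c * (y $ fst e * a $ e + y $ snd e * F e) = s * ((y $ fst e)\<^sup>2 - \<mu> * (F e)\<^sup>2)"
    if "e \<in> E" for e
  proof -
    define w z where "w = y $ fst e" and "z = a $ e"
    have "- c * (w * z + (\<mu> * s * z - c * w) * (c * z + s * w)) - s * (w\<^sup>2 - \<mu> * (c * z + s * w)\<^sup>2)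
        = (c\<^sup>2 + \<mu> * s\<^sup>2 - 1) * (c * w * z + s * w\<^sup>2)"
      by (simp add: algebra_simps power2_eq_square)
    also have "\<dots> = 0" by (simp add: cs)
    finally show ?thesis by (simp add: rel[OF that] F_def w_def z_def)
  qed
  ultimately have sum0: "(\<Sum>e\<in>E. s * ((y $ fst e)\<^sup>2 - \<mu> * (F e)\<^sup>2)) = 0" by simp
  have nn: "0 \<le> s * ((y $ fst e)\<^sup>2 - \<mu> * (F e)\<^sup>2)" for e
  proof -
    have "\<mu> * (F e)\<^sup>2 \<le> 0" using \<mu> by (simp add: mult_nonpos_nonneg)
    then show ?thesis using s by (simp add: order.trans[OF _ zero_le_power2])
  qed
  have each: "(y $ fst e)\<^sup>2 = \<mu> * (F e)\<^sup>2" if "e \<in> E" for e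
  proof -
    have "s * ((y $ fst e)\<^sup>2 - \<mu> * (F e)\<^sup>2) = 0"
      using sum_nonneg_eq_0_iff[of E "\<lambda>e. s * ((y $ fst e)\<^sup>2 - \<mu> * (F e)\<^sup>2)"] sum0 nn that s by simp
    then show ?thesis using s by simp
  qed
  have yf: "y $ fst e = 0" if "e \<in> E" for e
  proof -
    have "(y $ fst e)\<^sup>2 \<le> 0" using each[OF that] \<mu> by (simp add: mult_nonpos_nonneg)
    then show ?thesis by simp
  qed
  have ae: "a $ e = 0" if "\<mu> < 0" for e
  proof (cases "e \<in> E")
    case True
    then have "F e = 0" using each[OF True] yf[OF True] that by simp
    then show ?thesis using yf[OF True] c by (simp add: F_def)
  qed (rule a0)
  then show "a = 0" if "\<mu> < 0" using that by (simp add: vec_eq_iff)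
  show "y = 0"
  proof (rule vertex_vector_eqI)
    show "y $ snd e = 0 $ snd e" if "e \<in> E" for e
      using rel[OF that] yf[OF that] ae[of e] \<mu> by (cases "\<mu> = 0") auto
  qed (simp add: yf)
qed

text \<open>With d the dimension of the vertex kernel, the edge kernel contributes N - n + d and the
  vertex kernel another d; this is the origin of the 2. The additive form avoids truncated
  subtraction of natural numbers.\<close>

lemma mult_sin_0:
  assumes "sinf \<mu> le = 0"
  shows "anti_standard_mult E len \<mu> + CARD('v) = card E + 2 * dim (vertex_kernel (cosf \<mu> le))"
  using dim_edge_kernel[of "cosf \<mu> le"]
  by (simp add: mult_eq_dim eigen_params_sin_0[OF assms] dim_Times subspace_edge_kernel subspace_vertex_kernel)

text \<open>Here \<open>sinf 0 le = le\<close> is nonzero, so the conditions do not decouple.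
  Instead \<open>y = 0\<close> leaves only the edge kernel, and the vertex kernel is counted once,
  through its dimension.\<close>

lemma mult_0: "anti_standard_mult E len 0 + CARD('v) = card E + dim (vertex_kernel 1)"
proof -
  have "eigen_params 0 = edge_kernel 1 \<times> {0}"
  proof (intro equalityI subsetI)
    fix p assume p: "p \<in> eigen_params 0"
    obtain a y where py: "p = (a, y)" by (cases p)
    have "y = 0" using eigen_params_nonpos(1)[of 0 a y] p py by simp
    then show "p \<in> edge_kernel 1 \<times> {0}"
      using p by (simp add: py eigen_params_def edge_kernel_def cosf_def)
  next
    fix p assume "p \<in> edge_kernel 1 \<times> {0 :: real^'v}"
    then show "p \<in> eigen_params 0"
      by (auto simp: eigen_params_def edge_kernel_def cosf_def)
  qed
  then have "anti_standard_mult E len 0 = dim (edge_kernel 1 \<times> {0 :: real^'v})"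
    by (simp add: mult_eq_dim)
  also have "\<dots> = dim (edge_kernel 1)"
    by (simp add: dim_Times subspace_edge_kernel)
  finally show ?thesis using dim_edge_kernel[of 1] by simp
qed

lemma mult_neg: "\<mu> < 0 \<Longrightarrow> anti_standard_mult E len \<mu> = 0"
proof -
  assume \<mu>: "\<mu> < 0"
  have "eigen_params \<mu> \<subseteq> {0}"
    using eigen_params_nonpos[of \<mu>] \<mu> by (auto simp: zero_prod_def)
  then show ?thesis by (simp add: mult_eq_dim dim_eq_0)
qed

text \<open>The edge equation can be solved for \<open>a\<close>, so projecting to \<open>y\<close>
  loses nothing. Substituted into the vertex sums and multiplied by \<open>\<mu> * s\<close>, it
  yields the same expression at both ends of an edge: the value of \<open>y\<close> at the opposite
  vertex plus \<open>c\<close> times the value at the vertex itself.\<close>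

lemma mult_sin_nonzero:
  assumes \<mu>: "0 < \<mu>" and s: "sinf \<mu> le \<noteq> 0"
  shows "anti_standard_mult E len \<mu> = dim {x. (transition_matrix E + cosf \<mu> le *\<^sub>R mat 1) *v x = 0}"
proof -
  define s where "s = sinf \<mu> le"
  define c where "c = cosf \<mu> le"
  have cs: "c\<^sup>2 + \<mu> * s\<^sup>2 = 1" unfolding c_def s_def by (rule cosf_sinf_identity)
  have \<mu>s: "\<mu> * s \<noteq> 0" using assms by (simp add: s_def)
  have val: "vsum (\<lambda>e. a $ e) (\<lambda>e. c * a $ e + s * y $ fst e) v
      = (\<Sum>e\<in>incident E v. y $ opposite v e + c * y $ v) / (\<mu> * s)"
    if a: "\<And>e. e \<in> E \<Longrightarrow> \<mu> * s * a $ e = y $ snd e + c * y $ fst e" for a y v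
    unfolding sum_divide_distrib vsum_def
  proof (intro sum.cong refl)
    fix e assume e: "e \<in> incident E v"
    then have eE: "e \<in> E" by (simp add: incident_def)
    show "(if fst e = v then a $ e else c * a $ e + s * y $ fst e) = (y $ opposite v e + c * y $ v) / (\<mu> * s)"
    proof (cases "fst e = v")
      case True
      then show ?thesis using a[OF eE] \<mu>s by (simp add: opposite_def nonzero_eq_divide_eq mult.commute)
    next
      case False
      then have "snd e = v" using e by (simp add: incident_def)
      \<comment> \<open>At the endpoint \<open>le\<close>, the relation
        \<open>c\<^sup>2 + \<mu> * s\<^sup>2 = 1\<close> collapses the coefficient of
        \<open>y $ fst e\<close> to 1.\<close>
      have "(c * a $ e + s * y $ fst e) * (\<mu> * s) = c * (\<mu> * s * a $ e) + \<mu> * s\<^sup>2 * y $ fst e"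
        by (simp add: algebra_simps power2_eq_square)
      also have "\<dots> = (c\<^sup>2 + \<mu> * s\<^sup>2) * y $ fst e + c * y $ snd e"
        unfolding a[OF eE] by (simp add: algebra_simps power2_eq_square)
      also have "\<dots> = y $ opposite v e + c * y $ v"
        using False \<open>snd e = v\<close> by (simp add: cs opposite_def)
      finally show ?thesis using False \<mu>s by (simp add: nonzero_eq_divide_eq)
    qed
  qed
  have img: "snd ` eigen_params \<mu> = {x. (transition_matrix E + c *\<^sub>R mat 1) *v x = 0}"
  proof (intro equalityI subsetI)
    fix y assume "y \<in> snd ` eigen_params \<mu>"
    then obtain a where p: "(a, y) \<in> eigen_params \<mu>" by auto
    then have "(\<Sum>e\<in>incident E v. y $ opposite v e + c * y $ v) / (\<mu> * s) = 0" for v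
      using val[of a y v] by (simp add: eigen_params_def flip: s_def c_def)
    then show "y \<in> {x. (transition_matrix E + c *\<^sub>R mat 1) *v x = 0}"
      using \<mu>s by (simp add: transition_kernel_iff)
  next
    fix y assume "y \<in> {x. (transition_matrix E + c *\<^sub>R mat 1) *v x = 0}"
    then have k: "(\<Sum>e\<in>incident E v. y $ opposite v e + c * y $ v) = 0" for v
      by (simp add: transition_kernel_iff)
    define a :: "real^('v \<times> 'v)" where
      "a = (\<chi> e. if e \<in> E then (y $ snd e + c * y $ fst e) / (\<mu> * s) else 0)"
    have a: "\<mu> * s * a $ e = y $ snd e + c * y $ fst e" if "e \<in> E" for e
      using that \<mu>s by (simp add: a_def)
    have "(a, y) \<in> eigen_params \<mu>"
      unfolding eigen_params_def mem_Collect_eq case_prod_conv s_def[symmetric] c_def[symmetric]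
    proof (intro conjI allI impI ballI)
      show "a $ e = 0" if "e \<notin> E" for e using that by (simp add: a_def)
      show "vsum (\<lambda>e. a $ e) (\<lambda>e. c * a $ e + s * y $ fst e) v = 0" for v
        using k[of v] by (subst val) (simp_all add: a)
    qed (rule a)
    then show "y \<in> snd ` eigen_params \<mu>" by force
  qed
  have "inj_on snd (eigen_params \<mu>)"
  proof (rule inj_onI)
    fix p q assume pq: "p \<in> eigen_params \<mu>" "q \<in> eigen_params \<mu>" "snd p = snd q"
    obtain a y where p: "p = (a, y)" by (cases p)
    obtain b where q: "q = (b, y)" using pq(3) p by (cases q) auto
    have "a $ e = b $ e" for e
    proof (cases "e \<in> E")
      case True
      then have "\<mu> * s * a $ e = \<mu> * s * b $ e"
        using pq by (simp add: p q eigen_params_def s_def)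
      then show ?thesis using \<mu>s by simp
    next
      case False
      then have "a $ e = 0" "b $ e = 0" using pq unfolding p q eigen_params_def by blast+
      then show ?thesis by simp
    qed
    then show "p = q" by (simp add: p q vec_eq_iff)
  qed
  then have "dim (snd ` eigen_params \<mu>) = dim (eigen_params \<mu>)"
    by (intro dim_image_eq linear_snd) (simp add: span_eq_iff[THEN iffD2, OF subspace_eigen_params])
  then show ?thesis using img by (simp add: mult_eq_dim c_def)
qed

end

section \<open>The resolvent set\<close>

type_synonym 'v edge_data = "(real^('v \<times> 'v)) \<times> (real^('v \<times> 'v))"

lemma norm_vec_le:
  fixes x :: "real^'n" and B :: real
  assumes "\<And>i. \<bar>x $ i\<bar> \<le> B"
  shows "norm x \<le> CARD('n) * B"
  using norm_le_l1_cart[of x] sum_bounded_above[of UNIV "\<lambda>i. \<bar>x $ i\<bar>" B] assms by simp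

context equilateral_graph
begin

text \<open>
  \<open>(a, b)\<close> are the initial data at the endpoints \<open>0\<close>, and \<open>(p, q)\<close> the contribution of the source term at the
  endpoints \<open>le\<close>. The vertex conditions at \<open>v\<close> hold iff, for every edge end at \<open>v\<close>, the sum of the values at \<open>v\<close>
  plus the deviation of this outgoing derivative from the mean vanishes: as many equations as unknowns.
\<close>

definition residual :: "real \<Rightarrow> 'v edge_data \<times> 'v edge_data \<Rightarrow>
    'v edge_data" where
  "residual \<mu> = (\<lambda>((a, b), (p, q)).
     let F = (\<lambda>e. cosf \<mu> le * a $ e + sinf \<mu> le * b $ e + p $ e);
         D = (\<lambda>e. cosf \<mu> le * b $ e - \<mu> * sinf \<mu> le * a $ e + q $ e);
         m = (\<lambda>v. vsum (\<lambda>e. b $ e) (\<lambda>e. - D e) v / card (incident E v));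
         w = vsum (\<lambda>e. a $ e) F
     in (\<chi> e. if e \<in> E then w (fst e) + (b $ e - m (fst e)) else a $ e,
         \<chi> e. if e \<in> E then w (snd e) + (- D e - m (snd e)) else b $ e))"

lemma linear_residual: "linear (residual \<mu>)"
proof (rule linearI)
  fix x y :: "'v edge_data \<times> 'v edge_data"
  obtain a b p q where x: "x = ((a, b), (p, q))" by (metis prod.collapse)
  obtain a' b' p' q' where y: "y = ((a', b'), (p', q'))" by (metis prod.collapse)
  have 1: "vsum (\<lambda>e. (a + a') $ e) (\<lambda>e. cosf \<mu> le * (a + a') $ e + sinf \<mu> le * (b + b') $ e + (p + p') $ e) v
     = vsum (\<lambda>e. a $ e) (\<lambda>e. cosf \<mu> le * a $ e + sinf \<mu> le * b $ e + p $ e) v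
     + vsum (\<lambda>e. a' $ e) (\<lambda>e. cosf \<mu> le * a' $ e + sinf \<mu> le * b' $ e + p' $ e) v" for v
    unfolding vsum_add[symmetric] by (simp add: algebra_simps)
  have 2: "vsum (\<lambda>e. (b + b') $ e) (\<lambda>e. - (cosf \<mu> le * (b + b') $ e - \<mu> * sinf \<mu> le * (a + a') $ e + (q + q') $ e)) v
     = vsum (\<lambda>e. b $ e) (\<lambda>e. - (cosf \<mu> le * b $ e - \<mu> * sinf \<mu> le * a $ e + q $ e)) v
     + vsum (\<lambda>e. b' $ e) (\<lambda>e. - (cosf \<mu> le * b' $ e - \<mu> * sinf \<mu> le * a' $ e + q' $ e)) v" for v
    unfolding vsum_add[symmetric] by (simp add: algebra_simps)
  show "residual \<mu> (x + y) = residual \<mu> x + residual \<mu> y"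
    unfolding x y residual_def Let_def add_Pair case_prod_conv 1 2
    by (simp add: vec_eq_iff add_divide_distrib algebra_simps)
next
  fix c and x :: "'v edge_data \<times> 'v edge_data"
  obtain a b p q where x: "x = ((a, b), (p, q))" by (metis prod.collapse)
  have 1: "vsum (\<lambda>e. (c *\<^sub>R a) $ e) (\<lambda>e. cosf \<mu> le * (c *\<^sub>R a) $ e + sinf \<mu> le * (c *\<^sub>R b) $ e + (c *\<^sub>R p) $ e) v
     = c * vsum (\<lambda>e. a $ e) (\<lambda>e. cosf \<mu> le * a $ e + sinf \<mu> le * b $ e + p $ e) v" for v
    unfolding vsum_scale[symmetric] by (simp add: algebra_simps)
  have 2: "vsum (\<lambda>e. (c *\<^sub>R b) $ e) (\<lambda>e. - (cosf \<mu> le * (c *\<^sub>R b) $ e - \<mu> * sinf \<mu> le * (c *\<^sub>R a) $ e + (c *\<^sub>R q) $ e)) v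
     = c * vsum (\<lambda>e. b $ e) (\<lambda>e. - (cosf \<mu> le * b $ e - \<mu> * sinf \<mu> le * a $ e + q $ e)) v" for v
    unfolding vsum_scale[symmetric] by (simp add: algebra_simps)
  show "residual \<mu> (c *\<^sub>R x) = c *\<^sub>R residual \<mu> x"
    unfolding x residual_def Let_def scaleR_Pair case_prod_conv 1 2
    by (simp add: vec_eq_iff algebra_simps)
qed

text \<open>Indices outside \<open>E\<close> carry the padding equations \<open>a $ e = 0\<close>
  and \<open>b $ e = 0\<close>, so the system is square over the whole index type.\<close>

lemma residual_eq_0_iff:
  "residual \<mu> ((a, b), (p, q)) = 0 \<longleftrightarrow> (\<forall>e. e \<notin> E \<longrightarrow> a $ e = 0 \<and> b $ e = 0) \<and>
     vertex_cond (\<lambda>e. a $ e) (\<lambda>e. b $ e) (\<lambda>e. cosf \<mu> le * a $ e + sinf \<mu> le * b $ e + p $ e)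
       (\<lambda>e. cosf \<mu> le * b $ e - \<mu> * sinf \<mu> le * a $ e + q $ e)"
proof -
  define F where "F e = cosf \<mu> le * a $ e + sinf \<mu> le * b $ e + p $ e" for e
  define D where "D e = cosf \<mu> le * b $ e - \<mu> * sinf \<mu> le * a $ e + q $ e" for e
  define m where "m v = vsum (\<lambda>e. b $ e) (\<lambda>e. - D e) v / card (incident E v)" for v
  define w where "w = vsum (\<lambda>e. a $ e) F"
  define out where "out v e = (if fst e = v then b $ e else - D e)" for v e
  have res: "residual \<mu> ((a, b), (p, q)) =
     (\<chi> e. if e \<in> E then w (fst e) + (b $ e - m (fst e)) else a $ e,
         \<chi> e. if e \<in> E then w (snd e) + (- D e - m (snd e)) else b $ e)"
    unfolding residual_def Let_def case_prod_conv F_def[abs_def] D_def[abs_def] m_def[abs_def] w_def ..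
  have m: "m v * card (incident E v) = (\<Sum>e\<in>incident E v. out v e)" for v
    using incident_nonempty[of v] by (simp add: m_def vsum_def out_def)
  have "residual \<mu> ((a, b), (p, q)) = 0 \<longleftrightarrow> (\<forall>e. e \<notin> E \<longrightarrow> a $ e = 0 \<and> b $ e = 0) \<and>
     (\<forall>e\<in>E. w (fst e) + (b $ e - m (fst e)) = 0 \<and> w (snd e) + (- D e - m (snd e)) = 0)"
    unfolding res zero_prod_def prod.inject vec_eq_iff by (auto split: if_splits)
  also have "(\<forall>e\<in>E. w (fst e) + (b $ e - m (fst e)) = 0 \<and> w (snd e) + (- D e - m (snd e)) = 0) \<longleftrightarrow>
      (\<forall>v. \<forall>e\<in>incident E v. w v + (out v e - m v) = 0)"
  proof (intro iffI ballI allI)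
    fix v e
    assume "\<forall>e\<in>E. w (fst e) + (b $ e - m (fst e)) = 0 \<and> w (snd e) + (- D e - m (snd e)) = 0" "e \<in> incident E v"
    then show "w v + (out v e - m v) = 0" by (auto simp: incident_def out_def)
  next
    fix e assume *: "\<forall>v. \<forall>e\<in>incident E v. w v + (out v e - m v) = 0" and e: "e \<in> E"
    have "e \<in> incident E (fst e)" "e \<in> incident E (snd e)" using e by (auto simp: incident_def)
    then have "w (fst e) + (out (fst e) e - m (fst e)) = 0" "w (snd e) + (out (snd e) e - m (snd e)) = 0"
      using * by blast+
    then show "w (fst e) + (b $ e - m (fst e)) = 0 \<and> w (snd e) + (- D e - m (snd e)) = 0"
      using fst_neq_snd[OF e] by (simp add: out_def)
  qed
  also have "\<dots> \<longleftrightarrow> (\<forall>v. (\<forall>e\<in>incident E v. \<forall>e'\<in>incident E v. out v e = out v e') \<and> w v = 0)"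
  proof (intro all_cong1 iffI conjI ballI)
    fix v assume *: "\<forall>e\<in>incident E v. w v + (out v e - m v) = 0"
    show "out v e = out v e'" if "e \<in> incident E v" "e' \<in> incident E v" for e e'
      using *[rule_format, OF that(1)] *[rule_format, OF that(2)] by simp
    \<comment> \<open>Deviations from a mean add up to zero, which isolates the degree times
      \<open>w v\<close>.\<close>
    have "(\<Sum>e\<in>incident E v. w v + (out v e - m v)) = 0" using * by simp
    then have "card (incident E v) * w v = 0"
      using m[of v] by (simp add: sum.distrib sum_subtractf mult.commute)
    then show "w v = 0" using incident_nonempty[of v] by simp
  next
    fix v e assume *: "(\<forall>e\<in>incident E v. \<forall>e'\<in>incident E v. out v e = out v e') \<and> w v = 0"
      and e: "e \<in> incident E v"
    have "(\<Sum>e'\<in>incident E v. out v e') = (\<Sum>e'\<in>incident E v. out v e)"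
      by (rule sum.cong[OF refl]) (use * e in blast)
    then have "m v * card (incident E v) = out v e * card (incident E v)"
      unfolding m by (simp add: mult.commute)
    then have "m v = out v e" using incident_nonempty[of v] by simp
    then show "w v + (out v e - m v) = 0" using * by simp
  qed
  finally show ?thesis
    unfolding vertex_cond_def out_def w_def F_def[abs_def] D_def[abs_def] .
qed

text \<open>Values and derivatives at the endpoints \<open>le\<close> of the solutions with source
  \<open>g\<close> and zero initial data.\<close>

definition source_data :: "real \<Rightarrow> 'v gfun \<Rightarrow> 'v edge_data" where
  "source_data \<mu> g =
     (\<chi> e. if e \<in> E then Sint \<mu> (g e) le * cosf \<mu> le - Cint \<mu> (g e) le * sinf \<mu> le else 0,
      \<chi> e. if e \<in> E then - Cint \<mu> (g e) le * cosf \<mu> le - \<mu> * (Sint \<mu> (g e) le * sinf \<mu> le) else 0)"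

definition sol_of :: "real \<Rightarrow> 'v edge_data \<Rightarrow> 'v gfun \<Rightarrow> 'v gfun" where
  "sol_of \<mu> X g = gsol \<mu> (\<lambda>e. fst X $ e) (\<lambda>e. snd X $ e) g"

definition initial_data :: "'v gfun \<Rightarrow> 'v edge_data" where
  "initial_data f = (\<chi> e. f e 0, \<chi> e. gderiv E len f e 0)"

lemma residual_source_iff:
  assumes g: "g \<in> L2 E len"
  shows "residual \<mu> (X, source_data \<mu> g) = 0 \<longleftrightarrow>
    (\<forall>e. e \<notin> E \<longrightarrow> fst X $ e = 0 \<and> snd X $ e = 0) \<and> sol_of \<mu> X g \<in> anti_standard_domain E len"
proof -
  obtain a b where X: "X = (a, b)" by (cases X)
  have "vertex_cond (\<lambda>e. a $ e) (\<lambda>e. b $ e)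
      (\<lambda>e. cosf \<mu> le * a $ e + sinf \<mu> le * b $ e + fst (source_data \<mu> g) $ e)
      (\<lambda>e. cosf \<mu> le * b $ e - \<mu> * sinf \<mu> le * a $ e + snd (source_data \<mu> g) $ e)
    \<longleftrightarrow> vertex_cond (\<lambda>e. a $ e) (\<lambda>e. b $ e) (\<lambda>e. ode_sol \<mu> (a $ e) (b $ e) (g e) le)
      (\<lambda>e. ode_sol' \<mu> (a $ e) (b $ e) (g e) le)"
    by (intro vertex_cond_cong) (auto simp: source_data_def ode_sol_def ode_sol'_def algebra_simps)
  then show ?thesis
    using residual_eq_0_iff[of \<mu> a b "fst (source_data \<mu> g)" "snd (source_data \<mu> g)"]
    by (simp add: X sol_of_def gsol_anti_standard_iff[OF g])
qed

lemma domain_solution: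
  assumes f: "f \<in> anti_standard_domain E len" and g: "g \<in> L2 E len"
    and ae: "ae_eq E len (\<lambda>e x. laplacian E len f e x - \<mu> * f e x) g"
  shows "f = sol_of \<mu> (initial_data f) g" and "residual \<mu> (initial_data f, source_data \<mu> g) = 0"
proof -
  have md: "f \<in> maximal_domain E len" using f by (simp add: anti_standard_domain_iff)
  show eq: "f = sol_of \<mu> (initial_data f) g"
    using maximal_domain_representation(1)[OF md g ae] by (simp add: sol_of_def initial_data_def)
  have "f e 0 = 0 \<and> gderiv E len f e 0 = 0" if "e \<notin> E" for e
  proof
    show "f e 0 = 0" using md that unfolding maximal_domain_def L2_iff by blast
    show "gderiv E len f e 0 = 0" using that by (simp add: gderiv_def)
  qed
  then show "residual \<mu> (initial_data f, source_data \<mu> g) = 0"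
    unfolding residual_source_iff[OF g] using f by (simp add: initial_data_def flip: eq) (simp add: initial_data_def[symmetric] flip: eq)
qed

text \<open>For fixed source data 0, \<open>residual\<close> maps a finite-dimensional space to
  itself, so injectivity suffices, and a kernel vector would be the initial data of a nonzero
  eigenfunction. Linearity of \<open>G\<close> later supplies the bound on the inverse.\<close>

lemma residual_invertible:
  assumes triv: "anti_standard_eigenspace E len \<mu> \<subseteq> {\<lambda>e x. 0}"
  obtains G where "linear G" "\<And>X W. residual \<mu> (X, W) = 0 \<longleftrightarrow> X = G W"
proof -
  define L where "L X = residual \<mu> (X, 0)" for X
  define M where "M W = residual \<mu> (0, W)" for W
  have split: "residual \<mu> (X, W) = L X + M W" for X W
    using linear_add[OF linear_residual, of \<mu> "(X, 0)" "(0, W)"] by (simp add: L_def M_def)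
  have linL: "linear L"
    using linear_add[OF linear_residual, of \<mu> "(_, 0)" "(_, 0)"] linear_scale[OF linear_residual, of \<mu> _ "(_, 0)"]
    by (intro linearI) (simp_all add: L_def)
  have linM: "linear M"
    using linear_add[OF linear_residual, of \<mu> "(0, _)" "(0, _)"] linear_scale[OF linear_residual, of \<mu> _ "(0, _)"]
    by (intro linearI) (simp_all add: M_def)
  have src0: "source_data \<mu> (\<lambda>e x. 0) = 0"
    by (simp add: source_data_def Sint_def Cint_def zero_prod_def vec_eq_iff)
  have "X = 0" if "L X = 0" for X
  proof -
    have X: "(\<forall>e. e \<notin> E \<longrightarrow> fst X $ e = 0 \<and> snd X $ e = 0)" "sol_of \<mu> X (\<lambda>e x. 0) \<in> anti_standard_domain E len"
      using residual_source_iff[OF L2_zero, of \<mu> X] that by (auto simp: L_def src0)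
    have "sol_of \<mu> X (\<lambda>e x. 0) \<in> anti_standard_eigenspace E len \<mu>"
      unfolding eigenspace_iff using X(2) ae_eq_gsol[OF L2_zero] by (simp add: sol_of_def)
    then have zero: "sol_of \<mu> X (\<lambda>e x. 0) = (\<lambda>e x. 0)" using triv by blast
    have "fst X $ e = 0" if "e \<in> E" for e
    proof -
      have "sol_of \<mu> X (\<lambda>e x. 0) e 0 = 0" by (simp add: zero)
      then show ?thesis using that le_pos by (simp add: sol_of_def gsol_def)
    qed
    moreover have "snd X $ e = 0" if "e \<in> E" for e
    proof -
      have "gderiv E len (sol_of \<mu> X (\<lambda>e x. 0)) e 0 = 0"
        unfolding zero by (rule gderiv_eq[OF that]) (use le_pos in auto)
      then show ?thesis using that le_pos by (simp add: sol_of_def gderiv_gsol[OF L2_zero] gsol'_def)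
    qed
    ultimately show "X = 0" using X(1) by (metis (no_types) prod_eq_iff vec_eq_iff zero_index fst_zero snd_zero)
  qed
  then have "inj L" using linear_injective_0[OF linL] by blast
  then obtain L' where L': "linear L'" "\<And>X. L' (L X) = X" "\<And>X. L (L' X) = X"
    using linear_injective_isomorphism[OF linL] by blast
  show thesis
  proof (rule that[of "\<lambda>W. L' (- M W)"])
    show "linear (\<lambda>W. L' (- M W))"
      using linear_compose[OF linear_compose_neg[OF linM] L'(1)] by (simp add: o_def)
    show "residual \<mu> (X, W) = 0 \<longleftrightarrow> X = L' (- M W)" for X W
      unfolding split by (metis L'(2,3) add_eq_0_iff2 add_eq_0_iff)
  qed
qed

section \<open>Boundedness of the solution operator\<close>

lemma L2_norm_eq:
  assumes f: "f \<in> L2 E len"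
  shows "L2_norm E len f = sqrt (\<Sum>e\<in>E. integral {0..le} (\<lambda>x. (f e x)\<^sup>2))"
  unfolding L2_norm_def using f
  by (intro arg_cong[of _ _ sqrt] sum.cong refl)
    (simp add: len_eq L2_iff square_integrable_def lebesgue_integral_eq_integral)

lemma integral_edge_le_L2_norm:
  assumes g: "g \<in> L2 E len" and e: "e \<in> E"
  shows "integral {0..le} (\<lambda>x. \<bar>g e x\<bar>) \<le> sqrt le * L2_norm E len g"
proof -
  have ge: "square_integrable 0 le (g e)" if "e \<in> E" for e using g that by (simp add: L2_iff)
  have "integral {0..le} (\<lambda>x. (g e x)\<^sup>2) \<le> (\<Sum>e\<in>E. integral {0..le} (\<lambda>x. (g e x)\<^sup>2))"
    using e ge square_integrable_integrable_on(3) by (intro member_le_sum integral_nonneg) auto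
  then have "sqrt (integral {0..le} (\<lambda>x. (g e x)\<^sup>2)) \<le> L2_norm E len g"
    by (simp add: L2_norm_eq[OF g])
  then have "sqrt le * sqrt (integral {0..le} (\<lambda>x. (g e x)\<^sup>2)) \<le> sqrt le * L2_norm E len g"
    using le_pos by (intro mult_left_mono) auto
  then show ?thesis using integral_abs_le_sqrt[OF ge[OF e] le_pos] by simp
qed

lemma L2_norm_le_sup:
  assumes f: "f \<in> L2 E len" and B: "\<And>e x. \<lbrakk>e \<in> E; x \<in> {0..le}\<rbrakk> \<Longrightarrow> \<bar>f e x\<bar> \<le> B"
  shows "L2_norm E len f \<le> sqrt (card E * le) * \<bar>B\<bar>"
proof -
  have "integral {0..le} (\<lambda>x. (f e x)\<^sup>2) \<le> le * B\<^sup>2" if e: "e \<in> E" for e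
  proof -
    have "integral {0..le} (\<lambda>x. (f e x)\<^sup>2) \<le> integral {0..le} (\<lambda>x. B\<^sup>2)"
    proof (rule integral_le)
      show "(\<lambda>x. (f e x)\<^sup>2) integrable_on {0..le}"
        using f e square_integrable_integrable_on(3) by (simp add: L2_iff)
      show "(f e x)\<^sup>2 \<le> B\<^sup>2" if "x \<in> {0..le}" for x
        using B[OF e that] by (intro abs_le_square_iff[THEN iffD1]) auto
    qed auto
    then show ?thesis using le_pos by simp
  qed
  then have "(\<Sum>e\<in>E. integral {0..le} (\<lambda>x. (f e x)\<^sup>2)) \<le> (\<Sum>e\<in>E. le * B\<^sup>2)" by (rule sum_mono)
  then have "L2_norm E len f \<le> sqrt (card E * le * B\<^sup>2)"
    unfolding L2_norm_eq[OF f] by (simp add: mult.assoc)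
  then show ?thesis by (simp add: real_sqrt_mult)
qed

text \<open>By Cauchy-Schwarz, \<open>T = sqrt le * L2_norm E len g\<close> dominates the integral
  of \<bar>g\<bar> on each edge. The source data, the initial data and the solution are bounded
  pointwise by multiples of \<open>T\<close>, and on edges of finite length a pointwise bound gives
  an L2 bound.\<close>

lemma solution_bound:
  assumes G: "linear G" "\<And>X W. residual \<mu> (X, W) = 0 \<longleftrightarrow> X = G W"
  obtains C where "\<And>g f. \<lbrakk>g \<in> L2 E len; f = sol_of \<mu> (G (source_data \<mu> g)) g; f \<in> L2 E len\<rbrakk>
    \<Longrightarrow> L2_norm E len f \<le> C * L2_norm E len g"
proof -
  obtain K where K: "0 < K" "\<And>W. norm (G W) \<le> K * norm W"
    using linear_bounded_pos[OF G(1)] by blast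
  have "bounded (cosf \<mu> ` {0..le} \<union> sinf \<mu> ` {0..le})"
    by (intro bounded_Un[THEN iffD2] conjI compact_imp_bounded compact_continuous_image
        continuous_on_cosf continuous_on_sinf compact_Icc)
  then have "\<exists>M. \<forall>x\<in>{0..le}. \<bar>cosf \<mu> x\<bar> \<le> M \<and> \<bar>sinf \<mu> x\<bar> \<le> M"
    unfolding bounded_iff by auto
  then obtain M where M: "\<And>x. x \<in> {0..le} \<Longrightarrow> \<bar>cosf \<mu> x\<bar> \<le> M" "\<And>x. x \<in> {0..le} \<Longrightarrow> \<bar>sinf \<mu> x\<bar> \<le> M"
    by blast
  have M0: "0 \<le> M" using M(1)[of 0] le_pos by simp
  \<comment> \<open>\<open>c\<close> counts the components of an edge vector. \<open>K1\<close>
    bounds each source component: two products for values, and factors 1 and \<bar>\<mu>\<bar> for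
    derivatives. \<open>K2\<close> bounds the initial data through the sum of the two vector norms,
    and \<open>K3\<close> the two products in the solution formula.\<close>
  define c where "c = real CARD('v \<times> 'v)"
  define K1 where "K1 = (2 + \<bar>\<mu>\<bar>) * (M * M)"
  define K2 where "K2 = K * (c * K1 + c * K1)"
  define K3 where "K3 = (K2 + M) * M + (K2 + M) * M"
  have K0: "0 \<le> K1" "0 \<le> K2" using M0 K by (auto simp: K1_def K2_def c_def)
  show thesis
  proof (rule that[of "sqrt (card E * le) * (K3 * sqrt le)"])
    fix g f assume g: "g \<in> L2 E len" and f: "f = sol_of \<mu> (G (source_data \<mu> g)) g" and fL2: "f \<in> L2 E len"
    define T where "T = sqrt le * L2_norm E len g"
    have T0: "0 \<le> T" using le_pos by (simp add: T_def L2_norm_eq[OF g] sum_nonneg integral_nonneg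
      square_integrable_integrable_on(3) g[unfolded L2_iff])
    have int: "\<bar>Sint \<mu> (g e) x\<bar> \<le> M * T \<and> \<bar>Cint \<mu> (g e) x\<bar> \<le> M * T" if e: "e \<in> E" and x: "x \<in> {0..le}" for e x
    proof -
      have ge: "square_integrable 0 le (g e)" using g e by (simp add: L2_iff)
      have "M * integral {0..le} (\<lambda>x. \<bar>g e x\<bar>) \<le> M * T"
        unfolding T_def by (intro mult_left_mono integral_edge_le_L2_norm g e M0)
      then show ?thesis
        using abs_integral_le[OF ge continuous_on_sinf M(2) x] abs_integral_le[OF ge continuous_on_cosf M(1) x]
        unfolding Sint_def Cint_def by linarith
    qed
    have le_mem: "le \<in> {0..le}" using le_pos by simp
    have prod_le: "\<bar>u * v\<bar> \<le> (M * T) * M" if "\<bar>u\<bar> \<le> M * T" "\<bar>v\<bar> \<le> M" for u v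
      unfolding abs_mult using that by (intro mult_mono) auto
    define p where "p = fst (source_data \<mu> g)"
    define q where "q = snd (source_data \<mu> g)"
    have pq: "\<bar>p $ e\<bar> \<le> K1 * T \<and> \<bar>q $ e\<bar> \<le> K1 * T" for e
    proof (cases "e \<in> E")
      case True
      note i = int[OF True le_mem]
      note b = prod_le[OF conjunct1[OF i] M(1)[OF le_mem]] prod_le[OF conjunct2[OF i] M(2)[OF le_mem]]
        prod_le[OF conjunct2[OF i] M(1)[OF le_mem]] prod_le[OF conjunct1[OF i] M(2)[OF le_mem]]
      have "\<bar>\<mu> * (Sint \<mu> (g e) le * sinf \<mu> le)\<bar> \<le> \<bar>\<mu>\<bar> * ((M * T) * M)"
        unfolding abs_mult[of \<mu>] by (intro mult_left_mono b) auto
      moreover have "p $ e = Sint \<mu> (g e) le * cosf \<mu> le - Cint \<mu> (g e) le * sinf \<mu> le"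
        "q $ e = - (Cint \<mu> (g e) le * cosf \<mu> le) - \<mu> * (Sint \<mu> (g e) le * sinf \<mu> le)"
        using True by (simp_all add: p_def q_def source_data_def)
      moreover have "K1 * T = (M * T) * M + (M * T) * M + \<bar>\<mu>\<bar> * ((M * T) * M)"
        by (simp add: K1_def algebra_simps)
      moreover have "0 \<le> (M * T) * M" "0 \<le> \<bar>\<mu>\<bar> * ((M * T) * M)" using M0 T0 by auto
      ultimately show ?thesis using b by linarith
    qed (use K0 T0 in \<open>simp add: p_def q_def source_data_def\<close>)
    have "norm (source_data \<mu> g) \<le> norm p + norm q"
      unfolding p_def q_def using norm_Pair_le[of "fst (source_data \<mu> g)" "snd (source_data \<mu> g)"] by simp
    also have "\<dots> \<le> c * (K1 * T) + c * (K1 * T)"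
    proof (rule add_mono)
      show "norm p \<le> c * (K1 * T)"
        unfolding c_def by (rule norm_vec_le) (rule pq[THEN conjunct1])
      show "norm q \<le> c * (K1 * T)"
        unfolding c_def by (rule norm_vec_le) (rule pq[THEN conjunct2])
    qed
    finally have n: "norm (source_data \<mu> g) \<le> c * (K1 * T) + c * (K1 * T)" .
    have "norm (G (source_data \<mu> g)) \<le> K * (c * (K1 * T) + c * (K1 * T))"
      by (rule order_trans[OF K(2) mult_left_mono[OF n less_imp_le[OF K(1)]]])
    also have "\<dots> = K2 * T" by (simp add: K2_def algebra_simps)
    finally have X: "norm (G (source_data \<mu> g)) \<le> K2 * T" .
    define A where "A = fst (G (source_data \<mu> g))"
    define B where "B = snd (G (source_data \<mu> g))"
    have "norm (A, B) \<le> K2 * T" using X by (simp add: A_def B_def)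
    then have AB: "\<bar>A $ e\<bar> \<le> K2 * T" "\<bar>B $ e\<bar> \<le> K2 * T" for e
      using component_le_norm_cart[of A e] component_le_norm_cart[of B e]
        norm_fst_le[of A B] norm_snd_le[of B A] by linarith+
    have "\<bar>f e x\<bar> \<le> K3 * T" if e: "e \<in> E" and x: "x \<in> {0..le}" for e x
    proof -
      have fe: "f e x = (A $ e + Sint \<mu> (g e) x) * cosf \<mu> x + (B $ e - Cint \<mu> (g e) x) * sinf \<mu> x"
        using e x by (simp add: f sol_of_def gsol_def ode_sol_def A_def B_def)
      have ab: "\<bar>A $ e + Sint \<mu> (g e) x\<bar> \<le> (K2 + M) * T" "\<bar>B $ e - Cint \<mu> (g e) x\<bar> \<le> (K2 + M) * T"
        unfolding distrib_right using AB[of e] int[OF e x] by linarith+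
      have nn: "0 \<le> (K2 + M) * T" using K0 M0 T0 by simp
      have "\<bar>(A $ e + Sint \<mu> (g e) x) * cosf \<mu> x\<bar> \<le> (K2 + M) * T * M"
        unfolding abs_mult by (rule mult_mono[OF ab(1) M(1)[OF x] nn abs_ge_zero])
      moreover have "\<bar>(B $ e - Cint \<mu> (g e) x) * sinf \<mu> x\<bar> \<le> (K2 + M) * T * M"
        unfolding abs_mult by (rule mult_mono[OF ab(2) M(2)[OF x] nn abs_ge_zero])
      ultimately have "\<bar>f e x\<bar> \<le> (K2 + M) * T * M + (K2 + M) * T * M" unfolding fe by linarith
      also have "\<dots> = K3 * T" by (simp add: K3_def algebra_simps)
      finally show ?thesis .
    qed
    then have "L2_norm E len f \<le> sqrt (card E * le) * \<bar>K3 * T\<bar>" by (rule L2_norm_le_sup[OF fL2])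
    also have "\<bar>K3 * T\<bar> = K3 * T" using K0 M0 T0 by (simp add: K3_def)
    finally show "L2_norm E len f \<le> sqrt (card E * le) * (K3 * sqrt le) * L2_norm E len g"
      by (simp add: T_def mult.assoc)
  qed
qed

section \<open>The spectrum as the set of eigenvalues\<close>

lemma L2_laplacian_diff:
  assumes f: "f \<in> maximal_domain E len"
  shows "(\<lambda>e x. laplacian E len f e x - \<mu> * f e x) \<in> L2 E len"
proof -
  have "f \<in> L2 E len" "laplacian E len f \<in> L2 E len" using f by (auto simp: maximal_domain_def)
  then have z: "f e x = 0" "laplacian E len f e x = 0" if "\<not> (e \<in> E \<and> x \<in> {0..le})" for e x
    using that unfolding L2_iff by blast+
  have "square_integrable 0 le (\<lambda>x. laplacian E len f e x + (- \<mu>) * f e x)" if "e \<in> E" for e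
    using \<open>f \<in> L2 E len\<close> \<open>laplacian E len f \<in> L2 E len\<close> that
    by (intro square_integrable_add square_integrable_mult_continuous) (auto simp: L2_iff)
  then show ?thesis
    unfolding L2_iff using z by simp
qed

lemma zero_in_eigenspace: "(\<lambda>e x. 0) \<in> anti_standard_eigenspace E len \<mu>"
proof -
  have "eigen_fun \<mu> 0 = (\<lambda>e x. 0)" by (simp add: eigen_fun_apply fun_eq_iff)
  then show ?thesis
    unfolding eigenspace_eq using subspace_0[OF subspace_eigen_params[of \<mu>]] by (metis image_eqI)
qed

lemma resolvent_set_iff:
  "\<mu> \<in> anti_standard_resolvent_set E len \<longleftrightarrow> anti_standard_eigenspace E len \<mu> \<subseteq> {\<lambda>e x. 0}"
proof
  assume res: "\<mu> \<in> anti_standard_resolvent_set E len"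
  have "\<exists>!f. f \<in> anti_standard_domain E len \<and>
             ae_eq E len (\<lambda>e x. laplacian E len f e x - \<mu> * f e x) (\<lambda>e x. 0)"
    using res L2_zero unfolding anti_standard_resolvent_set_def by blast
  then have "\<exists>!f. f \<in> anti_standard_eigenspace E len \<mu>" by (simp add: eigenspace_iff)
  then show "anti_standard_eigenspace E len \<mu> \<subseteq> {\<lambda>e x. 0}"
    using zero_in_eigenspace by blast
next
  assume triv: "anti_standard_eigenspace E len \<mu> \<subseteq> {\<lambda>e x. 0}"
  have "\<exists>G. linear G \<and> (\<forall>X W. residual \<mu> (X, W) = 0 \<longleftrightarrow> X = G W)"
    by (rule residual_invertible[OF triv]) blast
  then obtain G where G: "linear G" "\<And>X W. residual \<mu> (X, W) = 0 \<longleftrightarrow> X = G W" by blast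
  have unique: "f = sol_of \<mu> (G (source_data \<mu> g)) g"
    if "g \<in> L2 E len" "f \<in> anti_standard_domain E len" "ae_eq E len (\<lambda>e x. laplacian E len f e x - \<mu> * f e x) g" for f g
    using domain_solution[OF that(2,1,3)] G(2) by simp
  have "\<exists>!f. f \<in> anti_standard_domain E len \<and> ae_eq E len (\<lambda>e x. laplacian E len f e x - \<mu> * f e x) g"
    if g: "g \<in> L2 E len" for g
  proof (rule ex1I)
    have "residual \<mu> (G (source_data \<mu> g), source_data \<mu> g) = 0" using G(2) by blast
    then show "sol_of \<mu> (G (source_data \<mu> g)) g \<in> anti_standard_domain E len \<and>
        ae_eq E len (\<lambda>e x. laplacian E len (sol_of \<mu> (G (source_data \<mu> g)) g) e x
          - \<mu> * sol_of \<mu> (G (source_data \<mu> g)) g e x) g"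
      unfolding residual_source_iff[OF g] using ae_eq_gsol[OF g] by (simp add: sol_of_def)
  qed (use unique[OF g] in blast)
  moreover have "\<exists>C. \<forall>f\<in>anti_standard_domain E len.
             L2_norm E len f \<le> C * L2_norm E len (\<lambda>e x. laplacian E len f e x - \<mu> * f e x)"
  proof -
    obtain C where C: "\<And>g f. \<lbrakk>g \<in> L2 E len; f = sol_of \<mu> (G (source_data \<mu> g)) g; f \<in> L2 E len\<rbrakk>
        \<Longrightarrow> L2_norm E len f \<le> C * L2_norm E len g"
      using solution_bound[OF G] by blast
    show ?thesis
    proof (intro exI[of _ C] ballI)
      fix f assume f: "f \<in> anti_standard_domain E len"
      define g where "g = (\<lambda>e x. laplacian E len f e x - \<mu> * f e x)"
      have md: "f \<in> maximal_domain E len" using f by (simp add: anti_standard_domain_iff)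
      have g: "g \<in> L2 E len" unfolding g_def by (rule L2_laplacian_diff[OF md])
      have "ae_eq E len (\<lambda>e x. laplacian E len f e x - \<mu> * f e x) g"
        by (simp add: g_def ae_eq_iff)
      then have "f = sol_of \<mu> (G (source_data \<mu> g)) g" by (rule unique[OF g f])
      moreover have "f \<in> L2 E len" using md by (simp add: maximal_domain_def)
      ultimately have "L2_norm E len f \<le> C * L2_norm E len g" using C[OF g] by blast
      then show "L2_norm E len f \<le> C * L2_norm E len (\<lambda>e x. laplacian E len f e x - \<mu> * f e x)"
        by (simp add: g_def)
    qed
  qed
  ultimately show "\<mu> \<in> anti_standard_resolvent_set E len"
    unfolding anti_standard_resolvent_set_def by blast
qed

lemma spectrum_iff: "\<mu> \<in> anti_standard_spectrum E len \<longleftrightarrow> anti_standard_mult E len \<mu> \<noteq> 0"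
proof -
  have "anti_standard_eigenspace E len \<mu> \<subseteq> {\<lambda>e x. 0} \<longleftrightarrow> eigen_params \<mu> \<subseteq> {0}"
  proof
    assume "eigen_params \<mu> \<subseteq> {0}"
    then show "anti_standard_eigenspace E len \<mu> \<subseteq> {\<lambda>e x. 0}"
      unfolding eigenspace_eq by (auto simp: eigen_fun_apply fun_eq_iff)
  next
    assume triv: "anti_standard_eigenspace E len \<mu> \<subseteq> {\<lambda>e x. 0}"
    show "eigen_params \<mu> \<subseteq> {0}"
    proof
      fix p assume p: "p \<in> eigen_params \<mu>"
      have "eigen_fun \<mu> q = (\<lambda>e x. 0)" if "q \<in> eigen_params \<mu>" for q
        using subsetD[OF triv[unfolded eigenspace_eq] imageI[OF that]] by (rule singletonD)
      from this[OF p] this[OF subspace_0[OF subspace_eigen_params]]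
      have "eigen_fun \<mu> p = eigen_fun \<mu> 0" by simp
      then have "p = 0"
        by (rule inj_onD[OF inj_on_eigen_fun _ p subspace_0[OF subspace_eigen_params]])
      then show "p \<in> {0}" by simp
    qed
  qed
  then show ?thesis
    unfolding anti_standard_spectrum_def mult_eq_dim by (simp add: resolvent_set_iff dim_eq_0)
qed

lemma transition_eigenvalue_iff:
  "- c \<in> eigenvalues (transition_matrix E) \<longleftrightarrow>
     dim {x. (transition_matrix E + c *\<^sub>R mat 1) *v x = 0} \<noteq> 0"
proof -
  have "(transition_matrix E + c *\<^sub>R mat 1) *v x = transition_matrix E *v x + c *\<^sub>R x" for x
    by (simp add: matrix_vector_mult_add_rdistrib scaleR_matrix_vector_assoc[symmetric])
  then have "(transition_matrix E + c *\<^sub>R mat 1) *v x = 0 \<longleftrightarrow> transition_matrix E *v x = (- c) *\<^sub>R x" for x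
    by (simp add: add_eq_0_iff2)
  then show ?thesis unfolding eigenvalues_def dim_eq_0 by auto
qed

text \<open>The rows of the transition matrix sum to 1. This places every \<mu> > 0 with cosine -1
  in the set of the theorem.\<close>

lemma one_in_eigenvalues: "1 \<in> eigenvalues (transition_matrix E)"
proof -
  have "(transition_matrix E + (-1) *\<^sub>R mat 1) *v vec 1 = 0"
    unfolding transition_kernel_iff by simp
  moreover have "(vec 1 :: real^'v) \<noteq> 0" by (simp add: vec_eq_iff)
  ultimately have "\<not> {x. (transition_matrix E + (-1) *\<^sub>R mat 1) *v x = 0} \<subseteq> {0}" by blast
  then show ?thesis
    using transition_eigenvalue_iff[of "-1"] by (simp add: dim_eq_0)
qed

end

theorem theorem3p3:
  fixes E :: "('v::finite \<times> 'v) set" and len :: "'v \<times> 'v \<Rightarrow> real" and le :: real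
  assumes "metric_graph E len" and "equilateral E len le"
  shows
    "let n = int CARD('v); N = int (card E); Z = transition_matrix E;
         m = anti_standard_mult E len;
         S = {0} \<union> {\<mu>. \<mu> > 0 \<and> - cos (sqrt \<mu> * le) \<in> eigenvalues Z}
               \<union> {\<mu>. \<mu> > 0 \<and> cos (sqrt \<mu> * le) = 1}
     in
       anti_standard_spectrum E len = {\<mu> \<in> S. m \<mu> \<noteq> 0} \<and>
       (N > n \<or> (N = n \<and> bipartite E) \<longrightarrow> anti_standard_spectrum E len = S) \<and>
       (\<forall>\<mu>. \<exists>B. finite B \<and> anti_standard_eigenspace E len \<mu> = gfun.span B) \<and>
       (bipartite E \<longrightarrow> int (m 0) = N - n + 1) \<and>
       (\<not> bipartite E \<longrightarrow> int (m 0) = N - n) \<and>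
       (\<forall>\<mu>>0.
          (sin (sqrt \<mu> * le) \<noteq> 0 \<longrightarrow>
             m \<mu> = dim {x. (Z + cos (sqrt \<mu> * le) *\<^sub>R mat 1) *v x = 0}) \<and>
          (cos (sqrt \<mu> * le) = -1 \<longrightarrow> int (m \<mu>) = N - n + 2) \<and>
          (cos (sqrt \<mu> * le) = 1 \<and> bipartite E \<longrightarrow> int (m \<mu>) = N - n + 2) \<and>
          (cos (sqrt \<mu> * le) = 1 \<and> \<not> bipartite E \<longrightarrow> int (m \<mu>) = N - n))"
proof -
  interpret equilateral_graph E len le using assms by unfold_locales
  define n where "n = int CARD('v)"
  define N where "N = int (card E)"
  define Z where "Z = transition_matrix E"
  define m where "m = anti_standard_mult E len"
  define S where "S = {0} \<union> {\<mu>. \<mu> > 0 \<and> - cos (sqrt \<mu> * le) \<in> eigenvalues Z}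
               \<union> {\<mu>. \<mu> > 0 \<and> cos (sqrt \<mu> * le) = 1}"
  have m0: "int (m 0) = N - n + (if bipartite E then 1 else 0)"
    using mult_0 dim_vertex_kernel_one unfolding m_def N_def n_def by (simp split: if_splits)
  have m_sin: "m \<mu> = dim {x. (Z + cos (sqrt \<mu> * le) *\<^sub>R mat 1) *v x = 0}"
    if "\<mu> > 0" "sin (sqrt \<mu> * le) \<noteq> 0" for \<mu>
    using mult_sin_nonzero[OF that(1)] that by (simp add: m_def Z_def sinf_def cosf_def)
  have m_cos: "int (m \<mu>) = N - n + 2 * int (dim (vertex_kernel (cos (sqrt \<mu> * le))))"
    if "\<mu> > 0" "sin (sqrt \<mu> * le) = 0" for \<mu>
    using mult_sin_0[of \<mu>] that unfolding m_def N_def n_def by (simp add: sinf_def cosf_def)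
  have sin0: "sin t = 0" if "cos t = 1 \<or> cos t = - 1" for t :: real
    using sin_squared_eq[of t] that by auto
  have cos1: "cos t = 1 \<or> cos t = - 1" if "sin t = 0" for t :: real
    using sin_cos_squared_add[of t] that by (simp add: power2_eq_1_iff)
  have m_minus: "int (m \<mu>) = N - n + 2" if "\<mu> > 0" "cos (sqrt \<mu> * le) = - 1" for \<mu>
    using m_cos[OF that(1) sin0] that(2) by (simp add: dim_vertex_kernel_minus_one)
  have m_plus: "int (m \<mu>) = N - n + (if bipartite E then 2 else 0)"
    if "\<mu> > 0" "cos (sqrt \<mu> * le) = 1" for \<mu>
    using m_cos[OF that(1) sin0] that(2) by (simp add: dim_vertex_kernel_one)
  have spec: "anti_standard_spectrum E len = {\<mu>. m \<mu> \<noteq> 0}"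
    using spectrum_iff by (auto simp: m_def)
  have sub: "\<mu> \<in> S" if "m \<mu> \<noteq> 0" for \<mu>
  proof -
    have "0 \<le> \<mu>" using mult_neg[of \<mu>] that by (force simp: m_def)
    moreover have "- cos (sqrt \<mu> * le) \<in> eigenvalues Z \<or> cos (sqrt \<mu> * le) = 1" if "\<mu> > 0"
    proof (cases "sin (sqrt \<mu> * le) = 0")
      case True
      \<comment> \<open>A vanishing sine leaves cosine 1 or -1, and cosine -1 corresponds to the
        eigenvalue 1 of \<open>Z\<close>.\<close>
      then show ?thesis using cos1 one_in_eigenvalues by (force simp: Z_def)
    next
      case False
      then show ?thesis
        using m_sin[OF that False] \<open>m \<mu> \<noteq> 0\<close> transition_eigenvalue_iff by (simp add: Z_def)
    qed
    ultimately show ?thesis by (auto simp: S_def)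
  qed
  \<comment> \<open>The condition on N and n makes N - n + 1 and N - n + 2 positive in the bipartite
    case and N - n positive otherwise, so no multiplicity of the integer cases vanishes.\<close>
  have sup: "m \<mu> \<noteq> 0" if ge: "N > n \<or> (N = n \<and> bipartite E)" and \<mu>: "\<mu> \<in> S" for \<mu>
  proof -
    consider "\<mu> = 0" | "\<mu> > 0" "cos (sqrt \<mu> * le) = 1" | "\<mu> > 0" "cos (sqrt \<mu> * le) = - 1"
      | "\<mu> > 0" "sin (sqrt \<mu> * le) \<noteq> 0" "- cos (sqrt \<mu> * le) \<in> eigenvalues Z"
      using \<mu> cos1[of "sqrt \<mu> * le"] unfolding S_def by blast
    then show ?thesis
    proof cases
      case 1
      then show ?thesis using m0 ge by (auto split: if_splits)
    next
      case 2
      then show ?thesis using m_plus[OF 2] ge by (auto split: if_splits)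
    next
      case 3
      then show ?thesis using m_minus[OF 3] ge by auto
    next
      case 4
      then show ?thesis
        using m_sin[OF 4(1,2)] transition_eigenvalue_iff by (simp add: Z_def)
    qed
  qed
  have A: "anti_standard_spectrum E len = {\<mu> \<in> S. m \<mu> \<noteq> 0}"
    unfolding spec using sub by blast
  have B: "anti_standard_spectrum E len = S" if "N > n \<or> (N = n \<and> bipartite E)"
    unfolding spec using sub sup[OF that] by blast
  show ?thesis
    unfolding Let_def n_def[symmetric] N_def[symmetric] Z_def[symmetric] m_def[symmetric] S_def[symmetric]
    using A B eigenspace_finite_span m0 m_sin m_minus m_plus by auto
qed

end
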